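(* Let $\beta>0$, $\beta'=\beta/2$, and let $(a_n)_n,(b_n)_n$ be positive parameters such that $$\frac{a_n}{n}\xrightarrow[n\to\infty]{}\infty,\qquad \frac{a_n}{b_n}\xrightarrow[n\to\infty]{}\sigma\in(0,\infty),\qquad \sqrt{\frac{b_n}{n}}\Big(\sigma-\frac{a_n}{b_n}\Big)\xrightarrow[n\to\infty]{}0 .$$ For each $n$ let $(\lambda_1,\dots,\lambda_n;w_1,\dots,w_n)\sim\mathcal{J}\beta\mathcal{E}(a_n,b_n)$ (all $n$ on one probability space), and consider the rescaled eigenvalues $$\tilde\lambda_i=(\sigma+1)\sqrt{\frac{b_n(1+\sigma)}{\sigma n\beta'}}\Big(\lambda_i-\frac{\sigma}{\sigma+1}\Big).$$ Then both the spectral measure $\sum_{i=1}^n w_i\delta_{\tilde\lambda_i}$ and the empirical measure $\frac1n\sum_{i=1}^n\delta_{\tilde\lambda_i}$ converge weakly, almost surely, to the semicircle law $\mathrm{SC}$, which has density $\frac{1}{2\pi}\sqrt{4-x^2}\,\mathbb{1}_{\{-2<x<2\}}$.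
   Context: Jacobi ensemble $\mathcal{J}\beta\mathcal{E}(a,b)$ in dimension $n$ (with $\beta>0$, $\beta'=\beta/2$, parameters $a,b>\beta'(n-1)$): the joint law of a random eigenvalue vector $(\lambda_1,\dots,\lambda_n)$ with Lebesgue density $$c_{a,b,\beta}\prod_{i<j}|\lambda_i-\lambda_j|^\beta\prod_{i=1}^n\lambda_i^{a-e_\beta}(1-\lambda_i)^{b-e_\beta}\mathbb{1}_{\{0<\lambda_i<1\}},\qquad e_\beta=\tfrac{\beta}{2}(n-1)+1,$$ ($c_{a,b,\beta}$ the normalising constant), together with an independent weight vector $(w_1,\dots,w_n)$ having the Dirichlet distribution with all $n$ parameters equal to $\beta'$. The spectral measure is $\mu_n=\sum_i w_i\delta_{\lambda_i}$ and the empirical eigenvalue distribution is $\hat\mu_n=\frac1n\sum_i\delta_{\lambda_i}$; when eigenvalues are rescaled the weights are kept. Weak convergence refers to probability measures on $\mathbb{R}$. *)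

theory Defs
  imports "HOL-Probability.Probability"
begin

definition jacobi_density :: "nat \<Rightarrow> real \<Rightarrow> real \<Rightarrow> real \<Rightarrow> (nat \<Rightarrow> real) \<Rightarrow> real" where
  "jacobi_density n \<beta> a b x =
     (let e = \<beta> / 2 * (real n - 1) + 1 in
      if (\<forall>i<n. 0 < x i \<and> x i < 1) then
        (\<Prod>i<n. \<Prod>j\<in>{i<..<n}. \<bar>x i - x j\<bar> powr \<beta>) *
        (\<Prod>i<n. x i powr (a - e) * (1 - x i) powr (b - e))
      else 0)"

definition jacobi_eigenvalues :: "nat \<Rightarrow> real \<Rightarrow> real \<Rightarrow> real \<Rightarrow> (nat \<Rightarrow> real) measure" where
  "jacobi_eigenvalues n \<beta> a b =
     density (PiM {..<n} (\<lambda>_. lborel))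
       (\<lambda>x. ennreal (jacobi_density n \<beta> a b x /
              integral\<^sup>L (PiM {..<n} (\<lambda>_. lborel)) (jacobi_density n \<beta> a b)))"

text \<open>Dirichlet(alpha,...,alpha) on n coordinates: density of the first n-1 coordinates,
  the last coordinate being 1 minus their sum.\<close>
definition dirichlet_density :: "nat \<Rightarrow> real \<Rightarrow> (nat \<Rightarrow> real) \<Rightarrow> real" where
  "dirichlet_density n \<alpha> y =
     (if (\<forall>i<n-1. 0 < y i) \<and> (\<Sum>i<n-1. y i) < 1 then
        Gamma (real n * \<alpha>) / Gamma \<alpha> ^ n * (\<Prod>i<n-1. y i powr (\<alpha> - 1)) *
        (1 - (\<Sum>i<n-1. y i)) powr (\<alpha> - 1)
      else 0)"

definition dirichlet :: "nat \<Rightarrow> real \<Rightarrow> (nat \<Rightarrow> real) measure" where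
  "dirichlet n \<alpha> =
     distr (density (PiM {..<n-1} (\<lambda>_. lborel)) (\<lambda>y. ennreal (dirichlet_density n \<alpha> y)))
       (PiM {..<n} (\<lambda>_. lborel))
       (\<lambda>y. restrict (y(n-1 := 1 - (\<Sum>i<n-1. y i))) {..<n})"

definition jacobi_ensemble :: "nat \<Rightarrow> real \<Rightarrow> real \<Rightarrow> real \<Rightarrow> ((nat \<Rightarrow> real) \<times> (nat \<Rightarrow> real)) measure" where
  "jacobi_ensemble n \<beta> a b = jacobi_eigenvalues n \<beta> a b \<Otimes>\<^sub>M dirichlet n (\<beta> / 2)"

definition spectral_measure :: "nat \<Rightarrow> (nat \<Rightarrow> real) \<Rightarrow> (nat \<Rightarrow> real) \<Rightarrow> real measure" where
  "spectral_measure n w x =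
     measure_of UNIV (sets borel) (\<lambda>A. \<Sum>i<n. ennreal (w i) * indicator A (x i))"

definition empirical_measure :: "nat \<Rightarrow> (nat \<Rightarrow> real) \<Rightarrow> real measure" where
  "empirical_measure n x = spectral_measure n (\<lambda>_. 1 / real n) x"

definition semicircle :: "real measure" where
  "semicircle = density lborel (\<lambda>x. ennreal (indicator {-2<..<2} x * sqrt (4 - x\<^sup>2) / (2 * pi)))"

end

(*
  Moving every eigenvalue by l + eps l (1 - l) G l maps (0,1)^n onto itself, so integrating the
  transported density gives E exp R = 1, where R is the log-ratio of the transported density to the
  original one.  To first order R is eps times the loop (Schwinger-Dyson) functional of G, and
  Markov's inequality with both signs of eps = n^(-1/2) makes that functional negligible almost
  surely by Borel-Cantelli; no separate variance estimate is needed.  The factor l (1 - l) cancels the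
  singularities of the potential at 0 and 1.  In the rescaled variable, G = x bounds the second moment,
  and G = cos (t x), sin (t x) show that the empirical characteristic function satisfies
  phi' = - phi * phi (convolution on [0,t]) up to a vanishing error.  This Volterra equation is stable
  and the semicircle law solves it by the Catalan convolution, so Levy's theorem applies.

  For the weights, E (sum w_j t_j)^(- n alpha) = prod t_j^(- alpha) for Dirichlet(alpha,...,alpha);
  with t_j = exp (theta f(lambda_j)) this bounds the difference between the weighted and the uniform
  mean of f.  Taking f to be the indicator of (-infinity, q] for rational q transfers the convergence of
  distribution functions from the empirical to the spectral measure.
*)
theory Submission
  imports Defs "HOL-Computational_Algebra.Formal_Power_Series"
begin

section \<open>Change of variables in product integrals\<close>

text \<open>The normalising constant of the eigenvalue density is never evaluated: the transport
  compares the total mass with itself, and a sample with the stated law forces that mass to be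
  finite and positive. A lower bound of the transported density suffices, since Markov's inequality
  only asks for E exp (eps T - 2 eps^2 Q) <= 1, with T the loop functional and Q a quadratic
  remainder. Both T and Q live on the scale n^2, so outside two events of probability at most n^-2
  one has |T| / n^2 <= 2 eps Q / n^2 + 2 ln n / (eps n^2), and eps = n^(-1/2) makes both terms
  vanish with room to spare. The obstacle is that x g(x) is unbounded in the rescaled variable, so
  every error carries the factor 1 + second moment. For G = x the loop functional contains the
  second moment itself, which is thereby bounded by a small multiple of itself. Vector fields must
  be real and only countably many can be handled almost surely: hence cosine and sine separately,
  rational t only, and a Lipschitz bound in t to reach the other times.\<close>

text \<open>Fubini, one coordinate at a time. The weights \<open>J\<close> before and
  \<open>I\<close> after the substitution are kept separate so that one statement covers both the
  scaling of the whole space, where \<open>I\<close> is 1, and the transport of the cube, where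
  \<open>I\<close> is the indicator of [0,1].\<close>

lemma nn_integral_PiM_substitution:
  fixes \<phi> :: "real \<Rightarrow> real" and J I :: "real \<Rightarrow> ennreal"
  assumes "finite S"
    and [measurable]: "\<phi> \<in> borel_measurable borel" "J \<in> borel_measurable borel"
      "I \<in> borel_measurable borel"
    and sub: "\<And>f :: real \<Rightarrow> ennreal. f \<in> borel_measurable borel \<Longrightarrow>
       (\<integral>\<^sup>+x. f (\<phi> x) * J x \<partial>lborel) = (\<integral>\<^sup>+y. f y * I y \<partial>lborel)"
    and "F \<in> borel_measurable (PiM S (\<lambda>_. lborel))"
  shows "(\<integral>\<^sup>+x. F (\<lambda>i\<in>S. \<phi> (x i)) * (\<Prod>i\<in>S. J (x i)) \<partial>PiM S (\<lambda>_. lborel))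
       = (\<integral>\<^sup>+y. F y * (\<Prod>i\<in>S. I (y i)) \<partial>PiM S (\<lambda>_. lborel))"
  using assms(1,6)
proof (induction S arbitrary: F rule: finite_induct)
  case empty
  show ?case by (simp add: PiM_empty restrict_def nn_integral_count_space_finite)
next
  case (insert i S)
  interpret product_sigma_finite "\<lambda>_::'a. lborel :: real measure" by standard
  note [measurable] = insert.prems
  have [simp]: "finite S" "i \<notin> S" using insert by auto
  define H where "H = (\<lambda>x. \<integral>\<^sup>+y. F (x(i := y)) * I y \<partial>lborel)"
  have Fu[measurable]: "(\<lambda>p. F ((fst p)(i := snd p))) \<in> borel_measurable (PiM S (\<lambda>_. lborel) \<Otimes>\<^sub>M lborel)"
    by measurable
  have H[measurable]: "H \<in> borel_measurable (PiM S (\<lambda>_. lborel))"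
    unfolding H_def by (rule lborel.borel_measurable_nn_integral) (simp add: split_beta')
  have e: "(\<lambda>j\<in>insert i S. \<phi> ((x(i := y)) j)) = (\<lambda>j\<in>S. \<phi> (x j))(i := \<phi> y)" for x y
    by (auto simp: restrict_def fun_eq_iff)
  have pr: "(\<Prod>j\<in>insert i S. K ((x(i := y)) j)) = K y * (\<Prod>j\<in>S. K (x j))" for x y and K :: "real \<Rightarrow> ennreal"
    by (auto intro!: arg_cong2[where f="(*)"] prod.cong)
  have "(\<integral>\<^sup>+x. F (\<lambda>j\<in>insert i S. \<phi> (x j)) * (\<Prod>j\<in>insert i S. J (x j)) \<partial>PiM (insert i S) (\<lambda>_. lborel))
     = (\<integral>\<^sup>+x. (\<integral>\<^sup>+y. F ((\<lambda>j\<in>S. \<phi> (x j))(i := \<phi> y)) * (J y * (\<Prod>j\<in>S. J (x j))) \<partial>lborel) \<partial>PiM S (\<lambda>_. lborel))"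
    unfolding e[symmetric] pr[symmetric]
    by (rule product_nn_integral_insert) measurable
  also have "\<dots> = (\<integral>\<^sup>+x. H (\<lambda>j\<in>S. \<phi> (x j)) * (\<Prod>j\<in>S. J (x j)) \<partial>PiM S (\<lambda>_. lborel))"
  proof (rule nn_integral_cong)
    fix x assume x: "x \<in> space (PiM S (\<lambda>_. lborel :: real measure))"
    have r: "(\<lambda>j\<in>S. \<phi> (x j)) \<in> space (PiM S (\<lambda>_. lborel))"
      by (simp add: space_PiM)
    have m: "(\<lambda>y. F ((\<lambda>j\<in>S. \<phi> (x j))(i := y))) \<in> borel_measurable borel"
      using measurable_Pair2[OF Fu r] by (simp add: split_beta')
    have "(\<integral>\<^sup>+y. F ((\<lambda>j\<in>S. \<phi> (x j))(i := \<phi> y)) * (J y * (\<Prod>j\<in>S. J (x j))) \<partial>lborel)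
        = (\<integral>\<^sup>+y. (F ((\<lambda>j\<in>S. \<phi> (x j))(i := \<phi> y)) * J y) * (\<Prod>j\<in>S. J (x j)) \<partial>lborel)"
      by (simp add: mult.assoc)
    also have "\<dots> = (\<integral>\<^sup>+y. (F ((\<lambda>j\<in>S. \<phi> (x j))(i := \<phi> y)) * J y) \<partial>lborel) * (\<Prod>j\<in>S. J (x j))"
      using measurable_compose[OF _ m, of \<phi> borel] by (intro nn_integral_multc) simp
    also have "\<dots> = H (\<lambda>j\<in>S. \<phi> (x j)) * (\<Prod>j\<in>S. J (x j))"
      using sub[OF m] by (simp add: H_def)
    finally show "(\<integral>\<^sup>+y. F ((\<lambda>j\<in>S. \<phi> (x j))(i := \<phi> y)) * (J y * (\<Prod>j\<in>S. J (x j))) \<partial>lborel)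
        = H (\<lambda>j\<in>S. \<phi> (x j)) * (\<Prod>j\<in>S. J (x j))" .
  qed
  also have "\<dots> = (\<integral>\<^sup>+x. H x * (\<Prod>j\<in>S. I (x j)) \<partial>PiM S (\<lambda>_. lborel))"
    by (rule insert.IH) measurable
  also have "\<dots> = (\<integral>\<^sup>+x. (\<integral>\<^sup>+y. F (x(i := y)) * (I y * (\<Prod>j\<in>S. I (x j))) \<partial>lborel) \<partial>PiM S (\<lambda>_. lborel))"
  proof (rule nn_integral_cong)
    fix x assume x: "x \<in> space (PiM S (\<lambda>_. lborel :: real measure))"
    have m: "(\<lambda>y. F (x(i := y))) \<in> borel_measurable borel"
      using measurable_Pair2[OF Fu x] by (simp add: split_beta')
    show "H x * (\<Prod>j\<in>S. I (x j)) = (\<integral>\<^sup>+y. F (x(i := y)) * (I y * (\<Prod>j\<in>S. I (x j))) \<partial>lborel)"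
      using m by (simp add: H_def mult.assoc[symmetric] nn_integral_multc)
  qed
  also have "\<dots> = (\<integral>\<^sup>+x. F x * (\<Prod>j\<in>insert i S. I (x j)) \<partial>PiM (insert i S) (\<lambda>_. lborel))"
    unfolding pr[symmetric]
    by (rule product_nn_integral_insert[symmetric]) measurable
  finally show ?case .
qed

lemma nn_integral_gamma_scaled:
  fixes a \<tau> :: real
  assumes "a > 0" "\<tau> > 0"
  shows "(\<integral>\<^sup>+r. ennreal (indicator {0<..} r * (r powr (a - 1) * exp (- (\<tau> * r)))) \<partial>lborel)
       = ennreal (Gamma a * \<tau> powr (- a))"
proof -
  let ?g = "\<lambda>r::real. ennreal (indicator {0<..} r * (r powr (a - 1) * exp (- (\<tau> * r))))"
  have "ennreal (Gamma a) = ennreal \<bar>\<tau>\<bar> * (\<integral>\<^sup>+t. ennreal (indicator {0..} (0 + \<tau> * t) * (0 + \<tau> * t) powr (a - 1) / exp (0 + \<tau> * t)) \<partial>lborel)"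
    unfolding Gamma_conv_nn_integral_real[OF \<open>a > 0\<close>]
    by (rule nn_integral_real_affine) (use assms in auto)
  also have "\<dots> = (\<integral>\<^sup>+t. ennreal \<tau> * ennreal (indicator {0..} (\<tau> * t) * (\<tau> * t) powr (a - 1) / exp (\<tau> * t)) \<partial>lborel)"
    using assms by (subst nn_integral_cmult) auto
  also have "\<dots> = (\<integral>\<^sup>+r. ennreal (\<tau> powr a) * ?g r \<partial>lborel)"
  proof (intro nn_integral_cong)
    fix t :: real
    have "\<tau> * (indicator {0..} (\<tau> * t) * (\<tau> * t) powr (a - 1) / exp (\<tau> * t))
       = \<tau> powr a * (indicator {0<..} t * (t powr (a - 1) * exp (- (\<tau> * t))))"
    proof (cases "t > 0")
      case True
      then show ?thesis using assms
        by (simp add: powr_mult powr_diff exp_minus field_simps)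
    next
      case False
      then show ?thesis using assms
        by (cases "t = 0") (auto simp: indicator_def zero_le_mult_iff)
    qed
    then show "ennreal \<tau> * ennreal (indicator {0..} (\<tau> * t) * (\<tau> * t) powr (a - 1) / exp (\<tau> * t))
       = ennreal (\<tau> powr a) * ?g t"
      using assms by (simp add: ennreal_mult'[symmetric])
  qed
  also have "\<dots> = ennreal (\<tau> powr a) * (\<integral>\<^sup>+r. ?g r \<partial>lborel)"
    by (rule nn_integral_cmult) auto
  finally have *: "ennreal (Gamma a) = ennreal (\<tau> powr a) * (\<integral>\<^sup>+r. ?g r \<partial>lborel)" .
  have "ennreal (Gamma a * \<tau> powr (- a)) = ennreal (\<tau> powr (- a)) * ennreal (Gamma a)"
    using assms by (simp add: ennreal_mult'[symmetric] mult.commute)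
  also have "\<dots> = ennreal (\<tau> powr (- a) * \<tau> powr a) * (\<integral>\<^sup>+r. ?g r \<partial>lborel)"
    unfolding * by (simp add: ennreal_mult' mult.assoc)
  finally show ?thesis using assms by (simp add: powr_add[symmetric])
qed

section \<open>The Dirichlet distribution\<close>

abbreviation lebesgue_PiM :: "nat \<Rightarrow> (nat \<Rightarrow> real) measure" where
  "lebesgue_PiM n \<equiv> PiM {..<n} (\<lambda>_. lborel)"

lemma sigma_finite_PiM_lborel:
  "finite S \<Longrightarrow> sigma_finite_measure (PiM S (\<lambda>_. lborel :: real measure))"
  by (rule product_sigma_finite.sigma_finite) (auto intro!: product_sigma_finite.intro sigma_finite_lborel)

lemma borel_measurable_dirichlet_density [measurable]:
  "dirichlet_density n \<alpha> \<in> borel_measurable (lebesgue_PiM (n - 1))"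
  unfolding dirichlet_density_def[abs_def] by measurable

lemma measurable_dirichlet_embed:
  fixes n :: nat
  assumes "n \<ge> 1"
  shows "(\<lambda>y. restrict (y(n-1 := 1 - (\<Sum>i<n-1. y i))) {..<n})
     \<in> lebesgue_PiM (n - 1) \<rightarrow>\<^sub>M lebesgue_PiM n"
proof (rule measurable_restrict)
  fix i assume i: "i \<in> {..<n}"
  show "(\<lambda>y. (y(n-1 := 1 - (\<Sum>i<n-1. y i))) i) \<in> lebesgue_PiM (n - 1) \<rightarrow>\<^sub>M (lborel :: real measure)"
  proof (cases "i = n - 1")
    case True
    then show ?thesis by simp
  next
    case False
    have "i < n - 1" using i False unfolding lessThan_iff by arith
    then have "i \<in> {..<n-1}" by simp
    then show ?thesis using False by simp
  qed
qed

lemma nn_integral_dirichlet_eq: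
  assumes "n \<ge> 1" and [measurable]: "f \<in> borel_measurable (lebesgue_PiM n)"
  shows "(\<integral>\<^sup>+w. f w \<partial>dirichlet n \<alpha>) =
    (\<integral>\<^sup>+u. ennreal (dirichlet_density n \<alpha> u) *
        f (restrict (u(n-1 := 1 - (\<Sum>i<n-1. u i))) {..<n}) \<partial>lebesgue_PiM (n - 1))"
proof -
  note m = measurable_dirichlet_embed[OF assms(1)]
  have "(\<integral>\<^sup>+w. f w \<partial>dirichlet n \<alpha>) =
      (\<integral>\<^sup>+u. f (restrict (u(n-1 := 1 - (\<Sum>i<n-1. u i))) {..<n})
        \<partial>density (lebesgue_PiM (n - 1)) (\<lambda>y. ennreal (dirichlet_density n \<alpha> y)))"
    unfolding dirichlet_def
  proof (rule nn_integral_distr)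
    show "(\<lambda>y. restrict (y(n-1 := 1 - (\<Sum>i<n-1. y i))) {..<n})
      \<in> density (lebesgue_PiM (n - 1)) (\<lambda>y. ennreal (dirichlet_density n \<alpha> y)) \<rightarrow>\<^sub>M lebesgue_PiM n"
      using m by (simp only: measurable_density_eq1)
  qed simp
  also have "\<dots> = (\<integral>\<^sup>+u. ennreal (dirichlet_density n \<alpha> u) *
        f (restrict (u(n-1 := 1 - (\<Sum>i<n-1. u i))) {..<n}) \<partial>lebesgue_PiM (n - 1))"
    by (intro nn_integral_density measurable_compose[OF m assms(2)]) measurable
  finally show ?thesis .
qed

text \<open>Integrate a product of n unnormalised Gamma densities of shape \<open>\<alpha>\<close>
  and rates \<open>t j\<close> in two ways. Coordinatewise it gives the product of
  \<open>Gamma \<alpha> * t j powr (-\<alpha>)\<close>. With the total \<open>r\<close> and the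
  proportions \<open>u\<close> as variables, the integral over \<open>r\<close> is a Gamma integral
  of shape \<open>n * \<alpha>\<close> and rate \<open>\<tau> u\<close>, whose value contains
  \<open>Gamma (n * \<alpha>)\<close>, the numerator of the Dirichlet constant.\<close>

lemma nn_integral_dirichlet_powr:
  assumes "n \<ge> 1" "\<alpha> > 0" and t: "\<And>j. j < n \<Longrightarrow> t j > 0"
  shows "(\<integral>\<^sup>+w. ennreal ((\<Sum>j<n. t j * w j) powr (- (real n * \<alpha>))) \<partial>dirichlet n \<alpha>)
       = ennreal (\<Prod>j<n. t j powr (- \<alpha>))"
proof -
  obtain N where n: "n = Suc N" using assms(1) by (cases n) auto
  let ?L = "PiM {..<N} (\<lambda>_. lborel :: real measure)"
  interpret product_sigma_finite "\<lambda>_::nat. lborel :: real measure" by standard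
  interpret PS: pair_sigma_finite ?L "lborel :: real measure"
    by (intro pair_sigma_finite.intro sigma_finite_PiM_lborel sigma_finite_lborel) simp
  interpret PS2: pair_sigma_finite "lborel :: real measure" ?L
    by (intro pair_sigma_finite.intro sigma_finite_PiM_lborel sigma_finite_lborel) simp
  \<comment> \<open>The half-line is open, so a nonzero value of \<open>p\<close> certifies a
    positive argument (\<open>pp\<close>); the support of the product is then read off factor by
    factor.\<close>
  define p where "p j z = indicator {0<..} z * (z powr (\<alpha> - 1) * exp (- (t j * z)))" for j and z :: real
  have p0: "p j z \<ge> 0" for j z by (simp add: p_def)
  have pp: "p j z \<noteq> 0 \<Longrightarrow> z > 0" for j z by (auto simp: p_def indicator_def split: if_splits)
  have [measurable]: "p j \<in> borel_measurable borel" for j unfolding p_def by measurable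
  define H where "H = (\<lambda>y r. ennreal ((\<Prod>j<N. p j (y j)) * p N (r - (\<Sum>j<N. y j))))"
  have Hr: "H (\<lambda>j\<in>{..<N}. r * u j) r = ennreal ((\<Prod>j<N. p j (r * u j)) * p N (r - (\<Sum>j<N. r * u j)))" for r u
  proof -
    have "(\<Sum>j<N. (\<lambda>j\<in>{..<N}. r * u j) j) = (\<Sum>j<N. r * u j)"
      "(\<Prod>j<N. p j ((\<lambda>j\<in>{..<N}. r * u j) j)) = (\<Prod>j<N. p j (r * u j))"
      by (intro sum.cong prod.cong refl; simp)+
    then show ?thesis unfolding H_def by simp
  qed
  let ?h = "\<lambda>u r. ennreal (indicator {0<..} r * r ^ N) * H (\<lambda>j\<in>{..<N}. r * u j) r"
  have Hm[measurable]: "(\<lambda>(y, r). H y r) \<in> borel_measurable (?L \<Otimes>\<^sub>M lborel)"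
    unfolding H_def by measurable
  have Hm2[measurable]: "(\<lambda>(r, y). H y r) \<in> borel_measurable (lborel \<Otimes>\<^sub>M ?L)"
    unfolding H_def by measurable
  have Hy[measurable]: "(\<lambda>y. H y r) \<in> borel_measurable ?L" for r
    unfolding H_def by measurable
  define \<tau> where "\<tau> u = (\<Sum>j<N. t j * u j) + t N * (1 - (\<Sum>j<N. u j))" for u :: "nat \<Rightarrow> real"
  have [measurable]: "\<tau> \<in> borel_measurable ?L" unfolding \<tau>_def by measurable
  have "ennreal (\<Prod>j<n. Gamma \<alpha> * t j powr (-\<alpha>)) = (\<Prod>j<n. \<integral>\<^sup>+z. ennreal (p j z) \<partial>lborel)"
    using assms t unfolding p_def
    by (subst prod_ennreal[symmetric]) (auto simp: nn_integral_gamma_scaled intro!: prod.cong)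
  also have "\<dots> = (\<integral>\<^sup>+x. (\<Prod>j<n. ennreal (p j (x j))) \<partial>lebesgue_PiM n)"
    by (rule product_nn_integral_prod[symmetric]) auto
  also have "\<dots> = (\<integral>\<^sup>+y. \<integral>\<^sup>+z. (\<Prod>j<n. ennreal (p j ((y(N := z)) j))) \<partial>lborel \<partial>?L)"
    unfolding n lessThan_Suc by (rule product_nn_integral_insert) auto
  also have "\<dots> = (\<integral>\<^sup>+y. \<integral>\<^sup>+z. ennreal ((\<Prod>j<N. p j (y j)) * p N z) \<partial>lborel \<partial>?L)"
    by (intro nn_integral_cong) (simp add: n prod_ennreal p0 ennreal_mult prod_nonneg)
  \<comment> \<open>The last coordinate is traded for the total \<open>r\<close>, a translation at
    fixed \<open>y\<close>.\<close>
  also have "\<dots> = (\<integral>\<^sup>+y. \<integral>\<^sup>+r. H y r \<partial>lborel \<partial>?L)"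
  proof (rule nn_integral_cong)
    fix y
    show "(\<integral>\<^sup>+z. ennreal ((\<Prod>j<N. p j (y j)) * p N z) \<partial>lborel) = (\<integral>\<^sup>+r. H y r \<partial>lborel)"
      by (subst nn_integral_real_affine[where c=1 and t="- (\<Sum>j<N. y j)"]) (simp_all add: H_def)
  qed
  also have "\<dots> = (\<integral>\<^sup>+r. \<integral>\<^sup>+y. H y r \<partial>?L \<partial>lborel)"
    by (rule PS2.Fubini'[OF Hm2])
  \<comment> \<open>At fixed total \<open>r\<close> the first \<open>N = n - 1\<close> coordinates
    are scaled by \<open>r\<close>, with Jacobian \<open>r ^ N\<close>. For \<open>r <= 0\<close>
    both sides vanish.\<close>
  also have "\<dots> = (\<integral>\<^sup>+r. \<integral>\<^sup>+u. ?h u r \<partial>?L \<partial>lborel)"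
  proof (rule nn_integral_cong)
    fix r :: real
    show "(\<integral>\<^sup>+y. H y r \<partial>?L) = (\<integral>\<^sup>+u. ?h u r \<partial>?L)"
    proof (cases "r > 0")
      case True
      have "(\<integral>\<^sup>+y. H y r * (\<Prod>j<N. 1) \<partial>?L) = (\<integral>\<^sup>+u. H (\<lambda>j\<in>{..<N}. r * u j) r * (\<Prod>j<N. ennreal r) \<partial>?L)"
      proof (rule nn_integral_PiM_substitution[symmetric])
        fix f :: "real \<Rightarrow> ennreal" assume [measurable]: "f \<in> borel_measurable borel"
        show "(\<integral>\<^sup>+x. f (r * x) * ennreal r \<partial>lborel) = (\<integral>\<^sup>+y. f y * 1 \<partial>lborel)"
          using True nn_integral_real_affine[of f r 0]
          by (simp add: nn_integral_cmult mult.commute)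
      qed auto
      then show ?thesis using True by (simp add: ennreal_power mult.commute)
    next
      case False
      have "H y r = 0" for y
      proof (rule ccontr)
        assume "H y r \<noteq> 0"
        then have "(\<Prod>j<N. p j (y j)) * p N (r - (\<Sum>j<N. y j)) \<noteq> 0"
          unfolding H_def by (metis ennreal_0)
        then have "(\<Prod>j<N. p j (y j)) \<noteq> 0" and 2: "p N (r - (\<Sum>j<N. y j)) \<noteq> 0"
          unfolding mult_eq_0_iff de_Morgan_disj by blast+
        then have "\<forall>j<N. p j (y j) \<noteq> 0" by auto
        then have "\<forall>j<N. y j > 0" using pp by blast
        then have "(\<Sum>j<N. y j) \<ge> 0" by (intro sum_nonneg) (auto intro: less_imp_le)
        moreover have "r - (\<Sum>j<N. y j) > 0" using 2 by (rule pp)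
        ultimately show False using False by simp
      qed
      then show ?thesis using False by simp
    qed
  qed
  also have "\<dots> = (\<integral>\<^sup>+u. \<integral>\<^sup>+r. ?h u r \<partial>lborel \<partial>?L)"
    unfolding Hr by (rule PS.Fubini') measurable
  also have "\<dots> = (\<integral>\<^sup>+u. ennreal (Gamma \<alpha> ^ n * (dirichlet_density n \<alpha> u * \<tau> u powr (- (real n * \<alpha>)))) \<partial>?L)"
  proof (rule nn_integral_cong)
    fix u
    let ?D = "\<lambda>r. (\<Prod>j<N. p j (r * u j)) * p N (r - (\<Sum>j<N. r * u j))"
    show "(\<integral>\<^sup>+r. ?h u r \<partial>lborel)
        = ennreal (Gamma \<alpha> ^ n * (dirichlet_density n \<alpha> u * \<tau> u powr (- (real n * \<alpha>))))"
    proof (cases "(\<forall>j<N. u j > 0) \<and> (\<Sum>j<N. u j) < 1")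
      case True
      let ?c = "(\<Prod>j<N. u j powr (\<alpha> - 1)) * (1 - (\<Sum>j<N. u j)) powr (\<alpha> - 1)"
      have c0: "?c \<ge> 0" by (intro mult_nonneg_nonneg prod_nonneg) auto
      have "(\<Sum>j<N. t j * u j) \<ge> 0"
        using True t by (intro sum_nonneg mult_nonneg_nonneg) (auto simp: n less_imp_le)
      moreover have "t N * (1 - (\<Sum>j<N. u j)) > 0" using True t[of N] n by simp
      ultimately have \<tau>: "\<tau> u > 0" unfolding \<tau>_def by linarith
      have "(\<integral>\<^sup>+r. ?h u r \<partial>lborel)
         = (\<integral>\<^sup>+r. ennreal ?c * ennreal (indicator {0<..} r * (r powr (real n * \<alpha> - 1) * exp (- (\<tau> u * r)))) \<partial>lborel)"
      proof (rule nn_integral_cong)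
        fix r :: real
        show "?h u r
          = ennreal ?c * ennreal (indicator {0<..} r * (r powr (real n * \<alpha> - 1) * exp (- (\<tau> u * r))))"
        proof (cases "r > 0")
          case r: True
          have 1: "(\<Prod>j<N. p j (r * u j)) = (\<Prod>j<N. r powr (\<alpha> - 1) * (u j powr (\<alpha> - 1)) * exp (- (t j * u j * r)))"
            using True r by (intro prod.cong) (auto simp: p_def powr_mult mult_ac)
          have 2: "\<dots> = (r powr (\<alpha> - 1)) ^ N * (\<Prod>j<N. u j powr (\<alpha> - 1)) * exp (- ((\<Sum>j<N. t j * u j) * r))"
            by (simp add: prod.distrib exp_sum[symmetric] sum_distrib_right sum_negf)
          have s: "r - (\<Sum>j<N. r * u j) = r * (1 - (\<Sum>j<N. u j))"
            by (simp add: algebra_simps sum_distrib_left)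
          have 3: "p N (r - (\<Sum>j<N. r * u j)) = r powr (\<alpha> - 1) * (1 - (\<Sum>j<N. u j)) powr (\<alpha> - 1) * exp (- (t N * (1 - (\<Sum>j<N. u j)) * r))"
            unfolding s using r True by (simp add: p_def powr_mult mult_ac)
          \<comment> \<open>\<open>N\<close> from the Jacobian and \<open>n\<close> copies of
            \<open>\<alpha> - 1\<close> from the Gamma densities add up to
            \<open>n * \<alpha> - 1\<close>, the exponent of a Gamma integral of shape
            \<open>n * \<alpha>\<close>.\<close>
          have 4: "r ^ N * ((r powr (\<alpha> - 1)) ^ N * r powr (\<alpha> - 1)) = r powr (real n * \<alpha> - 1)"
          proof -
            have "r ^ N * ((r powr (\<alpha> - 1)) ^ N * r powr (\<alpha> - 1)) = r powr (real N) * (r powr (real N * (\<alpha> - 1)) * r powr (\<alpha> - 1))"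
              using r by (simp add: powr_powr mult.commute flip: powr_realpow)
            also have "\<dots> = r powr (real n * \<alpha> - 1)"
              by (simp add: powr_add[symmetric] n algebra_simps)
            finally show ?thesis .
          qed
          have "r ^ N * ?D r = ?c * (r powr (real n * \<alpha> - 1) * exp (- (\<tau> u * r)))"
            unfolding 1 2 3 4[symmetric] \<tau>_def
            by (simp add: ring_distribs exp_add exp_diff exp_minus field_simps)
          then show ?thesis using r c0
            by (simp add: Hr ennreal_mult'[symmetric] ennreal_mult[symmetric] prod_nonneg p0)
        qed simp
      qed
      also have "\<dots> = ennreal ?c * ennreal (Gamma (real n * \<alpha>) * \<tau> u powr (- (real n * \<alpha>)))"
        using assms \<tau> n by (subst nn_integral_cmult) (auto simp: nn_integral_gamma_scaled)
      also have "\<dots> = ennreal (Gamma \<alpha> ^ n * (dirichlet_density n \<alpha> u * \<tau> u powr (- (real n * \<alpha>))))"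
        using True Gamma_real_pos[OF assms(2)]
        by (subst ennreal_mult'[OF c0, symmetric]) (simp add: dirichlet_density_def n mult_ac del: power_Suc)
      finally show ?thesis .
    next
      case False
      have H0: "H (\<lambda>j\<in>{..<N}. r * u j) r = 0" if r: "r > 0" for r
      proof (rule ccontr)
        assume "H (\<lambda>j\<in>{..<N}. r * u j) r \<noteq> 0"
        then have "(\<Prod>j<N. p j (r * u j)) * p N (r - (\<Sum>j<N. r * u j)) \<noteq> 0"
          unfolding Hr by (metis ennreal_0)
        then have "(\<Prod>j<N. p j (r * u j)) \<noteq> 0" and 2: "p N (r - (\<Sum>j<N. r * u j)) \<noteq> 0"
          unfolding mult_eq_0_iff de_Morgan_disj by blast+
        then have "\<forall>j<N. p j (r * u j) \<noteq> 0" by auto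
        then have "\<forall>j<N. r * u j > 0" using pp by blast
        then have "\<forall>j<N. u j > 0" using r by (simp add: zero_less_mult_iff)
        moreover have "r - (\<Sum>j<N. r * u j) > 0" using 2 by (rule pp)
        then have "r * (1 - (\<Sum>j<N. u j)) > 0" by (simp add: algebra_simps sum_distrib_left)
        then have "(\<Sum>j<N. u j) < 1" using r by (simp add: zero_less_mult_iff)
        ultimately show False using False by simp
      qed
      have "(\<integral>\<^sup>+r. ?h u r \<partial>lborel) = (\<integral>\<^sup>+(r::real). 0 \<partial>lborel)"
        by (intro nn_integral_cong) (simp add: indicator_def H0)
      moreover have "dirichlet_density n \<alpha> u = 0" using False n by (auto simp: dirichlet_density_def)
      ultimately show ?thesis by simp
    qed
  qed
  also have "\<dots> = ennreal (Gamma \<alpha> ^ n) * (\<integral>\<^sup>+u. ennreal (dirichlet_density n \<alpha> u * \<tau> u powr (- (real n * \<alpha>))) \<partial>?L)"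
    using borel_measurable_dirichlet_density[of n \<alpha>] Gamma_real_pos[OF assms(2)] n
    by (subst nn_integral_cmult[symmetric]) (auto simp: ennreal_mult'[symmetric] less_imp_le)
  also have "(\<integral>\<^sup>+u. ennreal (dirichlet_density n \<alpha> u * \<tau> u powr (- (real n * \<alpha>))) \<partial>?L)
     = (\<integral>\<^sup>+w. ennreal ((\<Sum>j<n. t j * w j) powr (- (real n * \<alpha>))) \<partial>dirichlet n \<alpha>)"
    using assms(1)
    by (subst nn_integral_dirichlet_eq) (auto simp: \<tau>_def n ennreal_mult'' intro!: nn_integral_cong)
  finally have *: "ennreal (\<Prod>j<n. Gamma \<alpha> * t j powr (-\<alpha>)) =
    ennreal (Gamma \<alpha> ^ n) * (\<integral>\<^sup>+w. ennreal ((\<Sum>j<n. t j * w j) powr (- (real n * \<alpha>))) \<partial>dirichlet n \<alpha>)"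
    (is "_ = _ * ?R") .
  have g: "Gamma \<alpha> > 0" using Gamma_real_pos[OF assms(2)] by simp
  have "?R = ennreal (1 / Gamma \<alpha> ^ n) * (ennreal (Gamma \<alpha> ^ n) * ?R)"
    using g by (simp add: mult.assoc[symmetric] ennreal_mult'[symmetric])
  also have "\<dots> = ennreal (\<Prod>j<n. t j powr (- \<alpha>))"
    unfolding *[symmetric] using g by (simp add: ennreal_mult'[symmetric] prod.distrib)
  finally show ?thesis .
qed

lemma space_dirichlet [simp]: "space (dirichlet n \<alpha>) = space (lebesgue_PiM n)"
  and sets_dirichlet [measurable_cong]: "sets (dirichlet n \<alpha>) = sets (lebesgue_PiM n)"
  by (simp_all add: dirichlet_def)

lemma AE_dirichlet_simplex:
  assumes "n \<ge> 1"
  shows "AE w in dirichlet n \<alpha>. (\<forall>i<n. w i > 0) \<and> (\<Sum>i<n. w i) = 1"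
proof -
  have P: "{w \<in> space (lebesgue_PiM n). (\<forall>i<n. (w i::real) > 0) \<and> (\<Sum>i<n. w i) = 1} \<in> sets (lebesgue_PiM n)"
    by measurable
  obtain N where n: "n = Suc N" using assms(1) by (cases n) auto
  have m: "(\<lambda>u. ennreal (dirichlet_density n \<alpha> u)) \<in> borel_measurable (lebesgue_PiM (n - 1))"
    by measurable
  show ?thesis
    unfolding dirichlet_def
    apply (subst AE_distr_iff[OF _ P])
    subgoal using measurable_dirichlet_embed[OF assms] by simp
    subgoal unfolding AE_density[OF m]
      by (rule AE_I2) (auto simp: n dirichlet_density_def less_Suc_eq sum.lessThan_Suc split: if_splits)
    done
qed

text \<open>The negative-moment identity at \<open>t = 1\<close>: on the simplex the integrand is 1,
  so the identity computes the total mass.\<close>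

lemma prob_space_dirichlet:
  assumes "n \<ge> 1" "\<alpha> > 0"
  shows "prob_space (dirichlet n \<alpha>)"
proof
  have "emeasure (dirichlet n \<alpha>) (space (dirichlet n \<alpha>)) = (\<integral>\<^sup>+w. 1 \<partial>dirichlet n \<alpha>)"
    by simp
  also have "\<dots> = (\<integral>\<^sup>+w. ennreal ((\<Sum>j<n. 1 * w j) powr (- (real n * \<alpha>))) \<partial>dirichlet n \<alpha>)"
    by (rule nn_integral_cong_AE) (use AE_dirichlet_simplex[OF assms(1), of \<alpha>] in eventually_elim, simp)
  also have "\<dots> = 1" using nn_integral_dirichlet_powr[OF assms, of "\<lambda>_. 1"] by simp
  finally show "emeasure (dirichlet n \<alpha>) (space (dirichlet n \<alpha>)) = 1" .
qed

section \<open>Perturbing the eigenvalue density\<close>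

text \<open>With the derivative on the diagonal, coinciding points need no exclusion and the full
  double sum over \<open>i, j\<close> makes sense. \<open>f'\<close> is an argument rather than a
  chosen derivative, so measurability follows from that of \<open>f\<close> and
  \<open>f'\<close>.\<close>

definition divided_difference :: "(real \<Rightarrow> real) \<Rightarrow> (real \<Rightarrow> real) \<Rightarrow> real \<Rightarrow> real \<Rightarrow> real" where
  "divided_difference f f' x y = (if x = y then f' x else (f x - f y) / (x - y))"

lemma divided_difference_commute: "divided_difference f f' x y = divided_difference f f' y x"
proof -
  have "(f x - f y) / (x - y) = (f y - f x) / (y - x)"
    by (metis minus_diff_eq minus_divide_divide)
  then show ?thesis by (auto simp: divided_difference_def)
qed

lemma borel_measurable_divided_difference [measurable]:
  assumes [measurable]: "f \<in> borel_measurable borel" "f' \<in> borel_measurable borel"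
    "g \<in> borel_measurable M" "h \<in> borel_measurable M"
  shows "(\<lambda>x. divided_difference f f' (g x) (h x)) \<in> borel_measurable M"
  unfolding divided_difference_def by measurable

lemma abs_divided_difference_le:
  assumes d: "\<And>z. l \<le> z \<Longrightarrow> z \<le> u \<Longrightarrow> (f has_real_derivative f' z) (at z)"
    and b: "\<And>z. l \<le> z \<Longrightarrow> z \<le> u \<Longrightarrow> \<bar>f' z\<bar> \<le> K"
    and "l \<le> x" "x \<le> u" "l \<le> y" "y \<le> u"
  shows "\<bar>divided_difference f f' x y\<bar> \<le> K"
proof (cases "x = y")
  case True
  then show ?thesis using assms by (simp add: divided_difference_def)
next
  case False
  define p q where "p = min x y" and "q = max x y"
  have pq: "p < q" "l \<le> p" "q \<le> u" using False assms by (auto simp: p_def q_def)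
  have "\<exists>z. p < z \<and> z < q \<and> f q - f p = (q - p) * f' z"
    using pq by (intro MVT2 d) auto
  then obtain z where z: "p < z" "z < q" "f q - f p = (q - p) * f' z" by auto
  have "divided_difference f f' x y = divided_difference f f' q p"
    using divided_difference_commute[of f f' x y] by (auto simp: p_def q_def min_def max_def)
  also have "\<dots> = f' z" using z pq by (simp add: divided_difference_def)
  finally show ?thesis using b[of z] z pq by auto
qed

text \<open>This is \<open>ln (1 + u) >= u - 2 u^2\<close> for \<open>|u| <= 1/2\<close>,
  exponentiated. Any \<open>q >= u^2\<close> is allowed so that one constant can serve all factors
  of a product.\<close>

lemma exp_le_one_plus:
  fixes u q :: real
  assumes "\<bar>u\<bar> \<le> 1/2" "u\<^sup>2 \<le> q"
  shows "exp (u - 2 * q) \<le> 1 + u"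
proof -
  have "u - 2 * q \<le> ln (1 + u)"
    using abs_ln_one_plus_x_minus_x_bound[OF assms(1)] assms(2) by linarith
  then have "exp (u - 2 * q) \<le> exp (ln (1 + u))" by simp
  then show ?thesis using assms(1) by simp
qed

lemma exp_le_one_plus_powr:
  fixes u q p :: real
  assumes "\<bar>u\<bar> \<le> 1/2" "u\<^sup>2 \<le> q" "p \<ge> 0"
  shows "exp (p * (u - 2 * q)) \<le> (1 + u) powr p"
proof -
  have "exp (p * (u - 2 * q)) = exp (u - 2 * q) powr p" by (simp add: exp_powr_real mult.commute)
  also have "\<dots> \<le> (1 + u) powr p" by (intro powr_mono2 exp_le_one_plus assms) auto
  finally show ?thesis .
qed

text \<open>The coefficient of \<open>\<epsilon>\<close> in the logarithm of the transported over
  the original density, for the vector field \<open>k l = l * (1 - l) * G l\<close> with derivative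
  \<open>k'\<close>. The three sums come from the Jacobian, the Vandermonde factor and the weight
  \<open>l powr A * (1 - l) powr B\<close>; the last is \<open>k\<close> times
  \<open>A / l - B / (1 - l)\<close>.\<close>

definition loop_lin :: "nat \<Rightarrow> real \<Rightarrow> real \<Rightarrow> real \<Rightarrow> (real \<Rightarrow> real) \<Rightarrow> (real \<Rightarrow> real) \<Rightarrow> (nat \<Rightarrow> real) \<Rightarrow> real" where
  "loop_lin n \<beta> A B G k' x = (\<Sum>i<n. k' (x i))
     + \<beta> * (\<Sum>i<n. \<Sum>j\<in>{i<..<n}. divided_difference (\<lambda>l. l * (1 - l) * G l) k' (x i) (x j))
     + (\<Sum>i<n. (A * (1 - x i) - B * x i) * G (x i))"

text \<open>The squares of \<open>G\<close> are summed instead of being replaced by a supremum: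
  \<open>A + B\<close> may be much larger than \<open>n\<close>, and only the smallness of
  \<open>G = g / s\<close> near the centre keeps this sum at order \<open>n^2\<close>.\<close>

definition loop_quad :: "nat \<Rightarrow> real \<Rightarrow> real \<Rightarrow> real \<Rightarrow> real \<Rightarrow> (real \<Rightarrow> real) \<Rightarrow> (nat \<Rightarrow> real) \<Rightarrow> real" where
  "loop_quad n \<beta> A B K G x = real n * K\<^sup>2 + \<beta> * (real n)\<^sup>2 * K\<^sup>2 + (A + B) * (\<Sum>i<n. (G (x i))\<^sup>2)"

abbreviation loop_exponent :: "nat \<Rightarrow> real \<Rightarrow> real \<Rightarrow> real \<Rightarrow> real \<Rightarrow> real \<Rightarrow> (real \<Rightarrow> real) \<Rightarrow> (real \<Rightarrow> real) \<Rightarrow> (nat \<Rightarrow> real) \<Rightarrow> real" where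
  "loop_exponent n \<beta> A B K \<epsilon> G k' x \<equiv>
     \<epsilon> * loop_lin n \<beta> A B G k' x - 2 * \<epsilon>\<^sup>2 * loop_quad n \<beta> A B K G x"

lemma borel_measurable_jacobi_density [measurable]:
  "jacobi_density n \<beta> a b \<in> borel_measurable (lebesgue_PiM n)"
proof -
  have [measurable]: "(\<lambda>x. \<bar>x i - x j\<bar> powr \<beta>) \<in> borel_measurable (lebesgue_PiM n)"
    if "i \<in> {..<n}" "j \<in> {i<..<n}" for i j
  proof -
    have "j \<in> {..<n}" using that by auto
    then show ?thesis using that(1) by measurable
  qed
  show ?thesis
    unfolding jacobi_density_def[abs_def] Let_def by measurable
qed

lemma jacobi_density_nonneg: "jacobi_density n \<beta> a b x \<ge> 0"
  unfolding jacobi_density_def Let_def by (auto intro!: mult_nonneg_nonneg prod_nonneg)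

lemma borel_measurable_loop_lin:
  assumes [measurable]: "G \<in> borel_measurable borel" "k' \<in> borel_measurable borel"
  shows "loop_lin n \<beta> A B G k' \<in> borel_measurable (lebesgue_PiM n)"
proof -
  have [measurable]: "(\<lambda>x. divided_difference (\<lambda>l. l * (1 - l) * G l) k' (x i) (x j)) \<in> borel_measurable (lebesgue_PiM n)"
    if "i \<in> {..<n}" "j \<in> {i<..<n}" for i j
  proof -
    have "j \<in> {..<n}" using that by auto
    then show ?thesis using that(1) by measurable
  qed
  show ?thesis
    unfolding loop_lin_def[abs_def] by measurable
qed

lemma borel_measurable_loop_quad:
  assumes [measurable]: "G \<in> borel_measurable borel"
  shows "loop_quad n \<beta> A B K G \<in> borel_measurable (lebesgue_PiM n)"
  unfolding loop_quad_def[abs_def] by measurable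

text \<open>\<open>\<epsilon>K\<close> makes the Jacobian \<open>1 + \<epsilon> * k'\<close>
  positive on [0,1], and the field vanishes at 0 and 1, so the transport maps [0,1] onto itself.
  \<open>\<epsilon>G\<close> keeps the relative changes of \<open>l\<close> and \<open>1 - l\<close>
  below 1/2, the range of the logarithmic bound.\<close>

locale loop_perturbation =
  fixes n :: nat and \<beta> A B K \<epsilon> :: real and G k' :: "real \<Rightarrow> real"
  assumes \<beta>: "\<beta> > 0" and A: "A \<ge> 0" and B: "B \<ge> 0"
    and G_cont: "continuous_on UNIV G" and k'_cont: "continuous_on UNIV k'"
    and deriv: "\<And>l. ((\<lambda>l. l * (1 - l) * G l) has_real_derivative k' l) (at l)"
    and K: "\<And>l. 0 \<le> l \<Longrightarrow> l \<le> 1 \<Longrightarrow> \<bar>k' l\<bar> \<le> K"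
    and \<epsilon>K: "\<bar>\<epsilon>\<bar> * K \<le> 1/2"
    and \<epsilon>G: "\<And>l. 0 \<le> l \<Longrightarrow> l \<le> 1 \<Longrightarrow> \<bar>\<epsilon> * G l\<bar> \<le> 1/2"
begin

abbreviation k where "k \<equiv> \<lambda>l. l * (1 - l) * G l"
definition \<phi> where "\<phi> l = l + \<epsilon> * k l"

lemma G_meas [measurable]: "G \<in> borel_measurable borel"
  using G_cont by (rule borel_measurable_continuous_onI)
lemma k'_meas [measurable]: "k' \<in> borel_measurable borel"
  using k'_cont by (rule borel_measurable_continuous_onI)
lemma \<phi>_meas [measurable]: "\<phi> \<in> borel_measurable borel"
  unfolding \<phi>_def[abs_def] by measurable

lemma \<phi>_deriv: "(\<phi> has_real_derivative (1 + \<epsilon> * k' l)) (at l)"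
  unfolding \<phi>_def[abs_def] by (intro DERIV_add DERIV_ident DERIV_cmult deriv)

lemma abs_\<epsilon>K: "\<bar>z\<bar> \<le> K \<Longrightarrow> \<bar>\<epsilon> * z\<bar> \<le> 1/2"
  using \<epsilon>K mult_left_mono[of "\<bar>z\<bar>" K "\<bar>\<epsilon>\<bar>"] by (simp add: abs_mult)

lemma sq_\<epsilon>K: "\<bar>z\<bar> \<le> K \<Longrightarrow> (\<epsilon> * z)\<^sup>2 \<le> \<epsilon>\<^sup>2 * K\<^sup>2"
  by (auto simp: power_mult_distrib intro!: mult_left_mono abs_le_square_iff[THEN iffD1])

lemma substitution:
  assumes [measurable]: "f \<in> borel_measurable borel"
  shows "(\<integral>\<^sup>+x. f (\<phi> x) * (ennreal (1 + \<epsilon> * k' x) * indicator {0..1} x) \<partial>lborel)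
       = (\<integral>\<^sup>+y. f y * indicator {0..1} y \<partial>lborel)"
proof -
  have "(\<integral>\<^sup>+x. f x * indicator {\<phi> 0..\<phi> 1} x \<partial>lborel) =
        (\<integral>\<^sup>+x. f (\<phi> x) * ennreal (1 + \<epsilon> * k' x) * indicator {0..1} x \<partial>lborel)"
  proof (rule nn_integral_substitution_aux)
    show "continuous_on {0..1} (\<lambda>x. 1 + \<epsilon> * k' x)"
      using k'_cont by (intro continuous_intros) (auto intro: continuous_on_subset)
    show "0 \<le> 1 + \<epsilon> * k' x" if "x \<in> {0..1}" for x
      using abs_\<epsilon>K[OF K, of x] that by (simp add: abs_le_iff)
  qed (auto intro: \<phi>_deriv)
  then show ?thesis by (simp add: \<phi>_def mult.assoc)
qed

lemma \<phi>_eq: "\<phi> l = l * (1 + \<epsilon> * (1 - l) * G l)" "1 - \<phi> l = (1 - l) * (1 + - (\<epsilon> * l * G l))"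
  by (simp_all add: \<phi>_def algebra_simps)

lemma \<epsilon>G_bounds:
  assumes "0 < l" "l < 1"
  shows "\<bar>\<epsilon> * (1 - l) * G l\<bar> \<le> 1/2" "(\<epsilon> * (1 - l) * G l)\<^sup>2 \<le> \<epsilon>\<^sup>2 * (G l)\<^sup>2"
    "\<bar>- (\<epsilon> * l * G l)\<bar> \<le> 1/2" "(- (\<epsilon> * l * G l))\<^sup>2 \<le> \<epsilon>\<^sup>2 * (G l)\<^sup>2"
proof -
  have gen: "\<bar>\<epsilon> * m * G l\<bar> \<le> 1/2 \<and> (\<epsilon> * m * G l)\<^sup>2 \<le> \<epsilon>\<^sup>2 * (G l)\<^sup>2" if "0 < m" "m < 1" for m
  proof
    have e: "\<epsilon> * m * G l = m * (\<epsilon> * G l)" by simp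
    have le: "\<bar>\<epsilon> * m * G l\<bar> \<le> \<bar>\<epsilon> * G l\<bar>"
      unfolding e abs_mult[of m] using that by (intro mult_left_le_one_le) auto
    then show "\<bar>\<epsilon> * m * G l\<bar> \<le> 1/2" using \<epsilon>G[of l] assms by linarith
    show "(\<epsilon> * m * G l)\<^sup>2 \<le> \<epsilon>\<^sup>2 * (G l)\<^sup>2"
      using le unfolding abs_le_square_iff by (simp add: power_mult_distrib)
  qed
  show "\<bar>\<epsilon> * (1 - l) * G l\<bar> \<le> 1/2" "(\<epsilon> * (1 - l) * G l)\<^sup>2 \<le> \<epsilon>\<^sup>2 * (G l)\<^sup>2"
    "\<bar>- (\<epsilon> * l * G l)\<bar> \<le> 1/2" "(- (\<epsilon> * l * G l))\<^sup>2 \<le> \<epsilon>\<^sup>2 * (G l)\<^sup>2"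
    using gen[of l] gen[of "1 - l"] assms by auto
qed

lemma \<phi>_range: "0 < l \<Longrightarrow> l < 1 \<Longrightarrow> 0 < \<phi> l \<and> \<phi> l < 1"
proof -
  assume l: "0 < l" "l < 1"
  have "0 < l * (1 + \<epsilon> * (1 - l) * G l)"
    using \<epsilon>G_bounds(1)[OF l] l by (intro mult_pos_pos) (simp_all add: abs_le_iff)
  moreover have "0 < (1 - l) * (1 + - (\<epsilon> * l * G l))"
    using \<epsilon>G_bounds(3)[OF l] l by (intro mult_pos_pos) (simp_all add: abs_le_iff)
  ultimately show ?thesis using \<phi>_eq[of l] by simp
qed

lemma \<phi>_diff: "\<phi> x - \<phi> y = (x - y) + \<epsilon> * (k x - k y)"
  by (simp add: \<phi>_def right_diff_distrib)

text \<open>Differences factor as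
  \<open>\<phi> x - \<phi> y = (x - y) * (1 + \<epsilon> * d)\<close> with \<open>d\<close> the
  divided difference of \<open>k\<close>, and \<open>|d| <= K\<close> by the mean value theorem. For
  \<open>x = y\<close> both sides are 0.\<close>

lemma vandermonde_factor:
  assumes "0 < x" "x < 1" "0 < y" "y < 1"
  shows "\<bar>x - y\<bar> powr \<beta> * exp (\<beta> * (\<epsilon> * divided_difference k k' x y - 2 * (\<epsilon>\<^sup>2 * K\<^sup>2)))
       \<le> \<bar>\<phi> x - \<phi> y\<bar> powr \<beta>"
proof (cases "x = y")
  case False
  let ?d = "divided_difference k k' x y"
  have d: "\<bar>?d\<bar> \<le> K"
    by (rule abs_divided_difference_le[where l=0 and u=1]) (use assms K deriv in auto)
  have kd: "k x - k y = (x - y) * ?d"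
    using False by (simp add: divided_difference_def)
  have "\<phi> x - \<phi> y = (x - y) * (1 + \<epsilon> * ?d)"
    unfolding \<phi>_diff kd by (simp add: distrib_left)
  moreover have "0 \<le> 1 + \<epsilon> * ?d" using abs_\<epsilon>K[OF d] by (simp add: abs_le_iff)
  ultimately have "\<bar>\<phi> x - \<phi> y\<bar> powr \<beta> = \<bar>x - y\<bar> powr \<beta> * (1 + \<epsilon> * ?d) powr \<beta>"
    by (simp add: abs_mult powr_mult)
  then show ?thesis
    using exp_le_one_plus_powr[OF abs_\<epsilon>K[OF d] sq_\<epsilon>K[OF d], of \<beta>] \<beta>
    by (auto intro!: mult_left_mono)
qed simp

lemma potential_factor:
  assumes "0 < x" "x < 1"
  shows "x powr A * (1 - x) powr B *
      exp (\<epsilon> * ((A * (1 - x) - B * x) * G x) - 2 * (\<epsilon>\<^sup>2 * ((A + B) * (G x)\<^sup>2)))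
     \<le> \<phi> x powr A * (1 - \<phi> x) powr B"
proof -
  have 1: "\<phi> x powr A = x powr A * (1 + \<epsilon> * (1 - x) * G x) powr A"
    unfolding \<phi>_eq(1) using \<epsilon>G_bounds(1)[OF assms] assms by (subst powr_mult) (auto simp: abs_le_iff)
  have 2: "(1 - \<phi> x) powr B = (1 - x) powr B * (1 + - (\<epsilon> * x * G x)) powr B"
    unfolding \<phi>_eq(2) using \<epsilon>G_bounds(3)[OF assms] assms by (subst powr_mult) (auto simp: abs_le_iff)
  have "exp (\<epsilon> * ((A * (1 - x) - B * x) * G x) - 2 * (\<epsilon>\<^sup>2 * ((A + B) * (G x)\<^sup>2)))
      = exp (A * (\<epsilon> * (1 - x) * G x - 2 * (\<epsilon>\<^sup>2 * (G x)\<^sup>2))) * exp (B * (- (\<epsilon> * x * G x) - 2 * (\<epsilon>\<^sup>2 * (G x)\<^sup>2)))"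
    unfolding exp_add[symmetric] by (simp add: algebra_simps)
  also have "\<dots> \<le> (1 + \<epsilon> * (1 - x) * G x) powr A * (1 + - (\<epsilon> * x * G x)) powr B"
    by (intro mult_mono exp_le_one_plus_powr \<epsilon>G_bounds assms A B) auto
  finally have "x powr A * (1 - x) powr B * exp (\<epsilon> * ((A * (1 - x) - B * x) * G x) - 2 * (\<epsilon>\<^sup>2 * ((A + B) * (G x)\<^sup>2)))
     \<le> x powr A * (1 - x) powr B * ((1 + \<epsilon> * (1 - x) * G x) powr A * (1 + - (\<epsilon> * x * G x)) powr B)"
    by (intro mult_left_mono) auto
  then show ?thesis unfolding 1 2 by (simp only: mult_ac)
qed

lemma jacobian_factor:
  assumes "0 < x" "x < 1"
  shows "exp (\<epsilon> * k' x - 2 * (\<epsilon>\<^sup>2 * K\<^sup>2)) \<le> 1 + \<epsilon> * k' x"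
  using K[of x] assms by (intro exp_le_one_plus abs_\<epsilon>K sq_\<epsilon>K) auto

lemma density_le:
  assumes a: "A = a - (\<beta> / 2 * (real n - 1) + 1)" and b: "B = b - (\<beta> / 2 * (real n - 1) + 1)"
    and x: "\<And>i. i < n \<Longrightarrow> 0 < x i \<and> x i < 1"
  shows "jacobi_density n \<beta> a b x * exp (loop_exponent n \<beta> A B K \<epsilon> G k' x)
    \<le> jacobi_density n \<beta> a b (\<lambda>i\<in>{..<n}. \<phi> (x i)) * (\<Prod>i<n. 1 + \<epsilon> * k' (x i))"
proof -
  let ?d = "\<lambda>i j. divided_difference k k' (x i) (x j)"
  let ?V = "\<Prod>i<n. \<Prod>j\<in>{i<..<n}. \<bar>x i - x j\<bar> powr \<beta>"
  let ?W = "\<Prod>i<n. x i powr A * (1 - x i) powr B"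
  let ?v = "\<lambda>i. \<epsilon> * ((A * (1 - x i) - B * x i) * G (x i)) - 2 * (\<epsilon>\<^sup>2 * ((A + B) * (G (x i))\<^sup>2))"
  have rho: "jacobi_density n \<beta> a b x = ?V * ?W"
    using x by (simp add: jacobi_density_def Let_def a b)
  have rho': "jacobi_density n \<beta> a b (\<lambda>i\<in>{..<n}. \<phi> (x i)) =
      (\<Prod>i<n. \<Prod>j\<in>{i<..<n}. \<bar>\<phi> (x i) - \<phi> (x j)\<bar> powr \<beta>) * (\<Prod>i<n. \<phi> (x i) powr A * (1 - \<phi> (x i)) powr B)"
    using x \<phi>_range by (simp add: jacobi_density_def Let_def a b)
  have pairs: "(\<Sum>i<n. \<Sum>j\<in>{i<..<n}. (1::real)) \<le> (real n)\<^sup>2"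
  proof -
    have "(\<Sum>i<n. \<Sum>j\<in>{i<..<n}. (1::real)) \<le> (\<Sum>i<n. real n)"
      by (intro sum_mono) auto
    then show ?thesis by (simp add: power2_eq_square)
  qed
  \<comment> \<open>An inequality only because the number of pairs is replaced by the cruder
    \<open>n^2\<close> in the quadratic term.\<close>
  have expo: "loop_exponent n \<beta> A B K \<epsilon> G k' x \<le>
      (\<Sum>i<n. \<Sum>j\<in>{i<..<n}. \<beta> * (\<epsilon> * ?d i j - 2 * (\<epsilon>\<^sup>2 * K\<^sup>2))) + (\<Sum>i<n. ?v i) + (\<Sum>i<n. \<epsilon> * k' (x i) - 2 * (\<epsilon>\<^sup>2 * K\<^sup>2))"
  proof -
    have "(\<Sum>i<n. \<Sum>j\<in>{i<..<n}. \<beta> * (\<epsilon> * ?d i j - 2 * (\<epsilon>\<^sup>2 * K\<^sup>2)))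
       = (\<beta> * \<epsilon>) * (\<Sum>i<n. \<Sum>j\<in>{i<..<n}. ?d i j) - (2 * \<beta> * \<epsilon>\<^sup>2 * K\<^sup>2) * (\<Sum>i<n. \<Sum>j\<in>{i<..<n}. (1::real))"
      unfolding sum_distrib_left sum_subtractf[symmetric] by (intro sum.cong refl) (simp add: algebra_simps)
    moreover have "(2 * \<beta> * \<epsilon>\<^sup>2 * K\<^sup>2) * (\<Sum>i<n. \<Sum>j\<in>{i<..<n}. (1::real)) \<le> (2 * \<beta> * \<epsilon>\<^sup>2 * K\<^sup>2) * (real n)\<^sup>2"
      using \<beta> by (intro mult_left_mono pairs) auto
    moreover have "(\<Sum>i<n. ?v i) = \<epsilon> * (\<Sum>i<n. (A * (1 - x i) - B * x i) * G (x i)) - (2 * \<epsilon>\<^sup>2 * (A + B)) * (\<Sum>i<n. (G (x i))\<^sup>2)"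
      unfolding sum_distrib_left sum_subtractf[symmetric] by (intro sum.cong refl) (simp only: mult_ac)
    moreover have "(\<Sum>i<n. \<epsilon> * k' (x i) - 2 * (\<epsilon>\<^sup>2 * K\<^sup>2)) = \<epsilon> * (\<Sum>i<n. k' (x i)) - 2 * \<epsilon>\<^sup>2 * (real n * K\<^sup>2)"
      by (simp add: sum_subtractf sum_distrib_left)
    moreover have "loop_exponent n \<beta> A B K \<epsilon> G k' x =
       \<epsilon> * (\<Sum>i<n. k' (x i)) + (\<beta> * \<epsilon>) * (\<Sum>i<n. \<Sum>j\<in>{i<..<n}. ?d i j) + \<epsilon> * (\<Sum>i<n. (A * (1 - x i) - B * x i) * G (x i))
       - 2 * \<epsilon>\<^sup>2 * (real n * K\<^sup>2) - (2 * \<beta> * \<epsilon>\<^sup>2 * K\<^sup>2) * (real n)\<^sup>2 - (2 * \<epsilon>\<^sup>2 * (A + B)) * (\<Sum>i<n. (G (x i))\<^sup>2)"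
      unfolding loop_lin_def loop_quad_def by algebra
    ultimately show ?thesis by linarith
  qed
  have "jacobi_density n \<beta> a b x * exp (loop_exponent n \<beta> A B K \<epsilon> G k' x)
     \<le> jacobi_density n \<beta> a b x * exp ((\<Sum>i<n. \<Sum>j\<in>{i<..<n}. \<beta> * (\<epsilon> * ?d i j - 2 * (\<epsilon>\<^sup>2 * K\<^sup>2))) + (\<Sum>i<n. ?v i) + (\<Sum>i<n. \<epsilon> * k' (x i) - 2 * (\<epsilon>\<^sup>2 * K\<^sup>2)))"
    using expo by (intro mult_left_mono jacobi_density_nonneg) simp
  also have "\<dots> = (\<Prod>i<n. \<Prod>j\<in>{i<..<n}. \<bar>x i - x j\<bar> powr \<beta> * exp (\<beta> * (\<epsilon> * ?d i j - 2 * (\<epsilon>\<^sup>2 * K\<^sup>2))))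
      * (\<Prod>i<n. x i powr A * (1 - x i) powr B * exp (?v i)) * (\<Prod>i<n. exp (\<epsilon> * k' (x i) - 2 * (\<epsilon>\<^sup>2 * K\<^sup>2)))"
    unfolding rho by (simp add: prod.distrib exp_add exp_sum)
  also have "\<dots> \<le> (\<Prod>i<n. \<Prod>j\<in>{i<..<n}. \<bar>\<phi> (x i) - \<phi> (x j)\<bar> powr \<beta>) * (\<Prod>i<n. \<phi> (x i) powr A * (1 - \<phi> (x i)) powr B)
      * (\<Prod>i<n. 1 + \<epsilon> * k' (x i))"
    using x
    by (intro mult_mono prod_mono conjI vandermonde_factor potential_factor jacobian_factor
        prod_nonneg mult_nonneg_nonneg) (auto intro!: prod_nonneg)
  finally show ?thesis unfolding rho' .
qed

text \<open>Integrating the pointwise bound and undoing the transport on the cube returns the mass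
  of the density itself, whatever its value.\<close>

lemma nn_integral_density_exp_le:
  assumes a: "A = a - (\<beta> / 2 * (real n - 1) + 1)" and b: "B = b - (\<beta> / 2 * (real n - 1) + 1)"
  shows "(\<integral>\<^sup>+x. ennreal (jacobi_density n \<beta> a b x) *
      ennreal (exp (loop_exponent n \<beta> A B K \<epsilon> G k' x)) \<partial>lebesgue_PiM n)
    \<le> (\<integral>\<^sup>+x. ennreal (jacobi_density n \<beta> a b x) \<partial>lebesgue_PiM n)"
    (is "?L \<le> _")
proof -
  have "?L \<le> (\<integral>\<^sup>+x. ennreal (jacobi_density n \<beta> a b (\<lambda>i\<in>{..<n}. \<phi> (x i))) *
      (\<Prod>i<n. ennreal (1 + \<epsilon> * k' (x i)) * indicator {0..1} (x i)) \<partial>lebesgue_PiM n)"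
  proof (rule nn_integral_mono)
    fix x
    show "ennreal (jacobi_density n \<beta> a b x) *
      ennreal (exp (loop_exponent n \<beta> A B K \<epsilon> G k' x)) \<le>
      ennreal (jacobi_density n \<beta> a b (\<lambda>i\<in>{..<n}. \<phi> (x i))) *
      (\<Prod>i<n. ennreal (1 + \<epsilon> * k' (x i)) * indicator {0..1} (x i))"
    proof (cases "\<forall>i<n. 0 < x i \<and> x i < 1")
      case True
      have nn: "0 \<le> 1 + \<epsilon> * k' (x i)" if "i < n" for i
        using abs_\<epsilon>K[OF K, of "x i"] True that by (simp add: abs_le_iff less_imp_le)
      have "(\<Prod>i<n. ennreal (1 + \<epsilon> * k' (x i)) * indicator {0..1} (x i)) = (\<Prod>i<n. ennreal (1 + \<epsilon> * k' (x i)))"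
        using True by (intro prod.cong) (auto simp: less_imp_le)
      also have "\<dots> = ennreal (\<Prod>i<n. 1 + \<epsilon> * k' (x i))"
        by (rule prod_ennreal) (use nn in auto)
      finally show ?thesis
        using density_le[OF a b, of x] True
        by (simp add: ennreal_mult'[symmetric] jacobi_density_nonneg ennreal_leI)
    next
      case False
      then have "jacobi_density n \<beta> a b x = 0" by (auto simp: jacobi_density_def Let_def)
      then show ?thesis by simp
    qed
  qed
  also have "\<dots> = (\<integral>\<^sup>+y. ennreal (jacobi_density n \<beta> a b y) * (\<Prod>i<n. indicator {0..1} (y i)) \<partial>lebesgue_PiM n)"
    by (rule nn_integral_PiM_substitution) (auto intro: substitution)
  also have "\<dots> \<le> (\<integral>\<^sup>+y. ennreal (jacobi_density n \<beta> a b y) * 1 \<partial>lebesgue_PiM n)"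
    by (intro nn_integral_mono mult_left_mono prod_le_1) (auto simp: indicator_def)
  finally show ?thesis by simp
qed

end

section \<open>Exponential inequalities for the Jacobi ensemble\<close>

lemma (in prob_space) prob_ge_le_exp:
  assumes [measurable]: "Y \<in> borel_measurable M"
    and le: "(\<integral>\<^sup>+\<omega>. ennreal (exp (Y \<omega>)) \<partial>M) \<le> 1"
  shows "prob {\<omega> \<in> space M. Y \<omega> \<ge> u} \<le> exp (- u)"
proof -
  have "ennreal (prob {\<omega> \<in> space M. Y \<omega> \<ge> u}) = (\<integral>\<^sup>+\<omega>. indicator {\<omega> \<in> space M. Y \<omega> \<ge> u} \<omega> \<partial>M)"
    by (simp add: emeasure_eq_measure)
  also have "\<dots> \<le> (\<integral>\<^sup>+\<omega>. ennreal (exp (- u)) * ennreal (exp (Y \<omega>)) \<partial>M)"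
    by (intro nn_integral_mono) (auto simp: indicator_def ennreal_mult[symmetric] exp_add[symmetric])
  also have "\<dots> = ennreal (exp (- u)) * (\<integral>\<^sup>+\<omega>. ennreal (exp (Y \<omega>)) \<partial>M)"
    by (rule nn_integral_cmult) measurable
  also have "\<dots> \<le> ennreal (exp (- u)) * 1"
    by (intro mult_left_mono le) auto
  finally show ?thesis by (simp add: ennreal_le_iff)
qed

text \<open>The bound is \<open>n^-2\<close>, hence summable. It is asked only from \<open>m\<close>
  on because the perturbation estimates are available only for large \<open>n\<close>.\<close>

lemma (in prob_space) AE_eventually_not_in:
  assumes A: "\<And>n. n \<ge> m \<Longrightarrow> A n \<in> events"
    and p: "\<And>n. n \<ge> m \<Longrightarrow> prob (A n) \<le> exp (- (2 * ln (real n)))"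
  shows "AE \<omega> in M. \<forall>\<^sub>F n in sequentially. \<omega> \<notin> A n"
proof -
  define A' where "A' n = (if n \<ge> m then A n else {})" for n
  have [measurable]: "A' n \<in> events" for n using A by (simp add: A'_def)
  have "summable (\<lambda>n. prob (A' n))"
  proof (rule summable_comparison_test_ev)
    show "\<forall>\<^sub>F n in sequentially. norm (prob (A' n)) \<le> inverse (real n ^ 2)"
      using eventually_ge_at_top[of "max m 1"]
    proof eventually_elim
      case (elim n)
      then have "prob (A' n) \<le> exp (- (2 * ln (real n)))" using p[of n] by (simp add: A'_def)
      also have "exp (- (2 * ln (real n))) = inverse (exp (ln (real n)) ^ 2)"
        by (simp add: exp_minus exp_of_nat_mult[symmetric])
      also have "\<dots> = inverse (real n ^ 2)" using elim by simp
      finally show ?case by simp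
    qed
    show "summable (\<lambda>n. inverse (real n ^ 2))" by (rule inverse_power_summable) simp
  qed
  then have "AE \<omega> in M. \<forall>\<^sub>F n in sequentially. \<omega> \<in> space M - A' n"
    by (intro borel_cantelli_AE1) (auto simp: emeasure_eq_measure)
  then show ?thesis
  proof eventually_elim
    case (elim \<omega>)
    then show ?case using eventually_ge_at_top[of m]
      by eventually_elim (auto simp: A'_def)
  qed
qed

lemma loop_lin_cong:
  "(\<And>i. i < n \<Longrightarrow> x i = y i) \<Longrightarrow> loop_lin n \<beta> A B G k' x = loop_lin n \<beta> A B G k' y"
  unfolding loop_lin_def by (auto intro!: arg_cong2[where f="(+)"] arg_cong2[where f="(*)"] sum.cong)

lemma loop_quad_cong:
  "(\<And>i. i < n \<Longrightarrow> x i = y i) \<Longrightarrow> loop_quad n \<beta> A B K G x = loop_quad n \<beta> A B K G y"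
  unfolding loop_quad_def by (auto intro!: arg_cong2[where f="(+)"] arg_cong2[where f="(*)"] sum.cong)

lemma sets_jacobi_eigenvalues [measurable_cong]:
  "sets (jacobi_eigenvalues n \<beta> a b) = sets (lebesgue_PiM n)"
  by (simp add: jacobi_eigenvalues_def)

section \<open>One sample: marginal laws and deviation bounds\<close>

text \<open>Restricting to \<open>{..<n}\<close> makes the values at indices \<open>i >= n\<close>
  irrelevant. Equality of the joint law with a product measure carries the independence of
  eigenvalues and weights.\<close>

locale jacobi_sample = prob_space M for M :: "'w measure" +
  fixes n :: nat and \<beta> a b :: real and lam w :: "'w \<Rightarrow> nat \<Rightarrow> real"
  assumes n: "n \<ge> 1" and \<beta>: "\<beta> > 0"
    and meas: "(\<lambda>\<omega>. (restrict (lam \<omega>) {..<n}, restrict (w \<omega>) {..<n}))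
             \<in> M \<rightarrow>\<^sub>M (PiM {..<n} (\<lambda>_. lborel) \<Otimes>\<^sub>M PiM {..<n} (\<lambda>_. lborel))"
    and law: "distr M (PiM {..<n} (\<lambda>_. lborel) \<Otimes>\<^sub>M PiM {..<n} (\<lambda>_. lborel))
             (\<lambda>\<omega>. (restrict (lam \<omega>) {..<n}, restrict (w \<omega>) {..<n}))
           = jacobi_ensemble n \<beta> a b"
begin

abbreviation L where "L \<equiv> PiM {..<n} (\<lambda>_. lborel :: real measure)"
abbreviation E where "E \<equiv> jacobi_eigenvalues n \<beta> a b"
abbreviation D where "D \<equiv> dirichlet n (\<beta> / 2)"
abbreviation rlam where "rlam \<omega> \<equiv> restrict (lam \<omega>) {..<n}"
abbreviation rw where "rw \<omega> \<equiv> restrict (w \<omega>) {..<n}"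

lemma rlam_meas [measurable]: "(\<lambda>\<omega>. rlam \<omega>) \<in> M \<rightarrow>\<^sub>M L"
  using measurable_compose[OF meas measurable_fst] by simp

lemma rw_meas [measurable]: "(\<lambda>\<omega>. rw \<omega>) \<in> M \<rightarrow>\<^sub>M L"
  using measurable_compose[OF meas measurable_snd] by simp

lemma lam_meas: "i < n \<Longrightarrow> (\<lambda>\<omega>. lam \<omega> i) \<in> borel_measurable M"
  using measurable_compose[OF rlam_meas measurable_component_singleton[of i]] by simp

lemma w_meas: "i < n \<Longrightarrow> (\<lambda>\<omega>. w \<omega> i) \<in> borel_measurable M"
  using measurable_compose[OF rw_meas measurable_component_singleton[of i]] by simp

sublocale D: prob_space D
  using n \<beta> by (intro prob_space_dirichlet) auto

lemma nn_integral_sample: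
  assumes [measurable]: "f \<in> borel_measurable (L \<Otimes>\<^sub>M L)"
  shows "(\<integral>\<^sup>+\<omega>. f (rlam \<omega>, rw \<omega>) \<partial>M) = (\<integral>\<^sup>+x. \<integral>\<^sup>+y. f (x, y) \<partial>D \<partial>E)"
proof -
  have "(\<integral>\<^sup>+\<omega>. f (rlam \<omega>, rw \<omega>) \<partial>M) = (\<integral>\<^sup>+p. f p \<partial>jacobi_ensemble n \<beta> a b)"
    unfolding law[symmetric] by (rule nn_integral_distr[symmetric]) (use meas in auto)
  also have "\<dots> = (\<integral>\<^sup>+x. \<integral>\<^sup>+y. f (x, y) \<partial>D \<partial>E)"
    unfolding jacobi_ensemble_def by (rule D.nn_integral_fst[symmetric]) measurable
  finally show ?thesis .
qed

lemma distr_lam: "distr M L (\<lambda>\<omega>. rlam \<omega>) = E" (is "?N = _")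
proof (rule measure_eqI)
  fix S assume "S \<in> sets ?N"
  then have S[measurable]: "S \<in> sets L" by simp
  have "emeasure ?N S = (\<integral>\<^sup>+x. indicator S x \<partial>?N)"
    by simp
  also have "\<dots> = (\<integral>\<^sup>+\<omega>. (\<lambda>p. indicator S (fst p)) (rlam \<omega>, rw \<omega>) \<partial>M)"
    by (subst nn_integral_distr) auto
  also have "\<dots> = (\<integral>\<^sup>+x. \<integral>\<^sup>+y. indicator S (fst (x, y)) \<partial>D \<partial>E)"
    by (rule nn_integral_sample) measurable
  also have "\<dots> = emeasure E S"
    using S D.emeasure_space_1 by (simp add: sets_jacobi_eigenvalues)
  finally show "emeasure ?N S = emeasure E S" .
qed (simp add: sets_jacobi_eigenvalues)

text \<open>Were the density not integrable or of integral 0, the division in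
  \<open>jacobi_eigenvalues\<close> would produce the zero measure. The existence of a sample
  excludes this, without evaluating the Selberg integral.\<close>

sublocale E: prob_space E
  unfolding distr_lam[symmetric] by (rule prob_space_distr) measurable

lemma distr_w: "distr M L (\<lambda>\<omega>. rw \<omega>) = D" (is "?N = _")
proof (rule measure_eqI)
  fix S assume "S \<in> sets ?N"
  then have S[measurable]: "S \<in> sets L" by simp
  have "emeasure ?N S = (\<integral>\<^sup>+x. indicator S x \<partial>?N)"
    by simp
  also have "\<dots> = (\<integral>\<^sup>+\<omega>. (\<lambda>p. indicator S (snd p)) (rlam \<omega>, rw \<omega>) \<partial>M)"
    by (subst nn_integral_distr) auto
  also have "\<dots> = (\<integral>\<^sup>+x. \<integral>\<^sup>+y. indicator S (snd (x, y)) \<partial>D \<partial>E)"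
    by (rule nn_integral_sample) measurable
  also have "\<dots> = emeasure D S"
    using S by (simp add: E.emeasure_space_1 sets_dirichlet)
  finally show "emeasure ?N S = emeasure D S" .
qed (simp add: sets_dirichlet)

lemma AE_w_simplex: "AE \<omega> in M. (\<forall>i<n. w \<omega> i > 0) \<and> (\<Sum>i<n. w \<omega> i) = 1"
proof -
  have "AE \<omega> in M. (\<forall>i<n. rw \<omega> i > 0) \<and> (\<Sum>i<n. rw \<omega> i) = 1"
    using AE_dirichlet_simplex[OF n, of "\<beta> / 2"] unfolding distr_w[symmetric]
    by (rule AE_distrD[OF rw_meas])
  then show ?thesis
  proof eventually_elim
    case (elim \<omega>)
    moreover have "(\<Sum>i<n. rw \<omega> i) = (\<Sum>i<n. w \<omega> i)" by (rule sum.cong) auto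
    ultimately show ?case by auto
  qed
qed

lemma AE_lam_range: "AE \<omega> in M. \<forall>i<n. 0 < lam \<omega> i \<and> lam \<omega> i < 1"
proof -
  have m: "(\<lambda>x. ennreal (jacobi_density n \<beta> a b x / integral\<^sup>L L (jacobi_density n \<beta> a b))) \<in> borel_measurable L"
    by measurable
  have "AE x in E. \<forall>i<n. 0 < x i \<and> x i < 1"
    unfolding jacobi_eigenvalues_def AE_density[OF m]
    by (rule AE_I2) (auto simp: jacobi_density_def Let_def split: if_splits)
  then have "AE \<omega> in M. \<forall>i<n. 0 < rlam \<omega> i \<and> rlam \<omega> i < 1"
    unfolding distr_lam[symmetric] by (rule AE_distrD[OF rlam_meas])
  then show ?thesis by eventually_elim auto
qed

lemma nn_integral_loop_exp_le:
  assumes lp: "loop_perturbation \<beta> A B K \<epsilon> G k'"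
    and A: "A = a - (\<beta> / 2 * (real n - 1) + 1)" and B: "B = b - (\<beta> / 2 * (real n - 1) + 1)"
  shows "(\<integral>\<^sup>+\<omega>. ennreal (exp (loop_exponent n \<beta> A B K \<epsilon> G k' (lam \<omega>))) \<partial>M) \<le> 1"
proof -
  interpret lp: loop_perturbation n \<beta> A B K \<epsilon> G k' by fact
  have [measurable]: "loop_lin n \<beta> A B G k' \<in> borel_measurable L" "loop_quad n \<beta> A B K G \<in> borel_measurable L"
    by (auto intro: borel_measurable_loop_lin borel_measurable_loop_quad lp.G_meas lp.k'_meas)
  let ?Z = "integral\<^sup>L L (jacobi_density n \<beta> a b)"
  let ?f = "\<lambda>x. exp (loop_exponent n \<beta> A B K \<epsilon> G k' x)"
  have "(\<integral>\<^sup>+\<omega>. ennreal (?f (lam \<omega>)) \<partial>M) = (\<integral>\<^sup>+\<omega>. ennreal (?f (rlam \<omega>)) \<partial>M)"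
    by (intro nn_integral_cong arg_cong[where f=ennreal] arg_cong[where f=exp] arg_cong2[where f="(-)"]
        arg_cong2[where f="(*)"] refl loop_lin_cong loop_quad_cong) auto
  also have "\<dots> = (\<integral>\<^sup>+x. ennreal (?f x) \<partial>E)"
    unfolding distr_lam[symmetric] by (subst nn_integral_distr) auto
  also have "\<dots> = (\<integral>\<^sup>+x. ennreal (1 / ?Z) * (ennreal (jacobi_density n \<beta> a b x) * ennreal (?f x)) \<partial>L)"
    unfolding jacobi_eigenvalues_def
    by (subst nn_integral_density)
       (auto simp: ennreal_mult'[symmetric] jacobi_density_nonneg mult.assoc[symmetric] ennreal_mult''[symmetric]
        intro!: nn_integral_cong)
  also have "\<dots> = ennreal (1 / ?Z) * (\<integral>\<^sup>+x. ennreal (jacobi_density n \<beta> a b x) * ennreal (?f x) \<partial>L)"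
    by (rule nn_integral_cmult) measurable
  also have "\<dots> \<le> ennreal (1 / ?Z) * (\<integral>\<^sup>+x. ennreal (jacobi_density n \<beta> a b x) \<partial>L)"
    by (intro mult_left_mono lp.nn_integral_density_exp_le A B) auto
  also have "\<dots> = (\<integral>\<^sup>+x. ennreal (1 / ?Z) * ennreal (jacobi_density n \<beta> a b x) \<partial>L)"
    by (rule nn_integral_cmult[symmetric]) measurable
  \<comment> \<open>\<open>1 / ?Z\<close> times the density is the density of \<open>E\<close>, so
    the constant disappears into a mass known to be 1.\<close>
  also have "\<dots> = (\<integral>\<^sup>+x. 1 \<partial>E)"
    unfolding jacobi_eigenvalues_def
    by (subst nn_integral_density)
       (auto simp: ennreal_mult''[symmetric] jacobi_density_nonneg intro!: nn_integral_cong)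
  also have "\<dots> = 1" by (simp add: E.emeasure_space_1)
  finally show ?thesis .
qed

lemma loop_meas:
  assumes lp: "loop_perturbation \<beta> A B K \<epsilon> G k'"
  shows "(\<lambda>\<omega>. loop_lin n \<beta> A B G k' (lam \<omega>)) \<in> borel_measurable M"
    "(\<lambda>\<omega>. loop_quad n \<beta> A B K G (lam \<omega>)) \<in> borel_measurable M"
proof -
  interpret lp: loop_perturbation n \<beta> A B K \<epsilon> G k' by fact
  have "(\<lambda>\<omega>. loop_lin n \<beta> A B G k' (rlam \<omega>)) \<in> borel_measurable M"
    by (rule measurable_compose[OF rlam_meas borel_measurable_loop_lin[OF lp.G_meas lp.k'_meas]])
  moreover have "loop_lin n \<beta> A B G k' (rlam \<omega>) = loop_lin n \<beta> A B G k' (lam \<omega>)" for \<omega>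
    by (rule loop_lin_cong) simp
  ultimately show "(\<lambda>\<omega>. loop_lin n \<beta> A B G k' (lam \<omega>)) \<in> borel_measurable M" by simp
  have "(\<lambda>\<omega>. loop_quad n \<beta> A B K G (rlam \<omega>)) \<in> borel_measurable M"
    by (rule measurable_compose[OF rlam_meas borel_measurable_loop_quad[OF lp.G_meas]])
  moreover have "loop_quad n \<beta> A B K G (rlam \<omega>) = loop_quad n \<beta> A B K G (lam \<omega>)" for \<omega>
    by (rule loop_quad_cong) simp
  ultimately show "(\<lambda>\<omega>. loop_quad n \<beta> A B K G (lam \<omega>)) \<in> borel_measurable M" by simp
qed

lemma prob_loop_ge:
  fixes u :: real
  assumes lp: "loop_perturbation \<beta> A B K \<epsilon> G k'"
    and A: "A = a - (\<beta> / 2 * (real n - 1) + 1)" and B: "B = b - (\<beta> / 2 * (real n - 1) + 1)"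
  defines "S \<equiv> {\<omega> \<in> space M. loop_exponent n \<beta> A B K \<epsilon> G k' (lam \<omega>) \<ge> u}"
  shows "S \<in> events" "prob S \<le> exp (- u)"
proof -
  note [measurable] = loop_meas[OF lp]
  show "S \<in> events" unfolding S_def by measurable
  show "prob S \<le> exp (- u)"
    unfolding S_def by (rule prob_ge_le_exp[OF _ nn_integral_loop_exp_le[OF lp A B]]) measurable
qed

text \<open>A Chernoff bound conditional on the eigenvalues, which are frozen while the weights are
  integrated. The negative moment of the weighted mean \<open>T\<close> of
  \<open>exp (\<theta> * f)\<close> is known exactly, and
  \<open>T <= exp (\<theta> * p + \<theta>^2)\<close>, with \<open>p\<close> the weighted mean of
  \<open>f\<close>, turns it into a bound on the uniform mean minus \<open>p\<close>. In the
  threshold, \<open>\<theta>\<close> pays for the quadratic term and the other summand is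
  \<open>u\<close> divided by the exponential rate.\<close>

lemma prob_weights_deviation:
  fixes f :: "real \<Rightarrow> real" and \<theta> u :: real
  assumes f [measurable]: "f \<in> borel_measurable borel" and f01: "\<And>x. 0 \<le> f x \<and> f x \<le> 1"
    and \<theta>: "0 < \<theta>" "\<theta> \<le> 1"
  defines "S \<equiv> {\<omega> \<in> space M. (\<Sum>i<n. f (lam \<omega> i)) / real n - (\<Sum>i<n. w \<omega> i * f (lam \<omega> i))
       \<ge> \<theta> + u / (real n * (\<beta> / 2) * \<theta>)}"
  shows "S \<in> events" "prob S \<le> exp (- u)"
proof -
  note [measurable] = lam_meas w_meas
  have *: "(\<lambda>\<omega>. lam \<omega> i) \<in> borel_measurable M" "(\<lambda>\<omega>. w \<omega> i) \<in> borel_measurable M" if "i \<in> {..<n}" for i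
    using that by auto
  note [measurable] = *
  show ev: "S \<in> events" unfolding S_def by measurable
  define \<alpha> where "\<alpha> = \<beta> / 2"
  have \<alpha>: "\<alpha> > 0" using \<beta> by (simp add: \<alpha>_def)
  \<comment> \<open>Normalised to have integral 1 over the weights for each fixed \<open>x\<close>:
    the first factor is the inverse of the product of \<open>t i powr (- \<alpha>)\<close> for
    \<open>t i = exp (\<theta> * f (x i))\<close>.\<close>
  define Z where "Z = (\<lambda>(x, y). exp (\<alpha> * \<theta> * (\<Sum>i<n. f (x i))) * (\<Sum>i<n. exp (\<theta> * f (x i)) * y i) powr (- (real n * \<alpha>)))"
  have [measurable]: "Z \<in> borel_measurable (L \<Otimes>\<^sub>M L)"
    unfolding Z_def by measurable
  have Z1: "(\<integral>\<^sup>+\<omega>. ennreal (Z (rlam \<omega>, rw \<omega>)) \<partial>M) = 1"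
  proof -
    have "(\<integral>\<^sup>+\<omega>. ennreal (Z (rlam \<omega>, rw \<omega>)) \<partial>M) = (\<integral>\<^sup>+x. \<integral>\<^sup>+y. ennreal (Z (x, y)) \<partial>D \<partial>E)"
      by (rule nn_integral_sample) measurable
    also have "\<dots> = (\<integral>\<^sup>+x. 1 \<partial>E)"
    proof (rule nn_integral_cong)
      fix x
      have "(\<integral>\<^sup>+y. ennreal (Z (x, y)) \<partial>D) = (\<integral>\<^sup>+y. ennreal (exp (\<alpha> * \<theta> * (\<Sum>i<n. f (x i)))) *
          ennreal ((\<Sum>i<n. exp (\<theta> * f (x i)) * y i) powr (- (real n * \<alpha>))) \<partial>D)"
        by (simp add: Z_def ennreal_mult)
      also have "\<dots> = ennreal (exp (\<alpha> * \<theta> * (\<Sum>i<n. f (x i)))) * (\<integral>\<^sup>+y. ennreal ((\<Sum>i<n. exp (\<theta> * f (x i)) * y i) powr (- (real n * \<alpha>))) \<partial>D)"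
        by (rule nn_integral_cmult) measurable
      also have "\<dots> = ennreal (exp (\<alpha> * \<theta> * (\<Sum>i<n. f (x i)))) * ennreal (\<Prod>i<n. exp (\<theta> * f (x i)) powr (- \<alpha>))"
        unfolding \<alpha>_def using n \<alpha> by (subst nn_integral_dirichlet_powr) (auto simp: \<alpha>_def)
      also have "(\<Prod>i<n. exp (\<theta> * f (x i)) powr (- \<alpha>)) = exp (- (\<alpha> * \<theta> * (\<Sum>i<n. f (x i))))"
        by (simp add: exp_powr_real exp_sum[symmetric] sum_distrib_left sum_negf[symmetric] mult_ac)
      finally show "(\<integral>\<^sup>+y. ennreal (Z (x, y)) \<partial>D) = 1"
        by (simp add: ennreal_mult[symmetric] exp_add[symmetric])
    qed
    finally show ?thesis by (simp add: E.emeasure_space_1)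
  qed
  have imp: "exp u \<le> Z (rlam \<omega>, rw \<omega>)"
    if S: "\<omega> \<in> S" and w: "(\<forall>i<n. w \<omega> i > 0) \<and> (\<Sum>i<n. w \<omega> i) = 1" for \<omega>
  proof -
    define p where "p = (\<Sum>i<n. w \<omega> i * f (lam \<omega> i))"
    define F where "F = (\<Sum>i<n. f (lam \<omega> i))"
    define T where "T = (\<Sum>i<n. exp (\<theta> * f (lam \<omega> i)) * w \<omega> i)"
    have ZT: "Z (rlam \<omega>, rw \<omega>) = exp (\<alpha> * \<theta> * F) * T powr (- (real n * \<alpha>))"
      by (simp add: Z_def F_def T_def)
    have "T \<le> (\<Sum>i<n. (1 + \<theta> * f (lam \<omega> i) + \<theta>\<^sup>2) * w \<omega> i)"
      unfolding T_def
    proof (intro sum_mono mult_right_mono)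
      fix i assume i: "i \<in> {..<n}"
      have fi: "0 \<le> f (lam \<omega> i)" "f (lam \<omega> i) \<le> 1" using f01 by auto
      have "exp (\<theta> * f (lam \<omega> i)) \<le> 1 + \<theta> * f (lam \<omega> i) + (\<theta> * f (lam \<omega> i))\<^sup>2"
        using fi \<theta> by (intro exp_bound) (auto intro: mult_le_one)
      moreover have "(\<theta> * f (lam \<omega> i))\<^sup>2 \<le> \<theta>\<^sup>2"
        using fi \<theta> by (intro power_mono) (auto intro: mult_left_le)
      ultimately show "exp (\<theta> * f (lam \<omega> i)) \<le> 1 + \<theta> * f (lam \<omega> i) + \<theta>\<^sup>2" by linarith
      show "0 \<le> w \<omega> i" using w i by (auto intro: less_imp_le)
    qed
    also have "\<dots> = (1 + \<theta>\<^sup>2) * (\<Sum>i<n. w \<omega> i) + \<theta> * p"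
      by (simp add: p_def sum_distrib_left sum_distrib_right sum.distrib algebra_simps)
    also have "\<dots> \<le> exp (\<theta> * p + \<theta>\<^sup>2)" unfolding w[THEN conjunct2] using exp_ge_add_one_self[of "\<theta> * p + \<theta>\<^sup>2"]
      by (simp only: mult_1_right mult_1_left ac_simps)
    finally have Tle: "T \<le> exp (\<theta> * p + \<theta>\<^sup>2)" .
    have "T > 0" unfolding T_def using w n by (intro sum_pos) (auto simp: lessThan_empty_iff)
    \<comment> \<open>The exponent is negative, so the upper bound on \<open>T\<close> becomes a
      lower bound on \<open>Z\<close>.\<close>
    have "exp (- (real n * \<alpha>) * (\<theta> * p + \<theta>\<^sup>2)) = exp (\<theta> * p + \<theta>\<^sup>2) powr (- (real n * \<alpha>))"
      by (simp add: exp_powr_real mult.commute)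
    also have "\<dots> \<le> T powr (- (real n * \<alpha>))"
      using Tle \<open>T > 0\<close> \<alpha> by (intro powr_mono2') auto
    finally have "exp (\<alpha> * \<theta> * F) * exp (- (real n * \<alpha>) * (\<theta> * p + \<theta>\<^sup>2)) \<le> exp (\<alpha> * \<theta> * F) * T powr (- (real n * \<alpha>))"
      by (intro mult_left_mono) auto
    moreover have "u \<le> \<alpha> * \<theta> * F - real n * \<alpha> * (\<theta> * p + \<theta>\<^sup>2)"
    proof -
      have "\<theta> + u / (real n * \<alpha> * \<theta>) \<le> F / real n - p"
        using S by (simp add: S_def F_def p_def \<alpha>_def)
      then have "real n * \<alpha> * \<theta> * (\<theta> + u / (real n * \<alpha> * \<theta>)) \<le> real n * \<alpha> * \<theta> * (F / real n - p)"
        using \<alpha> \<theta> by (intro mult_left_mono) auto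
      moreover have "real n * \<alpha> * \<theta> * (\<theta> + u / (real n * \<alpha> * \<theta>)) = real n * \<alpha> * \<theta>\<^sup>2 + u"
        using n \<alpha> \<theta> by (simp add: field_simps power2_eq_square)
      moreover have "real n * \<alpha> * \<theta> * (F / real n - p) = \<alpha> * \<theta> * F - real n * \<alpha> * \<theta> * p"
        using n by (simp add: field_simps)
      moreover have "real n * \<alpha> * (\<theta> * p + \<theta>\<^sup>2) = real n * \<alpha> * \<theta> * p + real n * \<alpha> * \<theta>\<^sup>2"
        by (simp add: algebra_simps)
      ultimately show ?thesis by linarith
    qed
    then have "exp u \<le> exp (\<alpha> * \<theta> * F) * exp (- (real n * \<alpha>) * (\<theta> * p + \<theta>\<^sup>2))"
      by (simp add: exp_add[symmetric])
    ultimately show ?thesis unfolding ZT by linarith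
  qed
  have "ennreal (prob S) = (\<integral>\<^sup>+\<omega>. indicator S \<omega> \<partial>M)"
    using ev by (simp add: emeasure_eq_measure)
  also have "\<dots> \<le> (\<integral>\<^sup>+\<omega>. ennreal (exp (- u)) * ennreal (Z (rlam \<omega>, rw \<omega>)) \<partial>M)"
  proof (rule nn_integral_mono_AE, use AE_w_simplex in eventually_elim)
    fix \<omega> assume w: "(\<forall>i<n. w \<omega> i > 0) \<and> (\<Sum>i<n. w \<omega> i) = 1"
    show "indicator S \<omega> \<le> ennreal (exp (- u)) * ennreal (Z (rlam \<omega>, rw \<omega>))"
    proof (cases "\<omega> \<in> S")
      case True
      have "1 \<le> exp (- u) * Z (rlam \<omega>, rw \<omega>)"
        using mult_left_mono[OF imp[OF True w], of "exp (- u)"] by (simp add: exp_add[symmetric])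
      then show ?thesis using True
        by (simp add: ennreal_mult'[symmetric] ennreal_leI flip: ennreal_1)
    qed simp
  qed
  also have "\<dots> = ennreal (exp (- u)) * (\<integral>\<^sup>+\<omega>. ennreal (Z (rlam \<omega>, rw \<omega>)) \<partial>M)"
    by (rule nn_integral_cmult) measurable
  finally show "prob S \<le> exp (- u)" unfolding Z1 by simp
qed

end

section \<open>The rescaled loop equation\<close>

text \<open>Linear growth of \<open>g\<close> admits the identity, which controls the second moment,
  next to the bounded cosine and sine.\<close>

definition loop_test :: "real \<Rightarrow> (real \<Rightarrow> real) \<Rightarrow> (real \<Rightarrow> real) \<Rightarrow> bool" where
  "loop_test L g g' \<longleftrightarrow> 0 \<le> L \<and> (\<forall>x. (g has_real_derivative g' x) (at x)) \<and> continuous_on UNIV g'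
     \<and> (\<forall>x. \<bar>g' x\<bar> \<le> L) \<and> (\<forall>x. \<bar>g x\<bar> \<le> 1 + \<bar>x\<bar>)"

text \<open>Division by \<open>s\<close> compensates the factor \<open>s\<close> of the chain rule,
  so that the vector field has a derivative of order 1. On the unit interval the argument of
  \<open>g\<close> is at most \<open>s\<close> in modulus, so linear growth of \<open>g\<close>
  still gives a bounded function.\<close>

definition scaled_test :: "real \<Rightarrow> real \<Rightarrow> (real \<Rightarrow> real) \<Rightarrow> real \<Rightarrow> real" where
  "scaled_test s c g l = g (s * (l - c)) / s"

text \<open>The derivative of the whole field \<open>l * (1 - l) * scaled_test s c g l\<close>, not
  of \<open>scaled_test\<close> alone.\<close>

definition scaled_deriv :: "real \<Rightarrow> real \<Rightarrow> (real \<Rightarrow> real) \<Rightarrow> (real \<Rightarrow> real) \<Rightarrow> real \<Rightarrow> real" where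
  "scaled_deriv s c g g' l = (1 - 2 * l) * (g (s * (l - c)) / s) + l * (1 - l) * g' (s * (l - c))"

text \<open>It measures the failure of the loop equation of the standard semicircle law: for two
  independent points the mean of \<open>(g x - g y) / (x - y)\<close> equals the mean of
  \<open>x * g x\<close>. Including the diagonal costs an error of order
  \<open>1 / n\<close>.\<close>

definition loop_defect :: "nat \<Rightarrow> (real \<Rightarrow> real) \<Rightarrow> (real \<Rightarrow> real) \<Rightarrow> (nat \<Rightarrow> real) \<Rightarrow> real" where
  "loop_defect n g g' x = (\<Sum>i<n. \<Sum>j<n. divided_difference g g' (x i) (x j)) / (real n)\<^sup>2
     - (\<Sum>i<n. x i * g (x i)) / real n"

definition mean_square :: "nat \<Rightarrow> (nat \<Rightarrow> real) \<Rightarrow> real" where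
  "mean_square n x = (\<Sum>i<n. (x i)\<^sup>2) / real n"

lemma scaled_deriv_bounds:
  assumes t: "loop_test L g g'" and s: "s \<ge> 1" and c: "0 < c" "c < 1" and l: "0 \<le> l" "l \<le> 1"
  shows "\<bar>scaled_test s c g l\<bar> \<le> 2" "\<bar>scaled_deriv s c g g' l\<bar> \<le> L + 2"
proof -
  let ?x = "s * (l - c)"
  have "\<bar>?x\<bar> \<le> s * 1" unfolding abs_mult using s c l by (intro mult_mono) auto
  then have "\<bar>g ?x\<bar> \<le> 1 + s" using t unfolding loop_test_def by (smt (verit))
  then have "\<bar>g ?x / s\<bar> \<le> (1 + s) / s" using s by (simp add: divide_right_mono)
  also have "\<dots> \<le> 2" using s by (simp add: field_simps)
  finally show 1: "\<bar>scaled_test s c g l\<bar> \<le> 2" by (simp add: scaled_test_def)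
  have "\<bar>(1 - 2 * l) * (g ?x / s)\<bar> \<le> 1 * 2"
    unfolding abs_mult[of "1 - 2 * l"] using 1 l by (intro mult_mono) (auto simp: scaled_test_def)
  moreover have "\<bar>l * (1 - l) * g' ?x\<bar> \<le> 1 * L"
    unfolding abs_mult[of "l * (1 - l)"] using t l
    by (intro mult_mono) (auto simp: loop_test_def abs_mult intro: mult_le_one)
  ultimately show "\<bar>scaled_deriv s c g g' l\<bar> \<le> L + 2" unfolding scaled_deriv_def by linarith
qed

lemma loop_perturbation_scaled:
  assumes t: "loop_test L g g'" and s: "s \<ge> 1" and c: "0 < c" "c < 1"
    and "\<beta> > 0" "A \<ge> 0" "B \<ge> 0" and e: "\<bar>\<epsilon>\<bar> * (L + 2) \<le> 1/2"
  shows "loop_perturbation \<beta> A B (L + 2) \<epsilon> (scaled_test s c g) (scaled_deriv s c g g')"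
proof
  have d: "\<And>x. (g has_real_derivative g' x) (at x)" and c': "continuous_on UNIV g'" and L: "L \<ge> 0"
    using t by (auto simp: loop_test_def)
  have cg: "continuous_on UNIV g"
    using d by (auto intro!: continuous_at_imp_continuous_on DERIV_isCont)
  show "continuous_on UNIV (scaled_test s c g)"
    unfolding scaled_test_def[abs_def] using s
    by (intro continuous_intros continuous_on_compose2[OF cg]) auto
  show "continuous_on UNIV (scaled_deriv s c g g')"
    unfolding scaled_deriv_def[abs_def] using s
    by (intro continuous_intros continuous_on_compose2[OF cg] continuous_on_compose2[OF c']) auto
  show "((\<lambda>l. l * (1 - l) * scaled_test s c g l) has_real_derivative scaled_deriv s c g g' l) (at l)" for l
  proof -
    have "((\<lambda>l. s * (l - c)) has_real_derivative s) (at l)" by (auto intro!: derivative_eq_intros)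
    from DERIV_chain2[OF d this] have [derivative_intros]:
      "((\<lambda>l. g (s * (l - c))) has_real_derivative g' (s * (l - c)) * s) (at l)" by simp
    have "((\<lambda>l. l * (1 - l) * (g (s * (l - c)) / s)) has_real_derivative
       (1 * (1 - l) + (0 - 1) * l) * (g (s * (l - c)) / s) + (g' (s * (l - c)) * s) / s * (l * (1 - l))) (at l)"
      by (intro DERIV_mult DERIV_cdivide DERIV_diff DERIV_const DERIV_ident derivative_intros)
    then show ?thesis unfolding scaled_test_def scaled_deriv_def using s by (simp add: algebra_simps)
  qed
  show "\<bar>scaled_deriv s c g g' l\<bar> \<le> L + 2" if "0 \<le> l" "l \<le> 1" for l
    using scaled_deriv_bounds(2)[OF t s c that] .
  show "\<bar>\<epsilon> * scaled_test s c g l\<bar> \<le> 1/2" if l: "0 \<le> l" "l \<le> 1" for l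
  proof -
    have "\<bar>\<epsilon> * scaled_test s c g l\<bar> \<le> \<bar>\<epsilon>\<bar> * (L + 2)"
      unfolding abs_mult using scaled_deriv_bounds(1)[OF t s c l] L by (intro mult_left_mono) auto
    then show ?thesis using e by simp
  qed
qed (use assms in auto)

text \<open>A product rule for divided differences. Writing
  \<open>l * (1 - l) = c * (1 - c) + r l\<close> isolates the value at the centre;
  \<open>r l\<close> is at most \<open>|x| / s\<close> in modulus, and
  \<open>(r l - r m) / (l - m) = 1 - l - m\<close> is bounded by 1.\<close>

lemma divided_difference_scaled:
  assumes t: "loop_test L g g'" and s: "s \<ge> 1"
    and l: "0 < l" "l < 1" and m: "0 < m" "m < 1" and c: "0 < c" "c < 1"
  defines "x \<equiv> s * (l - c)" and "y \<equiv> s * (m - c)"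
  shows "\<bar>divided_difference (\<lambda>l. l * (1 - l) * scaled_test s c g l) (scaled_deriv s c g g') l m
      - c * (1 - c) * divided_difference g g' x y\<bar> \<le> (L * \<bar>x\<bar> + (1 + \<bar>y\<bar>)) / s"
proof -
  let ?d = "divided_difference (\<lambda>l. l * (1 - l) * scaled_test s c g l) (scaled_deriv s c g g') l m"
  define r where "r l = (l - c) * (1 - l - c)" for l
  have r: "l * (1 - l) = c * (1 - c) + r l" for l by (simp add: r_def algebra_simps)
  have d: "\<And>x. (g has_real_derivative g' x) (at x)" and L: "L \<ge> 0" "\<And>x. \<bar>g' x\<bar> \<le> L"
    and g: "\<And>x. \<bar>g x\<bar> \<le> 1 + \<bar>x\<bar>"
    using t by (auto simp: loop_test_def)
  have dd: "\<bar>divided_difference g g' x y\<bar> \<le> L"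
    by (rule abs_divided_difference_le[where l="min x y" and u="max x y"]) (use d L in auto)
  have rl: "\<bar>r l\<bar> \<le> \<bar>x\<bar> / s"
  proof -
    have "\<bar>r l\<bar> \<le> \<bar>l - c\<bar> * 1" unfolding r_def abs_mult using l c by (intro mult_left_mono) auto
    then show ?thesis using s by (simp add: x_def abs_mult)
  qed
  have b1: "\<bar>r l * divided_difference g g' x y\<bar> \<le> L * \<bar>x\<bar> / s"
    using mult_mono[OF rl dd] L s by (simp add: abs_mult mult.commute)
  have b2: "\<bar>(1 - l - m) * (g y / s)\<bar> \<le> (1 + \<bar>y\<bar>) / s"
  proof -
    have "\<bar>(1 - l - m) * (g y / s)\<bar> \<le> 1 * ((1 + \<bar>y\<bar>) / s)"
      unfolding abs_mult[of "1 - l - m"] using l m s g[of y]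
      by (intro mult_mono) (auto intro!: divide_right_mono)
    then show ?thesis by simp
  qed
  have "?d
      - c * (1 - c) * divided_difference g g' x y = r l * divided_difference g g' x y + (1 - l - m) * (g y / s)"
  proof (cases "l = m")
    case True
    then have xy: "y = x" by (simp add: x_def y_def)
    have "scaled_deriv s c g g' l = (1 - 2 * l) * (g x / s) + (c * (1 - c) + r l) * g' x"
      unfolding scaled_deriv_def x_def r[of l] ..
    then show ?thesis using True unfolding xy
      by (simp add: divided_difference_def distrib_right left_diff_distrib)
  next
    case False
    then have xy: "x \<noteq> y" using s by (simp add: x_def y_def)
    have lm: "l - m = (x - y) / s" using s by (simp add: x_def y_def field_simps)
    have num: "(V + R) * X - (V + R') * Z = (V + R) * (X - Z) + (R - R') * Z" for V R R' X Z :: real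
      by (simp add: algebra_simps)
    have rr: "r l - r m = (l - m) * (1 - l - m)" by (simp add: r_def algebra_simps)
    have "?d
       = ((c * (1 - c) + r l) * (g x / s) - (c * (1 - c) + r m) * (g y / s)) / (l - m)"
      using False unfolding divided_difference_def scaled_test_def r[of l] r[of m] x_def y_def by simp
    also have "\<dots> = ((c * (1 - c) + r l) * ((g x - g y) / s) + (r l - r m) * (g y / s)) / (l - m)"
      unfolding diff_divide_distrib[of "g x" "g y" s]
      by (simp only: num)
    also have "\<dots> = (c * (1 - c) + r l) * (((g x - g y) / s) / (l - m)) + (1 - l - m) * (g y / s)"
      unfolding rr using False by (simp add: add_divide_distrib)
    also have "((g x - g y) / s) / (l - m) = divided_difference g g' x y"
      using xy s unfolding lm divided_difference_def by simp
    finally show ?thesis by (simp add: distrib_right)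
  qed
  also have "\<bar>\<dots>\<bar> \<le> L * \<bar>x\<bar> / s + (1 + \<bar>y\<bar>) / s" using b1 b2 by linarith
  finally show ?thesis by (simp add: add_divide_distrib)
qed

lemma sum_pairs_symmetric:
  fixes d :: "nat \<Rightarrow> nat \<Rightarrow> real"
  assumes "\<And>i j. d i j = d j i"
  shows "2 * (\<Sum>i<n. \<Sum>j\<in>{i<..<n}. d i j) = (\<Sum>i<n. \<Sum>j<n. d i j) - (\<Sum>i<n. d i i)"
proof (induction n)
  case (Suc n)
  have "(\<Sum>i<Suc n. \<Sum>j\<in>{i<..<Suc n}. d i j) = (\<Sum>i<n. \<Sum>j\<in>{i<..<Suc n}. d i j) + (\<Sum>j\<in>{n<..<Suc n}. d n j)"
    by simp
  also have "{n<..<Suc n} = {}" by auto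
  also have "(\<Sum>i<n. \<Sum>j\<in>{i<..<Suc n}. d i j) + sum (d n) {} = (\<Sum>i<n. \<Sum>j\<in>{i<..<Suc n}. d i j)"
    by simp
  also have "\<dots> = (\<Sum>i<n. (\<Sum>j\<in>{i<..<n}. d i j) + d i n)"
  proof (rule sum.cong)
    fix i assume "i \<in> {..<n}"
    then have "{i<..<Suc n} = insert n {i<..<n}" by auto
    then show "(\<Sum>j\<in>{i<..<Suc n}. d i j) = (\<Sum>j\<in>{i<..<n}. d i j) + d i n" by simp
  qed simp
  finally have "(\<Sum>i<Suc n. \<Sum>j\<in>{i<..<Suc n}. d i j) = (\<Sum>i<n. \<Sum>j\<in>{i<..<n}. d i j) + (\<Sum>i<n. d i n)"
    by (simp add: sum.distrib)
  moreover have "(\<Sum>i<Suc n. \<Sum>j<Suc n. d i j) = (\<Sum>i<n. \<Sum>j<n. d i j) + (\<Sum>i<n. d i n) + (\<Sum>j<n. d n j) + d n n"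
    by (simp add: sum.distrib)
  moreover have "(\<Sum>j<n. d n j) = (\<Sum>i<n. d i n)" using assms by (intro sum.cong) auto
  ultimately show ?case using Suc.IH by simp
qed simp

text \<open>The deterministic half of the argument. The error terms are, in order: quadratic
  remainder and Markov threshold, Jacobian and diagonal terms, variation of
  \<open>l * (1 - l)\<close> away from \<open>c\<close>, residual drift, and mismatch of the
  quadratic confinement. All share the factor \<open>1 + mean_square n x\<close> because
  \<open>g\<close> may grow linearly and \<open>x * g x\<close> quadratically.\<close>

lemma loop_defect_le:
  fixes lam x :: "nat \<Rightarrow> real" and n :: nat
  assumes t: "loop_test L g g'" and n: "n \<ge> 1" and s: "s \<ge> 1" and c: "0 < c" "c < 1"
    and pos: "\<beta> > 0" "A \<ge> 0" "B \<ge> 0" "\<epsilon> > 0" "u \<ge> 0"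
    and lam: "\<And>i. i < n \<Longrightarrow> 0 < lam i \<and> lam i < 1" and x: "\<And>i. i < n \<Longrightarrow> x i = s * (lam i - c)"
    and \<kappa>: "\<kappa> = (A + B) / (s\<^sup>2 * real n)" and \<delta>: "\<delta> = (A * (1 - c) - B * c) / (s * real n)"
    and T: "\<bar>loop_lin n \<beta> A B (scaled_test s c g) (scaled_deriv s c g g') lam\<bar>
       \<le> 2 * \<epsilon> * loop_quad n \<beta> A B (L + 2) (scaled_test s c g) lam + u / \<epsilon>"
  shows "\<beta> / 2 * (c * (1 - c)) * \<bar>loop_defect n g g' x\<bar> \<le>
     (2 * \<epsilon> * ((1 + \<beta>) * (L + 2)\<^sup>2 + 2 * \<kappa>) + u / (\<epsilon> * (real n)\<^sup>2) + (1 + \<beta>) * (L + 2) / real n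
       + \<beta> * (L + 2) / s + 2 * \<bar>\<delta>\<bar> + 2 * \<bar>\<kappa> - \<beta> / 2 * (c * (1 - c))\<bar>) * (1 + mean_square n x)"
proof -
  define N where "N = real n"
  define v where "v = c * (1 - c)"
  define Y where "Y = 1 + mean_square n x"
  have N: "N \<ge> 1" using n by (simp add: N_def)
  have L: "L \<ge> 0" and g: "\<And>x. \<bar>g x\<bar> \<le> 1 + \<bar>x\<bar>" using t by (auto simp: loop_test_def)
  have Y1: "Y \<ge> 1" by (simp add: Y_def mean_square_def sum_nonneg)
  have SY: "(\<Sum>i<n. 1 + (x i)\<^sup>2) = N * Y"
    using n by (simp add: Y_def mean_square_def N_def sum.distrib field_simps)
  have \<kappa>0: "\<kappa> \<ge> 0" using pos by (simp add: \<kappa>)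
  let ?G = "scaled_test s c g" and ?k' = "scaled_deriv s c g g'"
  let ?dk = "\<lambda>i j. divided_difference (\<lambda>l. l * (1 - l) * ?G l) ?k' (lam i) (lam j)"
  let ?dg = "\<lambda>i j. divided_difference g g' (x i) (x j)"
  define DK where "DK = (\<Sum>i<n. \<Sum>j<n. ?dk i j)"
  define DG where "DG = (\<Sum>i<n. \<Sum>j<n. ?dg i j)"
  define k1 where "k1 = (\<Sum>i<n. ?k' (lam i))"
  define Sg where "Sg = (\<Sum>i<n. g (x i))"
  define Sxg where "Sxg = (\<Sum>i<n. x i * g (x i))"
  define T0 where "T0 = loop_lin n \<beta> A B ?G ?k' lam"
  have ab: "\<bar>z\<bar> \<le> (1 + z\<^sup>2) / 2" for z :: real
    using zero_le_power2[of "\<bar>z\<bar> - 1"] by (simp add: power2_eq_square algebra_simps)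
  have X1: "(\<Sum>i<n. \<bar>x i\<bar>) \<le> N * Y / 2"
    unfolding SY[symmetric] sum_divide_distrib by (intro sum_mono ab)
  have k1: "\<bar>k1\<bar> \<le> N * (L + 2)"
  proof -
    have "\<bar>k1\<bar> \<le> (\<Sum>i<n. \<bar>?k' (lam i)\<bar>)" unfolding k1_def by (rule sum_abs)
    also have "\<dots> \<le> (\<Sum>i<n. L + 2)"
      using lam by (intro sum_mono scaled_deriv_bounds(2)[OF t s c]) (auto simp: less_imp_le)
    finally show ?thesis by (simp add: N_def)
  qed
  have Sg: "\<bar>Sg\<bar> \<le> 2 * N * Y"
  proof -
    have "\<bar>Sg\<bar> \<le> (\<Sum>i<n. 1 + \<bar>x i\<bar>)" unfolding Sg_def by (rule order.trans[OF sum_abs sum_mono[OF g]])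
    also have "\<dots> \<le> N + N * Y / 2" using X1 by (simp add: sum.distrib N_def)
    also have "\<dots> \<le> N * Y + N * Y" using N Y1 by (intro add_mono) (simp_all add: field_simps)
    finally show ?thesis by simp
  qed
  have Sxg: "\<bar>Sxg\<bar> \<le> 2 * N * Y"
  proof -
    have "\<bar>Sxg\<bar> \<le> (\<Sum>i<n. \<bar>x i * g (x i)\<bar>)" unfolding Sxg_def by (rule sum_abs)
    also have "\<dots> \<le> (\<Sum>i<n. 2 * (1 + (x i)\<^sup>2))"
    proof (rule sum_mono)
      fix i
      have "\<bar>x i * g (x i)\<bar> \<le> \<bar>x i\<bar> * (1 + \<bar>x i\<bar>)" unfolding abs_mult by (intro mult_left_mono g) auto
      also have "\<dots> = \<bar>x i\<bar> + (x i)\<^sup>2" by (simp add: algebra_simps power2_eq_square)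
      also have "\<dots> \<le> (1 + (x i)\<^sup>2) / 2 + (x i)\<^sup>2" using ab[of "x i"] by simp
      also have "\<dots> \<le> 2 * (1 + (x i)\<^sup>2)" by simp
      finally show "\<bar>x i * g (x i)\<bar> \<le> 2 * (1 + (x i)\<^sup>2)" .
    qed
    also have "\<dots> = 2 * N * Y" unfolding sum_distrib_left[symmetric] SY by simp
    finally show ?thesis .
  qed
  have DD: "\<bar>DK - v * DG\<bar> \<le> N\<^sup>2 * (2 * (L + 2) * Y / s)"
  proof -
    have e: "DK - v * DG = (\<Sum>i<n. \<Sum>j<n. ?dk i j - v * ?dg i j)"
      by (simp add: DK_def DG_def sum_distrib_left sum_subtractf)
    have "\<bar>DK - v * DG\<bar> \<le> (\<Sum>i<n. \<Sum>j<n. (L * \<bar>x i\<bar> + (1 + \<bar>x j\<bar>)) / s)"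
      unfolding e
    proof (intro order.trans[OF sum_abs] sum_mono)
      fix i j assume ij: "i \<in> {..<n}" "j \<in> {..<n}"
      show "\<bar>?dk i j - v * ?dg i j\<bar> \<le> (L * \<bar>x i\<bar> + (1 + \<bar>x j\<bar>)) / s"
        using divided_difference_scaled[OF t s _ _ _ _ c, of "lam i" "lam j"] lam ij
        by (simp add: x v_def)
    qed
    also have "\<dots> = (L * N * (\<Sum>i<n. \<bar>x i\<bar>) + N * (N + (\<Sum>i<n. \<bar>x i\<bar>))) / s"
    proof -
      have cst: "(\<Sum>j<n. z) = N * z" for z :: real by (simp add: N_def)
      have "(\<Sum>i<n. \<Sum>j<n. (L * \<bar>x i\<bar> + (1 + \<bar>x j\<bar>)) / s)
          = (\<Sum>i<n. \<Sum>j<n. L * \<bar>x i\<bar> + (1 + \<bar>x j\<bar>)) / s"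
        by (simp only: sum_divide_distrib)
      also have "(\<Sum>i<n. \<Sum>j<n. L * \<bar>x i\<bar> + (1 + \<bar>x j\<bar>)) = (\<Sum>i<n. N * (L * \<bar>x i\<bar>) + (N * 1 + (\<Sum>j<n. \<bar>x j\<bar>)))"
        by (simp only: sum.distrib cst)
      also have "\<dots> = (\<Sum>i<n. N * L * \<bar>x i\<bar>) + N * (N * 1 + (\<Sum>j<n. \<bar>x j\<bar>))"
        by (simp only: sum.distrib cst mult.assoc distrib_left)
      also have "(\<Sum>i<n. N * L * \<bar>x i\<bar>) = N * L * (\<Sum>i<n. \<bar>x i\<bar>)"
        by (rule sum_distrib_left[symmetric])
      finally show ?thesis by (simp only: mult.commute[of N L] mult_1_right)
    qed
    also have "\<dots> \<le> (L * N * (N * Y) + N * (N * Y + N * Y)) / s"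
    proof -
      have "0 \<le> N * Y" using N Y1 by simp
      then have "(\<Sum>i<n. \<bar>x i\<bar>) \<le> N * Y" using X1 by linarith
      moreover have "N \<le> N * Y" using N Y1 by simp
      ultimately show ?thesis using L N s by (intro divide_right_mono add_mono mult_left_mono) auto
    qed
    also have "\<dots> = N\<^sup>2 * ((L + 2) * Y / s)" by (simp add: power2_eq_square algebra_simps)
    also have "\<dots> \<le> N\<^sup>2 * (2 * (L + 2) * Y / s)" using L Y1 s by (intro mult_left_mono divide_right_mono) auto
    finally show ?thesis .
  qed
  \<comment> \<open>The pair sum is half of the full double sum minus its diagonal
    \<open>k1\<close>. The potential term is affine: at \<open>l = c + x / s\<close> it equals
    \<open>s * n * (\<delta> - \<kappa> * x)\<close>, and this \<open>s\<close> cancels the one in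
    \<open>scaled_test\<close>.\<close>
  have Tdec: "T0 = k1 + \<beta> / 2 * (DK - k1) + N * (\<delta> * Sg - \<kappa> * Sxg)"
  proof -
    have p: "2 * (\<Sum>i<n. \<Sum>j\<in>{i<..<n}. ?dk i j) = DK - k1"
      unfolding DK_def k1_def
      by (subst sum_pairs_symmetric) (auto simp: divided_difference_commute divided_difference_def)
    have "(\<Sum>i<n. (A * (1 - lam i) - B * lam i) * ?G (lam i)) = (\<Sum>i<n. N * (\<delta> * g (x i) - \<kappa> * (x i * g (x i))))"
    proof (rule sum.cong)
      fix i assume i: "i \<in> {..<n}"
      then have xi: "s * (lam i - c) = x i" using x by simp
      have li: "lam i = c + x i / s" using xi s by (simp add: field_simps)
      have "A * (1 - lam i) - B * lam i = (A * (1 - c) - B * c) - (A + B) * (x i / s)"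
        unfolding li by (simp add: algebra_simps add_divide_distrib)
      also have "A * (1 - c) - B * c = \<delta> * s * N" using s n by (simp add: \<delta> N_def)
      also have "A + B = \<kappa> * s\<^sup>2 * N" using s n by (simp add: \<kappa> N_def)
      finally have e: "A * (1 - lam i) - B * lam i = s * (N * (\<delta> - \<kappa> * x i))"
        using s by (simp add: power2_eq_square algebra_simps)
      show "(A * (1 - lam i) - B * lam i) * ?G (lam i) = N * (\<delta> * g (x i) - \<kappa> * (x i * g (x i)))"
        unfolding e scaled_test_def xi using s by (simp add: algebra_simps)
    qed simp
    also have "\<dots> = N * (\<delta> * Sg - \<kappa> * Sxg)"
      by (simp add: Sg_def Sxg_def sum_distrib_left[symmetric] sum_subtractf)
    finally show ?thesis using p unfolding T0_def loop_lin_def k1_def[symmetric] by simp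
  qed
  have Q: "loop_quad n \<beta> A B (L + 2) ?G lam \<le> N\<^sup>2 * (((1 + \<beta>) * (L + 2)\<^sup>2 + 2 * \<kappa>) * Y)"
  proof -
    have "(\<Sum>i<n. (?G (lam i))\<^sup>2) \<le> (\<Sum>i<n. 2 * (1 + (x i)\<^sup>2) / s\<^sup>2)"
    proof (rule sum_mono)
      fix i assume "i \<in> {..<n}"
      then have xi: "s * (lam i - c) = x i" using x by simp
      have "(g (x i))\<^sup>2 \<le> (1 + \<bar>x i\<bar>)\<^sup>2" using g[of "x i"] by (metis abs_ge_zero power2_abs power_mono)
      also have "\<dots> \<le> 2 * (1 + (x i)\<^sup>2)" using ab[of "x i"] by (simp add: power2_eq_square algebra_simps)
      finally show "(?G (lam i))\<^sup>2 \<le> 2 * (1 + (x i)\<^sup>2) / s\<^sup>2"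
        unfolding scaled_test_def xi power_divide by (intro divide_right_mono) auto
    qed
    also have "\<dots> = 2 * (N * Y) / s\<^sup>2"
      unfolding sum_divide_distrib[symmetric] sum_distrib_left[symmetric] SY ..
    finally have "(A + B) * (\<Sum>i<n. (?G (lam i))\<^sup>2) \<le> (A + B) * (2 * (N * Y) / s\<^sup>2)"
      using pos by (intro mult_left_mono) auto
    also have "(A + B) * (2 * (N * Y) / s\<^sup>2) = N\<^sup>2 * (2 * \<kappa> * Y)"
    proof -
      have "A + B = \<kappa> * s\<^sup>2 * N" using s n by (simp add: \<kappa> N_def)
      then show ?thesis using s by (simp add: power2_eq_square)
    qed
    finally have 1: "(A + B) * (\<Sum>i<n. (?G (lam i))\<^sup>2) \<le> N\<^sup>2 * (2 * \<kappa> * Y)" .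
    have "N * (L + 2)\<^sup>2 + \<beta> * N\<^sup>2 * (L + 2)\<^sup>2 \<le> N\<^sup>2 * (L + 2)\<^sup>2 + \<beta> * N\<^sup>2 * (L + 2)\<^sup>2"
      using N by (intro add_right_mono mult_right_mono) (auto simp: power2_eq_square)
    also have "\<dots> = N\<^sup>2 * ((1 + \<beta>) * (L + 2)\<^sup>2 * 1)" by (simp add: algebra_simps)
    also have "\<dots> \<le> N\<^sup>2 * ((1 + \<beta>) * (L + 2)\<^sup>2 * Y)" using Y1 pos by (intro mult_left_mono) auto
    finally show ?thesis using 1 unfolding loop_quad_def N_def[symmetric] by (simp add: algebra_simps)
  qed
  have T0: "\<bar>T0\<bar> \<le> N\<^sup>2 * ((2 * \<epsilon> * ((1 + \<beta>) * (L + 2)\<^sup>2 + 2 * \<kappa>) + u / (\<epsilon> * N\<^sup>2)) * Y)"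
  proof -
    have "\<bar>T0\<bar> \<le> 2 * \<epsilon> * (N\<^sup>2 * (((1 + \<beta>) * (L + 2)\<^sup>2 + 2 * \<kappa>) * Y)) + u / \<epsilon> * 1"
      using T Q pos mult_left_mono[OF Q, of "2 * \<epsilon>"] unfolding T0_def by linarith
    also have "\<dots> \<le> 2 * \<epsilon> * (N\<^sup>2 * (((1 + \<beta>) * (L + 2)\<^sup>2 + 2 * \<kappa>) * Y)) + u / \<epsilon> * Y"
      using Y1 pos by (intro add_left_mono mult_left_mono) auto
    also have "u / \<epsilon> * Y = N\<^sup>2 * (u / (\<epsilon> * N\<^sup>2) * Y)" using N pos by (simp add: field_simps)
    finally show ?thesis by (simp add: algebra_simps)
  qed
  let ?R = "2 * \<epsilon> * ((1 + \<beta>) * (L + 2)\<^sup>2 + 2 * \<kappa>) + u / (\<epsilon> * N\<^sup>2) + (1 + \<beta>) * (L + 2) / N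
      + \<beta> * (L + 2) / s + 2 * \<bar>\<delta>\<bar> + 2 * \<bar>\<kappa> - \<beta> / 2 * v\<bar>"
  have d: "\<beta> / 2 * v * (N\<^sup>2 * loop_defect n g g' x) = \<beta> / 2 * v * (DG - N * Sxg)"
    using N unfolding loop_defect_def DG_def[symmetric] Sxg_def[symmetric] N_def[symmetric]
    by (simp add: field_simps power2_eq_square)
  \<comment> \<open>The decomposition of \<open>T0\<close> solved for the defect; every other
    summand is an error.\<close>
  have e: "\<beta> / 2 * v * (DG - N * Sxg) = T0 - (1 - \<beta> / 2) * k1 - \<beta> / 2 * (DK - v * DG) - N * (\<delta> * Sg) + N * ((\<kappa> - \<beta> / 2 * v) * Sxg)"
    unfolding Tdec by (simp add: algebra_simps add_divide_distrib diff_divide_distrib)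
  have "\<bar>\<beta> / 2 * v * (N\<^sup>2 * loop_defect n g g' x)\<bar> \<le> \<bar>T0\<bar> + \<bar>(1 - \<beta> / 2) * k1\<bar> + \<bar>\<beta> / 2 * (DK - v * DG)\<bar> + \<bar>N * (\<delta> * Sg)\<bar> + \<bar>N * ((\<kappa> - \<beta> / 2 * v) * Sxg)\<bar>"
    unfolding d e by linarith
  also have "\<dots> \<le> N\<^sup>2 * ((2 * \<epsilon> * ((1 + \<beta>) * (L + 2)\<^sup>2 + 2 * \<kappa>) + u / (\<epsilon> * N\<^sup>2)) * Y)
      + N\<^sup>2 * ((1 + \<beta>) * (L + 2) / N * Y) + N\<^sup>2 * (\<beta> * (L + 2) / s * Y) + N\<^sup>2 * (2 * \<bar>\<delta>\<bar> * Y)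
      + N\<^sup>2 * (2 * \<bar>\<kappa> - \<beta> / 2 * v\<bar> * Y)"
  proof (intro add_mono T0)
    have "\<bar>(1 - \<beta> / 2) * k1\<bar> \<le> (1 + \<beta>) * (N * (L + 2))"
      unfolding abs_mult using pos k1 by (intro mult_mono) auto
    also have "\<dots> = N\<^sup>2 * ((1 + \<beta>) * (L + 2) / N * 1)" using N by (simp add: power2_eq_square)
    also have "\<dots> \<le> N\<^sup>2 * ((1 + \<beta>) * (L + 2) / N * Y)"
      using Y1 pos L N by (intro mult_left_mono) auto
    finally show "\<bar>(1 - \<beta> / 2) * k1\<bar> \<le> N\<^sup>2 * ((1 + \<beta>) * (L + 2) / N * Y)" .
    have "\<bar>\<beta> / 2 * (DK - v * DG)\<bar> \<le> \<beta> / 2 * (N\<^sup>2 * (2 * (L + 2) * Y / s))"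
      unfolding abs_mult[of "\<beta> / 2"] using pos DD by (intro mult_mono) auto
    then show "\<bar>\<beta> / 2 * (DK - v * DG)\<bar> \<le> N\<^sup>2 * (\<beta> * (L + 2) / s * Y)" by (simp add: algebra_simps)
    have "\<bar>N * (\<delta> * Sg)\<bar> \<le> N * (\<bar>\<delta>\<bar> * (2 * N * Y))"
      unfolding abs_mult using N Sg by (intro mult_mono) auto
    then show "\<bar>N * (\<delta> * Sg)\<bar> \<le> N\<^sup>2 * (2 * \<bar>\<delta>\<bar> * Y)" by (simp add: mult_ac power2_eq_square)
    have "\<bar>N * ((\<kappa> - \<beta> / 2 * v) * Sxg)\<bar> \<le> N * (\<bar>\<kappa> - \<beta> / 2 * v\<bar> * (2 * N * Y))"
      unfolding abs_mult[of N] abs_mult[of "\<kappa> - \<beta> / 2 * v"] using N Sxg by (intro mult_mono) auto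
    then show "\<bar>N * ((\<kappa> - \<beta> / 2 * v) * Sxg)\<bar> \<le> N\<^sup>2 * (2 * \<bar>\<kappa> - \<beta> / 2 * v\<bar> * Y)"
      by (simp add: mult_ac power2_eq_square)
  qed
  also have "\<dots> = N\<^sup>2 * (?R * Y)"
    by (simp only: distrib_left distrib_right)
  finally have fin: "\<bar>\<beta> / 2 * v * (N\<^sup>2 * loop_defect n g g' x)\<bar> \<le> N\<^sup>2 * (?R * Y)" .
  have "v > 0" using c by (simp add: v_def)
  then have eq: "\<bar>\<beta> / 2 * v * (N\<^sup>2 * loop_defect n g g' x)\<bar> = N\<^sup>2 * (\<beta> / 2 * v * \<bar>loop_defect n g g' x\<bar>)"
    using pos by (simp add: abs_mult)
  have "\<beta> / 2 * v * \<bar>loop_defect n g g' x\<bar> \<le> ?R * Y"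
    by (rule mult_left_le_imp_le[OF fin[unfolded eq]]) (use N in simp)
  then show ?thesis unfolding v_def Y_def N_def .
qed

section \<open>The Volterra equation for characteristic functions\<close>

abbreviation volterra_conv :: "(real \<Rightarrow> complex) \<Rightarrow> real \<Rightarrow> complex" where
  "volterra_conv \<phi> t \<equiv> integral {0..t} (\<lambda>v. \<phi> v * \<phi> (t - v))"

text \<open>A weighted supremum in place of Gronwall's inequality. If \<open>M\<close> is the
  maximum of \<open>norm (d t) * exp (- 2 * t)\<close>, the two convolutions differ at time
  \<open>u\<close> by at most \<open>M * exp (2 * u)\<close>, and integrating the derivative leaves
  \<open>M / 2 * exp (2 * t)\<close>. The rate 2 produces this factor 1/2, so the term is absorbed
  at the maximiser \<open>t0\<close>.\<close>

lemma volterra_stability: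
  fixes \<phi> \<psi> :: "real \<Rightarrow> complex"
  assumes T: "T \<ge> 0"
    and d\<phi>: "\<And>t. (\<phi> has_vector_derivative \<phi>' t) (at t)" and d\<psi>: "\<And>t. (\<psi> has_vector_derivative \<psi>' t) (at t)"
    and n\<phi>: "\<And>t. norm (\<phi> t) \<le> 1" and n\<psi>: "\<And>t. norm (\<psi> t) \<le> 1" and z: "\<phi> 0 = \<psi> 0"
    and D: "\<And>t. 0 \<le> t \<Longrightarrow> t \<le> T \<Longrightarrow> norm (\<phi>' t + volterra_conv \<phi> t) \<le> \<eta>"
    and V: "\<And>t. 0 \<le> t \<Longrightarrow> t \<le> T \<Longrightarrow> \<psi>' t + volterra_conv \<psi> t = 0"
    and t: "0 \<le> t" "t \<le> T"
  shows "norm (\<phi> t - \<psi> t) \<le> 2 * \<eta> * T * exp (2 * T)"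
proof -
  define d where "d t = \<phi> t - \<psi> t" for t
  have c\<phi>: "continuous_on S \<phi>" and c\<psi>: "continuous_on S \<psi>" for S
    using d\<phi> d\<psi> by (meson continuous_at_imp_continuous_on has_vector_derivative_continuous)+
  have dd: "(d has_vector_derivative (\<phi>' t - \<psi>' t)) (at t)" for t
    unfolding d_def by (intro has_vector_derivative_diff d\<phi> d\<psi>)
  have cd: "continuous_on S d" for S
    unfolding d_def by (intro continuous_intros c\<phi> c\<psi>)
  have "continuous_on {0..T} (\<lambda>t. norm (d t) * exp (- 2 * t))" by (intro continuous_intros cd)
  from continuous_attains_sup[OF compact_Icc _ this]
  obtain t0 where t0: "t0 \<in> {0..T}" "\<And>t. t \<in> {0..T} \<Longrightarrow> norm (d t) * exp (- 2 * t) \<le> norm (d t0) * exp (- 2 * t0)"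
    using T by auto
  define M where "M = norm (d t0) * exp (- 2 * t0)"
  have M0: "M \<ge> 0" by (simp add: M_def)
  have bnd: "norm (d t) \<le> M * exp (2 * t)" if "0 \<le> t" "t \<le> T" for t
  proof -
    have "norm (d t) * exp (- 2 * t) * exp (2 * t) \<le> M * exp (2 * t)"
      using t0(2)[of t] that by (intro mult_right_mono) (auto simp: M_def)
    then show ?thesis by (simp add: mult.assoc exp_add[symmetric])
  qed
  have \<eta>: "\<eta> \<ge> 0" using D[of 0] T norm_ge_zero order.trans by blast
  have der: "norm (\<phi>' u - \<psi>' u) \<le> \<eta> + M * exp (2 * u)" if u: "0 \<le> u" "u \<le> T" for u
  proof -
    have i\<phi>: "(\<lambda>v. \<phi> v * \<phi> (u - v)) integrable_on {0..u}"
      by (intro integrable_continuous_interval continuous_intros c\<phi> continuous_on_compose2[OF c\<phi>[of UNIV]]) auto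
    have i\<psi>: "(\<lambda>v. \<psi> v * \<psi> (u - v)) integrable_on {0..u}"
      by (intro integrable_continuous_interval continuous_intros c\<psi> continuous_on_compose2[OF c\<psi>[of UNIV]]) auto
    let ?F = "\<lambda>v. M / 2 * exp (2 * v) - M / 2 * exp (2 * (u - v))"
    have g: "((\<lambda>v. M * exp (2 * v) + M * exp (2 * (u - v))) has_integral (?F u - ?F 0)) {0..u}"
      by (rule fundamental_theorem_of_calculus[OF u(1)])
         (auto intro!: derivative_eq_intros simp: has_real_derivative_iff_has_vector_derivative[symmetric])
    have "norm (integral {0..u} (\<lambda>v. \<phi> v * \<phi> (u - v) - \<psi> v * \<psi> (u - v))) \<le> integral {0..u} (\<lambda>v. M * exp (2 * v) + M * exp (2 * (u - v)))"
    proof (rule Henstock_Kurzweil_Integration.integral_norm_bound_integral)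
      show "(\<lambda>v. \<phi> v * \<phi> (u - v) - \<psi> v * \<psi> (u - v)) integrable_on {0..u}"
        by (rule integrable_diff[OF i\<phi> i\<psi>])
      show "(\<lambda>v. M * exp (2 * v) + M * exp (2 * (u - v))) integrable_on {0..u}"
        using g by (rule has_integral_integrable)
      fix v assume v: "v \<in> {0..u}"
      \<comment> \<open>The difference of products telescopes into two terms linear in
        \<open>d\<close>; as \<open>\<phi>\<close> and \<open>\<psi>\<close> are bounded by 1, the
        quadratic equation is as stable as a linear one.\<close>
      have "\<phi> v * \<phi> (u - v) - \<psi> v * \<psi> (u - v) = d v * \<phi> (u - v) + \<psi> v * d (u - v)"
        by (simp add: d_def algebra_simps)
      also have "norm \<dots> \<le> norm (d v) * norm (\<phi> (u - v)) + norm (\<psi> v) * norm (d (u - v))"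
        by (rule order.trans[OF norm_triangle_ineq]) (simp add: norm_mult)
      also have "\<dots> \<le> norm (d v) * 1 + 1 * norm (d (u - v))"
        by (intro add_mono mult_mono n\<phi> n\<psi>) auto
      also have "\<dots> \<le> M * exp (2 * v) + M * exp (2 * (u - v))"
        using bnd[of v] bnd[of "u - v"] v u by auto
      finally show "norm (\<phi> v * \<phi> (u - v) - \<psi> v * \<psi> (u - v)) \<le> M * exp (2 * v) + M * exp (2 * (u - v))" .
    qed
    also have "\<dots> = M * exp (2 * u) - M" unfolding integral_unique[OF g] by simp
    also have "\<dots> \<le> M * exp (2 * u)" using M0 by simp
    finally have i: "norm (volterra_conv \<phi> u - volterra_conv \<psi> u) \<le> M * exp (2 * u)"
      unfolding Henstock_Kurzweil_Integration.integral_diff[OF i\<phi> i\<psi>] .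
    have "\<phi>' u - \<psi>' u = (\<phi>' u + volterra_conv \<phi> u)
       - (volterra_conv \<phi> u - volterra_conv \<psi> u)"
      using V[OF u] by (simp add: add_eq_0_iff2)
    then have "norm (\<phi>' u - \<psi>' u) \<le> norm (\<phi>' u + volterra_conv \<phi> u)
       + norm (volterra_conv \<phi> u - volterra_conv \<psi> u)"
      by (simp only: norm_triangle_ineq4)
    then show ?thesis using D[OF u] i by linarith
  qed
  have d0: "d 0 = 0" by (simp add: d_def z)
  have M: "M \<le> 2 * \<eta> * T"
  proof (cases "t0 = 0")
    case True
    then show ?thesis using \<eta> T by (simp add: M_def d0)
  next
    case False
    let ?b = "\<lambda>u. \<eta> * u + M / 2 * exp (2 * u)"
    have "norm (d t0 - d 0) \<le> ?b t0 - ?b 0"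
    proof (rule differentiable_bound_general[where f'="\<lambda>u. \<phi>' u - \<psi>' u" and \<phi>'="\<lambda>u. \<eta> + M * exp (2 * u)"])
      show "0 < t0" using False t0 by auto
      show "(?b has_vector_derivative \<eta> + M * exp (2 * x)) (at x)" for x
        unfolding has_real_derivative_iff_has_vector_derivative[symmetric]
        by (auto intro!: derivative_eq_intros)
    qed (use t0 in \<open>auto intro!: continuous_intros cd dd der\<close>)
    then have "norm (d t0) \<le> \<eta> * t0 + M / 2 * exp (2 * t0)" using M0 d0 by simp
    moreover have "norm (d t0) = M * exp (2 * t0)"
      by (simp add: M_def mult.assoc exp_add[symmetric])
    ultimately have "M * exp (2 * t0) \<le> 2 * \<eta> * t0" by simp
    moreover have "M * 1 \<le> M * exp (2 * t0)" using M0 t0 by (intro mult_left_mono) auto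
    moreover have "2 * \<eta> * t0 \<le> 2 * \<eta> * T" using \<eta> t0 by (intro mult_left_mono) auto
    ultimately show ?thesis by linarith
  qed
  have "norm (d t) \<le> M * exp (2 * t)" using bnd t by simp
  also have "\<dots> \<le> 2 * \<eta> * T * exp (2 * T)" using M M0 t T \<eta> by (intro mult_mono) auto
  finally show ?thesis by (simp add: d_def)
qed

section \<open>Empirical characteristic functions\<close>

definition ecf :: "nat \<Rightarrow> (nat \<Rightarrow> real) \<Rightarrow> real \<Rightarrow> complex" where
  "ecf n x t = (\<Sum>j<n. iexp (t * x j)) / of_nat n"

definition ecf_deriv :: "nat \<Rightarrow> (nat \<Rightarrow> real) \<Rightarrow> real \<Rightarrow> complex" where
  "ecf_deriv n x t = (\<Sum>j<n. \<i> * of_real (x j) * iexp (t * x j)) / of_nat n"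

lemma has_vector_derivative_ecf: "(ecf n x has_vector_derivative ecf_deriv n x t) (at t)"
proof -
  have "((\<lambda>z. (\<Sum>j<n. exp (\<i> * (z * of_real (x j)))) / of_nat n) has_field_derivative
     (\<Sum>j<n. exp (\<i> * (of_real t * of_real (x j))) * (\<i> * of_real (x j))) / of_nat n) (at (of_real t))"
    by (intro DERIV_cdivide DERIV_sum) (auto intro!: derivative_eq_intros)
  from has_vector_derivative_real_field[OF this, of UNIV]
  show ?thesis unfolding ecf_def[abs_def] ecf_deriv_def by (simp add: mult_ac)
qed

lemma norm_ecf_le: "norm (ecf n x t) \<le> 1"
proof -
  have "norm (\<Sum>j<n. iexp (t * x j)) \<le> (\<Sum>j<n. 1)"
    by (rule order.trans[OF norm_sum sum_mono]) simp
  then show ?thesis by (cases "n = 0") (simp_all add: ecf_def norm_divide)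
qed

lemma iexp_eq_cis: "iexp u = cis u"
  by (simp add: cis_conv_exp)

lemma norm_iexp_diff_le: "norm (iexp a - iexp b) \<le> \<bar>a - b\<bar>"
proof -
  have "iexp a - iexp b = iexp b * (iexp (a - b) - 1)"
    by (simp add: algebra_simps exp_add[symmetric])
  then have "norm (iexp a - iexp b) = norm (iexp (a - b) - 1)" by (simp add: norm_mult)
  also have "\<dots> \<le> \<bar>a - b\<bar>" using iexp_approx1[of "a - b" 0] by simp
  finally show ?thesis .
qed

text \<open>The divided difference of \<open>exp (i t x)\<close> in \<open>x\<close>, assembled from
  real and imaginary part because loop equations are available for real test functions.\<close>

abbreviation dd_cis :: "real \<Rightarrow> real \<Rightarrow> real \<Rightarrow> complex" where
  "dd_cis t x y \<equiv> of_real (divided_difference (\<lambda>x. cos (t * x)) (\<lambda>x. - t * sin (t * x)) x y)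
     + \<i> * of_real (divided_difference (\<lambda>x. sin (t * x)) (\<lambda>x. t * cos (t * x)) x y)"

text \<open>Duhamel's formula: the divided difference of \<open>exp (i t x)\<close> is
  \<open>i\<close> times a convolution of exponentials over [0,t]. This turns the loop equation into
  a Volterra equation.\<close>

lemma has_integral_iexp_convolution:
  assumes t: "t \<ge> 0"
  shows "((\<lambda>v. iexp (v * x) * iexp ((t - v) * y)) has_integral - \<i> * dd_cis t x y) {0..t}"
proof (cases "x = y")
  case True
  have "(\<lambda>v. iexp (v * x) * iexp ((t - v) * y)) = (\<lambda>v. iexp (t * x))"
    by (simp add: True exp_add[symmetric] algebra_simps)
  moreover have "((\<lambda>v. iexp (t * x)) has_integral of_real t * iexp (t * x)) {0..t}"
    using has_integral_const_real[of "iexp (t * x)" 0 t] t by (simp add: scaleR_conv_of_real)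
  moreover have "- \<i> * dd_cis t x y = of_real t * iexp (t * x)"
    unfolding True divided_difference_def iexp_eq_cis by (simp add: complex_eq_iff)
  ultimately show ?thesis by simp
next
  case False
  define F where "F v = iexp (v * (x - y)) * (iexp (t * y) / (\<i> * of_real (x - y)))" for v
  have eq: "iexp (v * x) * iexp ((t - v) * y) = iexp (v * (x - y)) * iexp (t * y)" for v
    by (simp add: exp_add[symmetric] algebra_simps)
  have "((\<lambda>v. iexp (v * (x - y)) * iexp (t * y)) has_integral F t - F 0) {0..t}"
  proof (rule fundamental_theorem_of_calculus[OF t])
    fix v
    have "((\<lambda>z. exp (\<i> * (z * of_real (x - y))) * (iexp (t * y) / (\<i> * of_real (x - y)))) has_field_derivative
      (exp (\<i> * (of_real v * of_real (x - y))) * (\<i> * of_real (x - y))) * (iexp (t * y) / (\<i> * of_real (x - y)))) (at (of_real v))"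
      by (rule DERIV_cmult_right) (auto intro!: derivative_eq_intros)
    from has_vector_derivative_real_field[OF this, of "{0..t}"]
    show "(F has_vector_derivative iexp (v * (x - y)) * iexp (t * y)) (at v within {0..t})"
      unfolding F_def[abs_def] using False by simp
  qed
  moreover have "F t - F 0 = - \<i> * dd_cis t x y"
  proof -
    have "F t - F 0 = (iexp (t * (x - y)) * iexp (t * y) - iexp (t * y)) / (\<i> * of_real (x - y))"
      by (simp add: F_def diff_divide_distrib)
    also have "iexp (t * (x - y)) * iexp (t * y) = iexp (t * x)"
      by (simp add: exp_add[symmetric] algebra_simps)
    also have "(iexp (t * x) - iexp (t * y)) / (\<i> * of_real (x - y)) = - \<i> * ((iexp (t * x) - iexp (t * y)) / of_real (x - y))"
      using False by (simp add: field_simps)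
    also have "(iexp (t * x) - iexp (t * y)) / of_real (x - y) = dd_cis t x y"
      using False unfolding divided_difference_def iexp_eq_cis
      by (simp add: complex_eq_iff Re_divide_of_real Im_divide_of_real del: of_real_diff)
    finally show ?thesis .
  qed
  ultimately show ?thesis unfolding eq by simp
qed

lemma ecf_convolution:
  assumes t: "t \<ge> 0"
  shows "((\<lambda>v. ecf n x v * ecf n x (t - v)) has_integral
     (\<Sum>i<n. \<Sum>j<n. - \<i> * dd_cis t (x i) (x j)) / (of_nat n)\<^sup>2) {0..t}"
proof -
  have "((\<lambda>v. (\<Sum>i<n. \<Sum>j<n. iexp (v * x i) * iexp ((t - v) * x j)) / (of_nat n)\<^sup>2) has_integral
     (\<Sum>i<n. \<Sum>j<n. - \<i> * dd_cis t (x i) (x j)) / (of_nat n)\<^sup>2) {0..t}"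
    by (intro has_integral_divide has_integral_sum has_integral_iexp_convolution t) auto
  moreover have "ecf n x v * ecf n x (t - v) = (\<Sum>i<n. \<Sum>j<n. iexp (v * x i) * iexp ((t - v) * x j)) / (of_nat n)\<^sup>2" for v
    unfolding ecf_def sum_product[symmetric] by (simp add: power2_eq_square)
  ultimately show ?thesis by simp
qed

lemma complex_combination_divide:
  "c * (of_real X + \<i> * of_real Y) / of_real r = c * (of_real (X / r) + \<i> * of_real (Y / r))"
  by (simp add: distrib_left add_divide_distrib)

abbreviation cos_defect :: "nat \<Rightarrow> real \<Rightarrow> (nat \<Rightarrow> real) \<Rightarrow> real" where
  "cos_defect n t \<equiv> loop_defect n (\<lambda>x. cos (t * x)) (\<lambda>x. - t * sin (t * x))"

abbreviation sin_defect :: "nat \<Rightarrow> real \<Rightarrow> (nat \<Rightarrow> real) \<Rightarrow> real" where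
  "sin_defect n t \<equiv> loop_defect n (\<lambda>x. sin (t * x)) (\<lambda>x. t * cos (t * x))"

text \<open>Averaging Duhamel's formula over both points gives \<open>volterra_conv\<close>, and the
  mean of \<open>x * exp (i t x)\<close> is \<open>- i\<close> times the derivative. The Volterra
  residual is therefore \<open>- i\<close> times the loop defect of
  \<open>exp (i t x)\<close>.\<close>

lemma ecf_defect:
  assumes t: "t \<ge> 0"
  shows "ecf_deriv n x t + volterra_conv (ecf n x) t =
    - \<i> * (of_real (cos_defect n t x)
      + \<i> * of_real (sin_defect n t x))"
proof -
  have 1: "ecf_deriv n x t = \<i> * (of_real ((\<Sum>j<n. x j * cos (t * x j)) / real n) + \<i> * of_real ((\<Sum>j<n. x j * sin (t * x j)) / real n))"
  proof -
    have ie: "iexp u = of_real (cos u) + \<i> * of_real (sin u)" for u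
      unfolding iexp_eq_cis by (simp add: complex_eq_iff)
    have "(\<Sum>j<n. \<i> * of_real (x j) * iexp (t * x j)) = (\<Sum>j<n. \<i> * (of_real (x j * cos (t * x j)) + \<i> * of_real (x j * sin (t * x j))))"
      unfolding ie by (intro sum.cong) (simp_all only: of_real_mult distrib_left mult_ac)
    also have "\<dots> = \<i> * (of_real (\<Sum>j<n. x j * cos (t * x j)) + \<i> * of_real (\<Sum>j<n. x j * sin (t * x j)))"
      by (simp only: of_real_sum sum_distrib_left distrib_left sum.distrib)
    finally have "(\<Sum>j<n. \<i> * of_real (x j) * iexp (t * x j)) = \<i> * (of_real (\<Sum>j<n. x j * cos (t * x j)) + \<i> * of_real (\<Sum>j<n. x j * sin (t * x j)))" .
    then show ?thesis unfolding ecf_deriv_def of_real_of_nat_eq[symmetric, where 'a=complex]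
      by (simp only: complex_combination_divide)
  qed
  have sums: "(\<Sum>i<n. \<Sum>j<n. - \<i> * (of_real (a i j) + \<i> * of_real (b i j)))
      = - \<i> * (of_real (\<Sum>i<n. \<Sum>j<n. a i j) + \<i> * of_real (\<Sum>i<n. \<Sum>j<n. b i j))" for a b :: "nat \<Rightarrow> nat \<Rightarrow> real"
    by (simp only: of_real_sum sum_distrib_left distrib_left sum.distrib)
  have 2: "volterra_conv (ecf n x) t = - \<i> *
     (of_real ((\<Sum>i<n. \<Sum>j<n. divided_difference (\<lambda>x. cos (t * x)) (\<lambda>x. - t * sin (t * x)) (x i) (x j)) / (real n)\<^sup>2)
      + \<i> * of_real ((\<Sum>i<n. \<Sum>j<n. divided_difference (\<lambda>x. sin (t * x)) (\<lambda>x. t * cos (t * x)) (x i) (x j)) / (real n)\<^sup>2))"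
    unfolding integral_unique[OF ecf_convolution[OF t]]
    unfolding of_real_of_nat_eq[symmetric, where 'a=complex] of_real_power[symmetric]
    by (simp only: sums complex_combination_divide)
  show ?thesis unfolding 1 2 loop_defect_def by (simp add: algebra_simps)
qed

lemma mean_abs_le_mean_square: "(\<Sum>j<n. \<bar>x j\<bar>) / real n \<le> 1 + mean_square n x"
proof (cases "n = 0")
  case False
  have "\<bar>z\<bar> \<le> 1 + z\<^sup>2" for z :: real
    using zero_le_power2[of "\<bar>z\<bar> - 1"] by (simp add: power2_eq_square algebra_simps)
  then have "(\<Sum>j<n. \<bar>x j\<bar>) \<le> (\<Sum>j<n. 1 + (x j)\<^sup>2)" by (intro sum_mono)
  then have "(\<Sum>j<n. \<bar>x j\<bar>) / real n \<le> (\<Sum>j<n. 1 + (x j)\<^sup>2) / real n"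
    by (intro divide_right_mono) auto
  also have "\<dots> = 1 + mean_square n x"
    using False by (simp add: mean_square_def sum.distrib add_divide_distrib)
  finally show ?thesis .
qed (simp add: mean_square_def)

lemma ecf_lipschitz:
  assumes "mean_square n x \<le> C"
  shows "norm (ecf n x t - ecf n x r) \<le> (1 + C) * \<bar>t - r\<bar>"
proof -
  have "norm (ecf n x t - ecf n x r) = norm (\<Sum>j<n. iexp (t * x j) - iexp (r * x j)) / real n"
    by (simp add: ecf_def diff_divide_distrib[symmetric] sum_subtractf norm_divide)
  also have "\<dots> \<le> (\<Sum>j<n. \<bar>x j\<bar> * \<bar>t - r\<bar>) / real n"
  proof (intro divide_right_mono order.trans[OF norm_sum] sum_mono)
    fix j show "norm (iexp (t * x j) - iexp (r * x j)) \<le> \<bar>x j\<bar> * \<bar>t - r\<bar>"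
      using norm_iexp_diff_le[of "t * x j" "r * x j"]
      by (simp add: left_diff_distrib[symmetric] abs_mult mult.commute)
  qed simp
  also have "\<dots> = ((\<Sum>j<n. \<bar>x j\<bar>) / real n) * \<bar>t - r\<bar>" by (simp add: sum_distrib_right)
  also have "\<dots> \<le> (1 + C) * \<bar>t - r\<bar>"
    using mean_abs_le_mean_square[where n=n and x=x] assms by (intro mult_right_mono) auto
  finally show ?thesis .
qed

lemma ecf_deriv_lipschitz:
  assumes "mean_square n x \<le> C"
  shows "norm (ecf_deriv n x t - ecf_deriv n x r) \<le> C * \<bar>t - r\<bar>"
proof -
  have "norm (ecf_deriv n x t - ecf_deriv n x r) = norm (\<Sum>j<n. \<i> * of_real (x j) * (iexp (t * x j) - iexp (r * x j))) / real n"
    by (simp add: ecf_deriv_def diff_divide_distrib[symmetric] sum_subtractf norm_divide right_diff_distrib)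
  also have "\<dots> \<le> (\<Sum>j<n. (x j)\<^sup>2 * \<bar>t - r\<bar>) / real n"
  proof (intro divide_right_mono order.trans[OF norm_sum] sum_mono)
    fix j
    have "norm (iexp (t * x j) - iexp (r * x j)) \<le> \<bar>x j\<bar> * \<bar>t - r\<bar>"
      using norm_iexp_diff_le[of "t * x j" "r * x j"]
      by (simp add: left_diff_distrib[symmetric] abs_mult mult.commute)
    then have "\<bar>x j\<bar> * norm (iexp (t * x j) - iexp (r * x j)) \<le> \<bar>x j\<bar> * (\<bar>x j\<bar> * \<bar>t - r\<bar>)"
      by (intro mult_left_mono) auto
    also have "\<dots> = (x j)\<^sup>2 * \<bar>t - r\<bar>" by (simp add: power2_eq_square mult.assoc[symmetric])
    finally show "norm (\<i> * of_real (x j) * (iexp (t * x j) - iexp (r * x j))) \<le> (x j)\<^sup>2 * \<bar>t - r\<bar>"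
      by (simp add: norm_mult)
  qed simp
  also have "\<dots> = mean_square n x * \<bar>t - r\<bar>" by (simp add: sum_distrib_right mean_square_def)
  also have "\<dots> \<le> C * \<bar>t - r\<bar>" using assms by (intro mult_right_mono) auto
  finally show ?thesis .
qed

text \<open>Convergence of the defect will be known only at rational times. A Lipschitz constant
  that depends on the sample only through a second-moment bound carries it from a grid to all of
  [0,T].\<close>

lemma ecf_defect_lipschitz:
  fixes n x
  defines "D \<equiv> \<lambda>t. ecf_deriv n x t + volterra_conv (ecf n x) t"
  assumes C: "mean_square n x \<le> C" and t: "0 \<le> r" "r \<le> t" "t \<le> T"
  shows "norm (D t - D r) \<le> (C + 1 + T * (1 + C)) * (t - r)"
proof -
  let ?\<phi> = "ecf n x"
  have C0: "C \<ge> 0" using C by (rule order.trans[rotated]) (simp add: mean_square_def sum_nonneg)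
  have c: "continuous_on S ?\<phi>" for S
    using has_vector_derivative_ecf by (meson continuous_at_imp_continuous_on has_vector_derivative_continuous)
  have i: "(\<lambda>v. ?\<phi> v * ?\<phi> (s - v)) integrable_on {a..b}" for s a b
    by (intro integrable_continuous_interval continuous_intros c continuous_on_compose2[OF c[of UNIV]]) auto
  have s: "volterra_conv ?\<phi> t = integral {0..r} (\<lambda>v. ?\<phi> v * ?\<phi> (t - v)) + integral {r..t} (\<lambda>v. ?\<phi> v * ?\<phi> (t - v))"
    using t by (intro Henstock_Kurzweil_Integration.integral_combine[symmetric] i) auto
  have 1: "norm (integral {r..t} (\<lambda>v. ?\<phi> v * ?\<phi> (t - v))) \<le> 1 * (t - r)"
  proof (rule integral_bound)
    show "continuous_on {r..t} (\<lambda>v. ?\<phi> v * ?\<phi> (t - v))"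
      by (intro continuous_intros c continuous_on_compose2[OF c[of UNIV]]) auto
    show "norm (?\<phi> v * ?\<phi> (t - v)) \<le> 1" for v
      unfolding norm_mult using mult_mono[OF norm_ecf_le[of n x v] norm_ecf_le[of n x "t - v"]] by simp
  qed (use t in auto)
  have "norm (integral {0..r} (\<lambda>v. ?\<phi> v * ?\<phi> (t - v) - ?\<phi> v * ?\<phi> (r - v))) \<le> ((1 + C) * (t - r)) * (r - 0)"
  proof (rule integral_bound)
    show "continuous_on {0..r} (\<lambda>v. ?\<phi> v * ?\<phi> (t - v) - ?\<phi> v * ?\<phi> (r - v))"
      by (intro continuous_intros c continuous_on_compose2[OF c[of UNIV]]) auto
    show "norm (?\<phi> v * ?\<phi> (t - v) - ?\<phi> v * ?\<phi> (r - v)) \<le> (1 + C) * (t - r)" for v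
    proof -
      have "norm (?\<phi> v * ?\<phi> (t - v) - ?\<phi> v * ?\<phi> (r - v)) = norm (?\<phi> v) * norm (?\<phi> (t - v) - ?\<phi> (r - v))"
        by (simp add: norm_mult[symmetric] right_diff_distrib)
      also have "\<dots> \<le> 1 * ((1 + C) * \<bar>(t - v) - (r - v)\<bar>)"
        by (intro mult_mono norm_ecf_le ecf_lipschitz C) auto
      finally show ?thesis using t by simp
    qed
  qed (use t in auto)
  also have "\<dots> \<le> ((1 + C) * (t - r)) * T" using t C0 by (intro mult_left_mono) auto
  finally have 2: "norm (integral {0..r} (\<lambda>v. ?\<phi> v * ?\<phi> (t - v)) - volterra_conv ?\<phi> r) \<le> ((1 + C) * (t - r)) * T"
    unfolding Henstock_Kurzweil_Integration.integral_diff[OF i i] .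
  have 3: "norm (ecf_deriv n x t - ecf_deriv n x r) \<le> C * (t - r)"
    using ecf_deriv_lipschitz[OF C, of t r] t by simp
  have "D t - D r = (ecf_deriv n x t - ecf_deriv n x r) +
     (integral {0..r} (\<lambda>v. ?\<phi> v * ?\<phi> (t - v)) - volterra_conv ?\<phi> r)
     + integral {r..t} (\<lambda>v. ?\<phi> v * ?\<phi> (t - v))"
    unfolding D_def s by simp
  also have "norm \<dots> \<le> C * (t - r) + ((1 + C) * (t - r)) * T + 1 * (t - r)"
    by (intro order.trans[OF norm_triangle_ineq] add_mono 1 2 3)
  finally show ?thesis by (simp add: algebra_simps)
qed

lemma ecf_tendsto:
  fixes x :: "nat \<Rightarrow> nat \<Rightarrow> real" and \<psi> :: "real \<Rightarrow> complex"
  assumes S: "\<forall>\<^sub>F n in sequentially. mean_square n (x n) \<le> C"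
    and Dc: "\<And>t. t \<in> \<rat> \<Longrightarrow> 0 \<le> t \<Longrightarrow> (\<lambda>n. cos_defect n t (x n)) \<longlonglongrightarrow> 0"
    and Ds: "\<And>t. t \<in> \<rat> \<Longrightarrow> 0 \<le> t \<Longrightarrow> (\<lambda>n. sin_defect n t (x n)) \<longlonglongrightarrow> 0"
    and d\<psi>: "\<And>t. (\<psi> has_vector_derivative \<psi>' t) (at t)" and n\<psi>: "\<And>t. norm (\<psi> t) \<le> 1" and z: "\<psi> 0 = 1"
    and V: "\<And>t. 0 \<le> t \<Longrightarrow> \<psi>' t + volterra_conv \<psi> t = 0"
    and T: "T \<ge> 0"
  shows "(\<lambda>n. ecf n (x n) T) \<longlonglongrightarrow> \<psi> T"
proof -
  define D where "D n t = ecf_deriv n (x n) t + volterra_conv (ecf n (x n)) t" for n t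
  have D0: "(\<lambda>n. D n t) \<longlonglongrightarrow> 0" if "t \<in> \<rat>" "0 \<le> t" for t
  proof -
    have "(\<lambda>n. - \<i> * (of_real (cos_defect n t (x n))
      + \<i> * of_real (sin_defect n t (x n)))) \<longlonglongrightarrow> - \<i> * (of_real 0 + \<i> * of_real 0)"
      by (intro tendsto_intros Dc Ds that)
    then show ?thesis unfolding D_def ecf_defect[OF that(2)] by simp
  qed
  define C' where "C' = max C 0"
  define K where "K = C' + 1 + T * (1 + C')"
  have K: "K > 0" using T by (simp add: K_def C'_def add_pos_nonneg)
  have small: "\<forall>\<^sub>F n in sequentially. \<forall>t\<in>{0..T}. norm (D n t) \<le> \<eta>" if \<eta>: "\<eta> > 0" for \<eta>
  proof -
    obtain N :: nat where N: "N > 0" "K / real N < \<eta> / 2"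
    proof -
      obtain N :: nat where "K / (\<eta> / 2) < real N" using reals_Archimedean2 by blast
      moreover have "0 < K / (\<eta> / 2)" using K \<eta> by simp
      ultimately have "0 < real N" by linarith
      then show ?thesis using that[of N] \<open>K / (\<eta> / 2) < real N\<close> \<eta> by (auto simp: field_simps)
    qed
    \<comment> \<open>A finite rational grid of mesh \<open>1 / N\<close> over [0,T];
      \<open>K / N < \<eta> / 2\<close> accounts for the distance to the grid point below.\<close>
    define G where "G = (\<lambda>k. real k / real N) ` {..nat \<lceil>T * real N\<rceil>}"
    have "finite G" by (simp add: G_def)
    have "\<forall>\<^sub>F n in sequentially. \<forall>q\<in>G. norm (D n q) < \<eta> / 2"
    proof (rule eventually_ball_finite[OF \<open>finite G\<close>], rule ballI)
      fix q assume "q \<in> G"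
      then have "q \<in> \<rat>" "q \<ge> 0" by (auto simp: G_def)
      from tendstoD[OF D0[OF this], of "\<eta> / 2"] show "\<forall>\<^sub>F n in sequentially. norm (D n q) < \<eta> / 2"
        using \<eta> by (simp add: dist_norm)
    qed
    then show ?thesis using S
    proof eventually_elim
      case (elim n)
      show ?case
      proof
        fix t assume t: "t \<in> {0..T}"
        define k where "k = nat \<lfloor>t * real N\<rfloor>"
        define q where "q = real k / real N"
        have k: "real k \<le> t * real N" "t * real N < real k + 1"
          using t N by (auto simp: k_def of_nat_nat floor_correct)
        have q: "0 \<le> q" "q \<le> t" "t - q \<le> 1 / real N"
        proof -
          show "0 \<le> q" by (simp add: q_def)
          show "q \<le> t" using k(1) N by (simp add: q_def pos_divide_le_eq)
          have "t \<le> (real k + 1) / real N" using k(2) N by (simp add: pos_le_divide_eq)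
          then show "t - q \<le> 1 / real N" by (simp add: q_def add_divide_distrib)
        qed
        have "real k \<le> T * real N"
        proof -
          have "t * real N \<le> T * real N" using t by (intro mult_right_mono) auto
          then show ?thesis using k(1) by linarith
        qed
        then have "k \<le> nat \<lceil>T * real N\<rceil>" by linarith
        then have "q \<in> G" by (auto simp: G_def q_def)
        then have "norm (D n q) < \<eta> / 2" using elim(1) by blast
        moreover have "norm (D n t - D n q) \<le> K * (t - q)"
          unfolding D_def K_def
          by (rule ecf_defect_lipschitz) (use elim(2) q t in \<open>auto simp: C'_def\<close>)
        moreover have "K * (t - q) \<le> K / real N" using q K mult_left_mono[of "t - q" "1 / real N" K] by simp
        moreover have "norm (D n t) \<le> norm (D n q) + norm (D n t - D n q)"
          using norm_triangle_sub[of "D n t" "D n q"] by simp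
        ultimately show "norm (D n t) \<le> \<eta>" using N(2) by linarith
      qed
    qed
  qed
  show ?thesis
  proof (rule tendstoI)
    fix e :: real assume e: "e > 0"
    \<comment> \<open>Makes the stability bound \<open>2 * \<eta> * T * exp (2 * T)\<close> at most
      \<open>e / 2\<close>; \<open>T + 1\<close> in place of \<open>T\<close> allows
      \<open>T = 0\<close>.\<close>
    define \<eta> where "\<eta> = e / (4 * (T + 1) * exp (2 * T))"
    have \<eta>: "\<eta> > 0" using e T by (simp add: \<eta>_def)
    show "\<forall>\<^sub>F n in sequentially. dist (ecf n (x n) T) (\<psi> T) < e"
      using small[OF \<eta>] eventually_gt_at_top[of 0]
    proof eventually_elim
      case (elim n)
      have "norm (ecf n (x n) T - \<psi> T) \<le> 2 * \<eta> * T * exp (2 * T)"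
      proof (rule volterra_stability[OF T has_vector_derivative_ecf d\<psi> norm_ecf_le n\<psi>])
        \<comment> \<open>At \<open>n = 0\<close> the division by zero would give the value 0; for
          \<open>n >= 1\<close> the value at time 0 is 1.\<close>
        show "ecf n (x n) 0 = \<psi> 0" using elim(2) z by (simp add: ecf_def)
        show "norm (ecf_deriv n (x n) t + volterra_conv (ecf n (x n)) t) \<le> \<eta>"
          if "0 \<le> t" "t \<le> T" for t using elim(1) that by (auto simp: D_def)
      qed (use V T in auto)
      also have "\<dots> \<le> 2 * \<eta> * (T + 1) * exp (2 * T)" using \<eta> T by (intro mult_right_mono mult_left_mono) auto
      also have "\<dots> = e / 2"
      proof -
        have "2 * (e / (4 * P)) * P = e / 2" if "P > 0" for P :: real using that by simp
        from this[of "(T + 1) * exp (2 * T)"] T show ?thesis by (simp only: \<eta>_def mult.assoc) simp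
      qed
      also have "\<dots> < e" using e by simp
      finally show ?case by (simp add: dist_norm)
    qed
  qed
qed

section \<open>Moments of the semicircle law\<close>

lemma DERIV_power_fact:
  "((\<lambda>v. v ^ Suc k / fact (Suc k)) has_real_derivative v ^ k / fact k) (at v within S)" for v :: real
proof -
  have "((\<lambda>v. v ^ Suc k / fact (Suc k)) has_real_derivative real (Suc k) * v ^ k / fact (Suc k)) (at v within S)"
    by (rule DERIV_cdivide) (use DERIV_pow[of "Suc k" v] in simp)
  then show ?thesis by (simp add: fact_Suc field_simps del: of_nat_Suc)
qed

text \<open>A Beta integral: normalised by factorials, powers convolve by adding degrees plus one.
  Integration by parts moves one degree from \<open>t - v\<close> to \<open>v\<close>; the boundary
  terms vanish since both factors of \<open>?F\<close> have positive degree.\<close>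

lemma has_integral_power_convolution:
  fixes t :: real
  assumes "t \<ge> 0"
  shows "((\<lambda>v. v ^ k / fact k * ((t - v) ^ l / fact l)) has_integral t ^ (k + l + 1) / fact (k + l + 1)) {0..t}"
proof (induction l arbitrary: k)
  case 0
  have "((\<lambda>v. v ^ k / fact k) has_integral (t ^ Suc k / fact (Suc k) - 0 ^ Suc k / fact (Suc k))) {0..t}"
  proof (rule fundamental_theorem_of_calculus[OF assms])
    show "((\<lambda>v. v ^ Suc k / fact (Suc k)) has_vector_derivative v ^ k / fact k) (at v within {0..t})" for v
      using DERIV_power_fact by (simp only: has_real_derivative_iff_has_vector_derivative)
  qed
  then show ?case by simp
next
  case (Suc l)
  let ?F = "\<lambda>v. v ^ Suc k / fact (Suc k) * ((t - v) ^ Suc l / fact (Suc l))"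
  have "((\<lambda>v. v ^ k / fact k * ((t - v) ^ Suc l / fact (Suc l)) - v ^ Suc k / fact (Suc k) * ((t - v) ^ l / fact l)) has_integral (?F t - ?F 0)) {0..t}"
  proof (rule fundamental_theorem_of_calculus[OF assms])
    fix v
    have 2: "((\<lambda>v. (t - v) ^ Suc l / fact (Suc l)) has_real_derivative - ((t - v) ^ l / fact l)) (at v within {0..t})"
    proof -
      have "((\<lambda>v. (t - v) ^ Suc l / fact (Suc l)) has_real_derivative (real (Suc l) * (0 - 1) * (t - v) ^ l) / fact (Suc l)) (at v within {0..t})"
      proof (rule DERIV_cdivide)
        have "((\<lambda>v. (t - v) ^ Suc l) has_real_derivative (1 + real l) * ((0 - 1) * (t - v) ^ l)) (at v within {0..t})"
          by (intro DERIV_power_Suc DERIV_diff DERIV_const DERIV_ident)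
        then show "((\<lambda>v. (t - v) ^ Suc l) has_real_derivative real (Suc l) * (0 - 1) * (t - v) ^ l) (at v within {0..t})"
          by (simp only: of_nat_Suc mult.assoc)
      qed
      then show ?thesis by (simp add: fact_Suc field_simps del: of_nat_Suc)
    qed
    have "(?F has_real_derivative v ^ k / fact k * ((t - v) ^ Suc l / fact (Suc l)) + (- ((t - v) ^ l / fact l)) * (v ^ Suc k / fact (Suc k))) (at v within {0..t})"
      by (rule DERIV_mult[OF DERIV_power_fact 2])
    then show "(?F has_vector_derivative v ^ k / fact k * ((t - v) ^ Suc l / fact (Suc l)) - v ^ Suc k / fact (Suc k) * ((t - v) ^ l / fact l)) (at v within {0..t})"
      unfolding has_real_derivative_iff_has_vector_derivative[symmetric] by (simp add: mult.commute)
  qed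
  from has_integral_add[OF this Suc.IH[of "Suc k"]]
  show ?case by simp
qed

text \<open>The Catalan numbers as coefficients of the square root of 1 - 4z: their convolution is then
  Vandermonde's identity for the exponents 1/2 + 1/2 = 1.\<close>

definition catalan_real :: "nat \<Rightarrow> real" where
  "catalan_real k = - (1/2) * (-4) ^ Suc k * ((1/2) gchoose Suc k)"

lemma catalan_real_0: "catalan_real 0 = 1"
  by (simp add: catalan_real_def)

text \<open>The Catalan recursion \<open>(k + 2) C_(k+1) = 2 (2 k + 1) C_k\<close>, doubled so that
  for \<open>p = 2 k\<close> it matches the integration by parts of the semicircle moments.\<close>

lemma catalan_real_Suc: "(2 * real k + 4) * catalan_real (Suc k) = 4 * (2 * real k + 1) * catalan_real k"
proof -
  have "real (Suc (Suc k)) * ((1/2) gchoose Suc (Suc k)) = (1/2 - real (Suc k)) * ((1/2::real) gchoose Suc k)"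
    using gbinomial_absorb_comp[of "1/2::real" "Suc k"] gbinomial_absorption[of "Suc k" "1/2::real"] by simp
  then have q: "(2 * real k + 4) * ((1/2) gchoose Suc (Suc k)) = - (2 * real k + 1) * ((1/2::real) gchoose Suc k)"
    by (simp add: field_simps)
 have "(2 * real k + 4) * catalan_real (Suc k) = - (1/2) * (-4) ^ Suc (Suc k) * ((2 * real k + 4) * ((1/2) gchoose Suc (Suc k)))"
    unfolding catalan_real_def by (simp only: mult_ac)
  also have "\<dots> = 4 * (2 * real k + 1) * catalan_real k"
  proof -
    have "- (1/2) * (- 4 * P) * (- r * Q) = 4 * r * (- (1/2) * P * Q)" for P Q r :: real by simp
    then show ?thesis unfolding q catalan_real_def power_Suc[of _ "Suc k"] .
  qed
  finally show ?thesis .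
qed

lemma catalan_real_convolution: "(\<Sum>k\<le>n. catalan_real k * catalan_real (n - k)) = catalan_real (Suc n)"
proof -
  let ?q = "\<lambda>j. (1/2::real) gchoose j"
  have "(\<Sum>j=0..Suc (Suc n). ?q j * ?q (Suc (Suc n) - j)) = 1 gchoose Suc (Suc n)"
    using gbinomial_Vandermonde[of "1/2::real" "1/2" "Suc (Suc n)"] by simp
  also have "(1::real) gchoose Suc (Suc n) = 0"
    using binomial_gbinomial[of 1 "Suc (Suc n)", where 'a=real] by simp
  \<comment> \<open>The end terms \<open>j = 0\<close> and \<open>j = n + 2\<close> each contain a
    factor \<open>gchoose 0 = 1\<close> and are equal; the indices between them, shifted down by
    one, give the convolution.\<close>
  also have "(\<Sum>j=0..Suc (Suc n). ?q j * ?q (Suc (Suc n) - j)) = 2 * ?q (Suc (Suc n)) + (\<Sum>k\<le>n. ?q (Suc k) * ?q (Suc (n - k)))"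
  proof -
    have "(\<Sum>j=0..Suc (Suc n). ?q j * ?q (Suc (Suc n) - j)) = ?q (Suc (Suc n)) + (\<Sum>j=0..Suc n. ?q (Suc j) * ?q (Suc n - j))"
      by (subst sum.atLeast0_atMost_Suc_shift) simp
    also have "(\<Sum>j=0..Suc n. ?q (Suc j) * ?q (Suc n - j)) = (\<Sum>j=0..n. ?q (Suc j) * ?q (Suc n - j)) + ?q (Suc (Suc n))"
      by simp
    also have "(\<Sum>j=0..n. ?q (Suc j) * ?q (Suc n - j)) = (\<Sum>k\<le>n. ?q (Suc k) * ?q (Suc (n - k)))"
      by (intro sum.cong) (auto simp: Suc_diff_le)
    finally show ?thesis by simp
  qed
  finally have q: "(\<Sum>k\<le>n. ?q (Suc k) * ?q (Suc (n - k))) = - 2 * ?q (Suc (Suc n))" by simp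
  have "(\<Sum>k\<le>n. catalan_real k * catalan_real (n - k)) = (\<Sum>k\<le>n. (1/4) * (-4) ^ Suc (Suc n) * (?q (Suc k) * ?q (Suc (n - k))))"
  proof (rule sum.cong)
    fix k assume k: "k \<in> {..n}"
    then have *: "(-4::real) ^ Suc k * (-4) ^ Suc (n - k) = (-4) ^ Suc (Suc n)"
      unfolding power_add[symmetric] by simp
    show "catalan_real k * catalan_real (n - k) = (1/4) * (-4) ^ Suc (Suc n) * (?q (Suc k) * ?q (Suc (n - k)))"
    proof -
      have "- (1/2) * P * Q * (- (1/2) * P' * Q') = (1/4) * (P * P') * (Q * Q')" for P Q P' Q' :: real by simp
      then show ?thesis using *[symmetric] unfolding catalan_real_def by (simp only:)
    qed
  qed simp
  also have "\<dots> = (1/4) * (-4) ^ Suc (Suc n) * (- 2 * ?q (Suc (Suc n)))"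
    unfolding sum_distrib_left[symmetric] q ..
  also have "\<dots> = catalan_real (Suc n)"
  proof -
    have "(1/4) * P * (- 2 * Q) = - (1/2) * P * Q" for P Q :: real by simp
    then show ?thesis unfolding catalan_real_def .
  qed
  finally show ?thesis .
qed

definition sc_moment :: "nat \<Rightarrow> real" where
  "sc_moment p = (if even p then catalan_real (p div 2) else 0)"

lemma sc_moment_Suc_Suc: "(real p + 4) * sc_moment (p + 2) = 4 * (real p + 1) * sc_moment p"
proof (cases "even p")
  case True
  then obtain k where "p = 2 * k" by auto
  then show ?thesis using catalan_real_Suc[of k] by (simp add: sc_moment_def)
qed (simp add: sc_moment_def)

text \<open>The Volterra equation on the level of Taylor coefficients. For even \<open>p\<close>
  only even \<open>k\<close> contribute, which leaves the Catalan convolution.\<close>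

lemma sc_moment_convolution: "(\<Sum>k\<le>p. sc_moment k * sc_moment (p - k)) = sc_moment (p + 2)"
proof (cases "even p")
  case True
  then obtain n where p: "p = 2 * n" by auto
  have "(\<Sum>k\<le>p. sc_moment k * sc_moment (p - k)) = (\<Sum>k\<in>(\<lambda>j. 2 * j) ` {..n}. sc_moment k * sc_moment (p - k))"
  proof (rule sum.mono_neutral_right)
    show "\<forall>k\<in>{..p} - (\<lambda>j. 2 * j) ` {..n}. sc_moment k * sc_moment (p - k) = 0"
    proof
      fix k assume k: "k \<in> {..p} - (\<lambda>j. 2 * j) ` {..n}"
      have "odd k"
      proof
        assume "even k"
        then obtain j where "k = 2 * j" by auto
        then show False using k p by auto
      qed
      then show "sc_moment k * sc_moment (p - k) = 0" by (simp add: sc_moment_def)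
    qed
  qed (auto simp: p)
  also have "\<dots> = (\<Sum>j\<le>n. catalan_real j * catalan_real (n - j))"
    by (subst sum.reindex) (auto simp: inj_on_def sc_moment_def p diff_mult_distrib2[symmetric] intro!: sum.cong)
  also have "\<dots> = sc_moment (p + 2)"
    unfolding catalan_real_convolution by (simp add: sc_moment_def p)
  finally show ?thesis .
next
  case False
  have "sc_moment k * sc_moment (p - k) = 0" if "k \<le> p" for k
    using that False by (auto simp: sc_moment_def)
  then have "(\<Sum>k\<le>p. sc_moment k * sc_moment (p - k)) = 0" by (intro sum.neutral) auto
  then show ?thesis using False by (simp add: sc_moment_def)
qed

text \<open>The function \<open>x ^ (p + 1) * (4 - x^2) powr (3/2)\<close> vanishes at both ends,
  and its derivative relates the moments of orders \<open>p\<close> and \<open>p + 2\<close> by the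
  recursion of \<open>sc_moment\<close>. Orders 0 and 1 have explicit primitives. The square root is
  not differentiable at the endpoints, hence the form of the fundamental theorem that asks for
  derivatives only in the interior.\<close>

lemma has_integral_semicircle_moment:
  "((\<lambda>x. x ^ p * sqrt (4 - x\<^sup>2)) has_integral 2 * pi * sc_moment p) {-2..2::real}"
proof -
  have int: "(\<lambda>x. x ^ p * sqrt (4 - x\<^sup>2)) integrable_on {-2..2::real}" for p
    by (intro integrable_continuous_interval continuous_intros)
  have pos: "4 - x\<^sup>2 > 0" if "x \<in> {-2<..<2}" for x :: real
  proof -
    have "(2 - x) * (2 + x) > 0" using that by (intro mult_pos_pos) auto
    then show ?thesis by (simp add: algebra_simps power2_eq_square)
  qed
  have ds: "((\<lambda>x. sqrt (4 - x\<^sup>2)) has_real_derivative - x / sqrt (4 - x\<^sup>2)) (at x)" if "x \<in> {-2<..<2}" for x :: real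
    using pos[OF that] by (auto intro!: derivative_eq_intros simp: field_simps)
  have d3: "((\<lambda>x. (4 - x\<^sup>2) * sqrt (4 - x\<^sup>2)) has_real_derivative - 3 * x * sqrt (4 - x\<^sup>2)) (at x)" if "x \<in> {-2<..<2}" for x :: real
  proof -
    have "((\<lambda>x. (4 - x\<^sup>2) * sqrt (4 - x\<^sup>2)) has_real_derivative (- 2 * x) * sqrt (4 - x\<^sup>2) + (- x / sqrt (4 - x\<^sup>2)) * (4 - x\<^sup>2)) (at x)"
      by (rule DERIV_mult[OF _ ds[OF that]]) (auto intro!: derivative_eq_intros)
    moreover have "(- x / sqrt (4 - x\<^sup>2)) * (4 - x\<^sup>2) = - x * sqrt (4 - x\<^sup>2)"
    proof -
      have "(- x / r) * (r * r) = - x * r" if "r > 0" for r :: real using that by simp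
      from this[of "sqrt (4 - x\<^sup>2)"] pos[OF that] show ?thesis
        by (simp only: real_sqrt_gt_zero real_sqrt_mult_self abs_of_pos simp_thms)
    qed
    ultimately show ?thesis by (simp add: algebra_simps)
  qed
  have rec: "(real p + 4) * integral {-2..2} (\<lambda>x. x ^ (p + 2) * sqrt (4 - x\<^sup>2)) = 4 * (real p + 1) * integral {-2..2::real} (\<lambda>x. x ^ p * sqrt (4 - x\<^sup>2))" for p
  proof -
    let ?F = "\<lambda>x::real. x ^ Suc p * ((4 - x\<^sup>2) * sqrt (4 - x\<^sup>2))"
    let ?f = "\<lambda>x::real. 4 * (real p + 1) * (x ^ p * sqrt (4 - x\<^sup>2)) - (real p + 4) * (x ^ (p + 2) * sqrt (4 - x\<^sup>2))"
    have "(?f has_integral (?F 2 - ?F (-2))) {-2..2}"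
    proof (rule fundamental_theorem_of_calculus_interior)
      show "continuous_on {-2..2} ?F" by (intro continuous_intros)
      fix x :: real assume x: "x \<in> {-2<..<2}"
      have "(?F has_real_derivative (real (Suc p) * x ^ p) * ((4 - x\<^sup>2) * sqrt (4 - x\<^sup>2)) + (- 3 * x * sqrt (4 - x\<^sup>2)) * x ^ Suc p) (at x)"
        by (rule DERIV_mult[OF _ d3[OF x]]) (use DERIV_pow[of "Suc p" x] in simp)
      moreover have "(real (Suc p) * x ^ p) * ((4 - x\<^sup>2) * sqrt (4 - x\<^sup>2)) + (- 3 * x * sqrt (4 - x\<^sup>2)) * x ^ Suc p = ?f x"
        by (simp add: algebra_simps power2_eq_square)
      ultimately show "(?F has_vector_derivative ?f x) (at x)"
        by (simp add: has_real_derivative_iff_has_vector_derivative)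
    qed simp
    then have "integral {-2..2} ?f = 0" by (simp add: integral_unique)
    moreover have "integral {-2..2} ?f = 4 * (real p + 1) * integral {-2..2} (\<lambda>x. x ^ p * sqrt (4 - x\<^sup>2)) - (real p + 4) * integral {-2..2} (\<lambda>x. x ^ (p + 2) * sqrt (4 - x\<^sup>2))"
      by (subst integral_diff) (auto intro!: integrable_on_cmult_left int simp: integral_mult_right simp del: power_Suc)
    ultimately show ?thesis by simp
  qed
  have "integral {-2..2} (\<lambda>x. x ^ p * sqrt (4 - x\<^sup>2)) = 2 * pi * sc_moment p"
  proof (induction p rule: nat_less_induct)
    case (1 p)
    consider "p = 0" | "p = 1" | q where "p = q + 2" by (metis One_nat_def add_2_eq_Suc' not0_implies_Suc)
    then show ?case
    proof cases
      case 1
      let ?F = "\<lambda>x::real. x * sqrt (4 - x\<^sup>2) / 2 + 2 * arcsin (x / 2)"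
      have "((\<lambda>x. sqrt (4 - x\<^sup>2)) has_integral (?F 2 - ?F (-2))) {-2..2}"
      proof (rule fundamental_theorem_of_calculus_interior)
        show "continuous_on {-2..2} ?F" by (intro continuous_intros) auto
        fix x :: real assume x: "x \<in> {-2<..<2}"
        define s where "s = sqrt (4 - x\<^sup>2)"
        have s: "s > 0" "s * s = 4 - x\<^sup>2" using pos[OF x] by (auto simp: s_def)
        have s2: "sqrt (1 - (x / 2)\<^sup>2) = s / 2"
          unfolding s_def by (rule real_sqrt_unique) (use pos[OF x] in \<open>auto simp: power_divide field_simps\<close>)
        have "((\<lambda>x. arcsin (x / 2)) has_real_derivative inverse (sqrt (1 - (x / 2)\<^sup>2)) * (1/2)) (at x)"
          by (rule DERIV_chain2[where f=arcsin], rule DERIV_arcsin) (use x in \<open>auto intro!: derivative_eq_intros\<close>)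
        moreover have "((\<lambda>x. x * sqrt (4 - x\<^sup>2)) has_real_derivative 1 * sqrt (4 - x\<^sup>2) + (- x / sqrt (4 - x\<^sup>2)) * x) (at x)"
          by (rule DERIV_mult[OF DERIV_ident ds[OF x]])
        ultimately have "(?F has_real_derivative (1 * s + (- x / s) * x) / 2 + 2 * (inverse (s / 2) * (1/2))) (at x)"
          unfolding s2 s_def[symmetric] by (intro DERIV_add DERIV_cdivide DERIV_cmult) (simp_all add: s_def)
        moreover have "(1 * s + (- x / s) * x) / 2 + 2 * (inverse (s / 2) * (1/2)) = s"
        proof -
          have "(1 * s + (- x / s) * x) / 2 + 2 * (inverse (s / 2) * (1/2)) = (s * s - x\<^sup>2 + 4) / (2 * s)"
            using s(1) by (simp add: field_simps power2_eq_square)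
          also have "s * s - x\<^sup>2 + 4 = 2 * (s * s)" using s(2) by simp
          finally show ?thesis using s(1) by simp
        qed
        ultimately show "(?F has_vector_derivative sqrt (4 - x\<^sup>2)) (at x)"
          by (simp add: has_real_derivative_iff_has_vector_derivative s_def)
      qed simp
      then show ?thesis using 1 by (simp add: integral_unique sc_moment_def catalan_real_0)
    next
      case 2
      let ?F = "\<lambda>x::real. (4 - x\<^sup>2) * sqrt (4 - x\<^sup>2) / (-3)"
      have "((\<lambda>x. x * sqrt (4 - x\<^sup>2)) has_integral (?F 2 - ?F (-2))) {-2..2}"
      proof (rule fundamental_theorem_of_calculus_interior)
        show "continuous_on {-2..2} ?F" by (intro continuous_intros) auto
        fix x :: real assume x: "x \<in> {-2<..<2}"
        show "(?F has_vector_derivative x * sqrt (4 - x\<^sup>2)) (at x)"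
          using DERIV_cdivide[OF d3[OF x], of "-3"]
          by (simp add: has_real_derivative_iff_has_vector_derivative)
      qed simp
      then show ?thesis using 2 by (simp add: integral_unique sc_moment_def)
    next
      case (3 q)
      have "(real q + 4) * integral {-2..2} (\<lambda>x. x ^ p * sqrt (4 - x\<^sup>2)) = (real q + 4) * (2 * pi * sc_moment p)"
        using rec[of q] 1[rule_format, of q] sc_moment_Suc_Suc[of q] 3 by simp
      then show ?thesis by simp
    qed
  qed
  then show ?thesis using int by (metis has_integral_iff)
qed

section \<open>The characteristic function of the semicircle law\<close>

text \<open>Open and closed interval agree because the square root vanishes at the endpoints; the
  closed form fits the integrals over \<open>{-2..2}\<close>.\<close>

lemma semicircle_density_eq:
  "indicator {-2<..<2} x * sqrt (4 - x\<^sup>2) / (2 * pi) = indicator {-2..2} x * (sqrt (4 - x\<^sup>2) / (2 * pi))" for x :: real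
proof (cases "x = 2 \<or> x = -2")
  case True
  then show ?thesis by auto
next
  case False
  then show ?thesis by (auto simp: indicator_def)
qed

lemma semicircle_density_nonneg:
  "0 \<le> indicator {-2<..<2} x * sqrt (4 - x\<^sup>2) / (2 * pi)" for x :: real
proof (cases "x \<in> {-2<..<2}")
  case True
  then have "0 \<le> (2 - x) * (2 + x)" by (intro mult_nonneg_nonneg) auto
  then show ?thesis using True by (simp add: algebra_simps power2_eq_square)
qed simp

lemma real_distribution_semicircle: "real_distribution semicircle"
proof -
  have hi: "((\<lambda>x. sqrt (4 - x\<^sup>2) / (2 * pi)) has_integral 1) {-2..2::real}"
    using has_integral_divide[OF has_integral_semicircle_moment[of 0], of "2 * pi"]
    by (simp add: sc_moment_def catalan_real_0)
  have nn: "0 \<le> sqrt (4 - x\<^sup>2) / (2 * pi)" if "x \<in> {-2..2}" for x :: real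
  proof -
    have "0 \<le> (2 - x) * (2 + x)" using that by (intro mult_nonneg_nonneg) auto
    then show ?thesis by (simp add: algebra_simps power2_eq_square)
  qed
  have "emeasure semicircle (space semicircle) = (\<integral>\<^sup>+x. ennreal (indicator {-2..2} x * (sqrt (4 - x\<^sup>2) / (2 * pi))) \<partial>lborel)"
    unfolding semicircle_def semicircle_density_eq by (simp add: emeasure_density)
  also have "\<dots> = 1" using nn_integral_has_integral_lebesgue[OF nn hi] by simp
  finally have "prob_space semicircle" by (rule prob_spaceI)
  moreover have "sets semicircle = sets borel" by (simp add: semicircle_def)
  ultimately show ?thesis by (simp add: real_distribution_def real_distribution_axioms_def)
qed

interpretation semicircle: real_distribution semicircle
  by (rule real_distribution_semicircle)

lemma AE_semicircle_bounded: "AE x in semicircle. \<bar>x\<bar> \<le> 2"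
proof -
  have m: "(\<lambda>x. ennreal (indicator {-2<..<2} x * sqrt (4 - x\<^sup>2) / (2 * pi))) \<in> borel_measurable lborel"
    by measurable
  show ?thesis unfolding semicircle_def AE_density[OF m]
    by (rule AE_I2) (auto simp: indicator_def split: if_splits)
qed

lemma integrable_semicircle_power: "integrable semicircle (\<lambda>x. x ^ k)"
proof (rule semicircle.integrable_const_bound)
  show "AE x in semicircle. norm (x ^ k) \<le> 2 ^ k"
    using AE_semicircle_bounded by eventually_elim (auto simp: power_abs intro!: power_mono)
qed simp

lemma expectation_semicircle_power: "semicircle.expectation (\<lambda>x. x ^ p) = sc_moment p"
proof -
  let ?f = "\<lambda>x::real. x ^ p * sqrt (4 - x\<^sup>2) / (2 * pi)"
  have "semicircle.expectation (\<lambda>x. x ^ p) = integral\<^sup>L lborel (\<lambda>x. (indicator {-2<..<2} x * sqrt (4 - x\<^sup>2) / (2 * pi)) *\<^sub>R x ^ p)"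
    unfolding semicircle_def
    by (rule Bochner_Integration.integral_density) (use semicircle_density_nonneg in \<open>auto simp: mult.assoc\<close>)
  also have "\<dots> = (LINT x:{-2..2}|lborel. ?f x)"
    unfolding set_lebesgue_integral_def semicircle_density_eq
    by (intro Bochner_Integration.integral_cong) (auto simp: mult_ac)
  also have "\<dots> = integral {-2..2} ?f"
    by (intro set_borel_integral_eq_integral borel_integrable_atLeastAtMost' continuous_intros) auto
  also have "\<dots> = sc_moment p"
    by (rule integral_unique) (use has_integral_divide[OF has_integral_semicircle_moment[of p], of "2 * pi"] in simp)
  finally show ?thesis .
qed

lemma expectation_semicircle_abs_power: "semicircle.expectation (\<lambda>x. \<bar>x\<bar> ^ p) \<le> 2 ^ p"
proof -
  have "semicircle.expectation (\<lambda>x. \<bar>x\<bar> ^ p) \<le> semicircle.expectation (\<lambda>x. 2 ^ p)"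
  proof (rule integral_mono_AE)
    show "integrable semicircle (\<lambda>x. \<bar>x\<bar> ^ p)"
      using integrable_abs[OF integrable_semicircle_power[of p]] by (simp add: power_abs)
    show "AE x in semicircle. \<bar>x\<bar> ^ p \<le> 2 ^ p"
      using AE_semicircle_bounded by eventually_elim (auto intro!: power_mono)
  qed simp
  then show ?thesis using semicircle.prob_space by simp
qed

lemma abs_sc_moment_le: "\<bar>sc_moment p\<bar> \<le> 2 ^ p"
proof -
  have "\<bar>sc_moment p\<bar> \<le> semicircle.expectation (\<lambda>x. \<bar>x ^ p\<bar>)"
    unfolding expectation_semicircle_power[symmetric] by (rule integral_abs_bound)
  then show ?thesis using expectation_semicircle_abs_power[of p] by (simp add: power_abs)
qed

definition sc_coeff :: "nat \<Rightarrow> complex" where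
  "sc_coeff p = \<i> ^ p * of_real (sc_moment p) / fact p"

lemma norm_sc_coeff_le: "norm (sc_coeff p * z ^ p) \<le> (2 * norm z) ^ p / fact p"
proof -
  have "norm (sc_coeff p * z ^ p) = \<bar>sc_moment p\<bar> * norm z ^ p / fact p"
    by (simp add: sc_coeff_def norm_mult norm_power norm_divide)
  also have "\<dots> \<le> 2 ^ p * norm z ^ p / fact p"
    by (intro divide_right_mono mult_right_mono abs_sc_moment_le) auto
  finally show ?thesis by (simp add: power_mult_distrib)
qed

lemma summable_power_over_fact: "summable (\<lambda>p. x ^ p / fact p :: real)"
  using summable_exp[of x] by (simp add: field_simps)

lemma summable_norm_sc_coeff: "summable (\<lambda>p. norm (sc_coeff p * z ^ p))"
proof (rule summable_comparison_test'[OF summable_power_over_fact[of "2 * norm z"]])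
  show "norm (norm (sc_coeff p * z ^ p)) \<le> (2 * norm z) ^ p / fact p" if "p \<ge> 0" for p
    unfolding real_norm_def abs_norm_cancel by (rule norm_sc_coeff_le)
qed

text \<open>Support in [-2,2] bounds the Taylor remainder by twice
  \<open>(2 * |t|) ^ n / n!\<close>, so the moment series represents the characteristic function for
  every \<open>t\<close>.\<close>

lemma char_semicircle_sums: "(\<lambda>p. sc_coeff p * of_real t ^ p) sums char semicircle t"
proof -
  let ?S = "\<lambda>n. \<Sum>k\<le>n. sc_coeff k * of_real t ^ k"
  have bd: "norm (?S n - char semicircle t) \<le> 2 * ((2 * \<bar>t\<bar>) ^ n / fact n)" for n
  proof -
    have e: "?S n = (\<Sum>k\<le>n. ((\<i> * t) ^ k / fact k) * semicircle.expectation (\<lambda>x. x ^ k))"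
      unfolding expectation_semicircle_power
      by (intro sum.cong refl) (simp add: sc_coeff_def power_mult_distrib)
    have "norm (?S n - char semicircle t) = cmod (char semicircle t - (\<Sum>k\<le>n. ((\<i> * t) ^ k / fact k) * semicircle.expectation (\<lambda>x. x ^ k)))"
      unfolding e by (rule norm_minus_commute)
    also have "\<dots> \<le> (2 * \<bar>t\<bar> ^ n / fact n) * semicircle.expectation (\<lambda>x. \<bar>x\<bar> ^ n)"
      by (rule semicircle.char_approx1) (rule integrable_semicircle_power)
    also have "\<dots> \<le> (2 * \<bar>t\<bar> ^ n / fact n) * 2 ^ n"
      by (intro mult_left_mono expectation_semicircle_abs_power) auto
    finally show ?thesis by (simp add: power_mult_distrib mult_ac)
  qed
  have lim: "(\<lambda>n. 2 * ((2 * \<bar>t\<bar>) ^ n / fact n)) \<longlonglongrightarrow> 0"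
    using tendsto_mult_left[OF summable_LIMSEQ_zero[OF summable_power_over_fact[of "2 * \<bar>t\<bar>"]], of 2] by simp
  have "(\<lambda>n. ?S n - char semicircle t) \<longlonglongrightarrow> 0"
    by (rule Lim_null_comparison[OF always_eventually[OF allI[OF bd]] lim])
  then show ?thesis unfolding sums_def_le by (rule LIM_zero_cancel)
qed

lemma char_semicircle_eq: "char semicircle t = (\<Sum>p. sc_coeff p * of_real t ^ p)"
  using char_semicircle_sums by (rule sums_unique)

definition char_semicircle_deriv :: "real \<Rightarrow> complex" where
  "char_semicircle_deriv t = (\<Sum>p. diffs sc_coeff p * of_real t ^ p)"

text \<open>The series is differentiated termwise as an entire function of a complex variable and
  then restricted to the real line.\<close>

lemma has_vector_derivative_char_semicircle:
  "(char semicircle has_vector_derivative char_semicircle_deriv t) (at t)"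
proof -
  have "((\<lambda>z. \<Sum>p. sc_coeff p * z ^ p) has_field_derivative char_semicircle_deriv t) (at (of_real t))"
    unfolding char_semicircle_deriv_def
    by (rule termdiffs_strong_converges_everywhere) (rule summable_norm_cancel[OF summable_norm_sc_coeff])
  from has_vector_derivative_real_field[OF this, of UNIV]
  show ?thesis unfolding char_semicircle_eq[symmetric] by simp
qed

text \<open>Multiply the two power series, integrate each Cauchy block by the Beta integral and sum
  the moments with \<open>sc_moment_convolution\<close>. Block \<open>p\<close> becomes the term of
  degree \<open>p + 1\<close> of the derivative series, up to the sign from
  \<open>\<i> ^ 2 = -1\<close>.\<close>

lemma char_semicircle_volterra:
  assumes t: "t \<ge> 0"
  shows "((\<lambda>v. char semicircle v * char semicircle (t - v)) has_integral - char_semicircle_deriv t) {0..t}"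
proof -
  define e where "e p v = (\<Sum>k\<le>p. (sc_coeff k * of_real v ^ k) * (sc_coeff (p - k) * of_real (t - v) ^ (p - k)))" for p and v :: real
  \<comment> \<open>A majorant on the whole interval, the Cauchy product of the series of
    \<open>exp (2 * t)\<close> with itself; the resulting uniform convergence permits termwise
    integration.\<close>
  define M where "M p = (\<Sum>k\<le>p. ((2 * t) ^ k / fact k) * ((2 * t) ^ (p - k) / fact (p - k)))" for p
  have sums_e: "(\<lambda>p. e p v) sums (char semicircle v * char semicircle (t - v))" for v
    unfolding e_def char_semicircle_eq
    by (rule Cauchy_product_sums) (use summable_norm_sc_coeff in \<open>auto simp del: norm_mult norm_power\<close>)
  have "summable M"
    unfolding M_def
    using Cauchy_product_sums[of "\<lambda>k. (2 * t) ^ k / fact k" "\<lambda>k. (2 * t) ^ k / fact k"]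
      summable_power_over_fact[of "2 * t"] t by (auto simp: sums_iff)
  moreover have "norm (e p v) \<le> M p" if "v \<in> {0..t}" for p v
    unfolding e_def M_def
  proof (intro order.trans[OF norm_sum] sum_mono)
    fix k
    have b: "norm (sc_coeff q * of_real u ^ q) \<le> (2 * t) ^ q / fact q" if "0 \<le> u" "u \<le> t" for q and u :: real
      using norm_sc_coeff_le[of q "of_real u"] that
      by (elim order.trans) (auto intro!: divide_right_mono power_mono)
    show "norm ((sc_coeff k * of_real v ^ k) * (sc_coeff (p - k) * of_real (t - v) ^ (p - k)))
      \<le> ((2 * t) ^ k / fact k) * ((2 * t) ^ (p - k) / fact (p - k))"
      unfolding norm_mult[of "sc_coeff k * of_real v ^ k"]
      using that t by (intro mult_mono b) auto
  qed
  ultimately have ul: "uniform_limit {0..t} (\<lambda>n v. \<Sum>p<n. e p v) (\<lambda>v. \<Sum>p. e p v) sequentially"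
    by (intro Weierstrass_m_test_ev[where M=M]) auto
  have ce: "continuous_on {0..t} (e p)" for p
    unfolding e_def by (intro continuous_intros)
  define q where "q p = \<i> ^ p * of_real (sc_moment (p + 2) * (t ^ (p + 1) / fact (p + 1)))" for p
  have ie: "(e p has_integral q p) {0..t}" for p
  proof -
    let ?f = "\<lambda>v::real. \<Sum>k\<le>p. (\<i> ^ p * of_real (sc_moment k * sc_moment (p - k))) * of_real (v ^ k / fact k * ((t - v) ^ (p - k) / fact (p - k)))"
    let ?I = "\<Sum>k\<le>p. (\<i> ^ p * of_real (sc_moment k * sc_moment (p - k))) * of_real (t ^ (k + (p - k) + 1) / fact (k + (p - k) + 1)) :: complex"
    have "((\<lambda>v. ?f v)
       has_integral ?I) {0..t}"
      by (intro has_integral_sum has_integral_mult_right has_integral_of_real has_integral_power_convolution t) auto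
    also have "(\<lambda>v. ?f v) = e p"
    proof
      fix v
      show "(?f v) = e p v"
        unfolding e_def
      proof (rule sum.cong)
        fix k assume "k \<in> {..p}"
        then have "\<i> ^ p = \<i> ^ k * \<i> ^ (p - k)" by (simp add: power_add[symmetric])
        then show "(\<i> ^ p * of_real (sc_moment k * sc_moment (p - k))) * of_real (v ^ k / fact k * ((t - v) ^ (p - k) / fact (p - k)))
           = (sc_coeff k * of_real v ^ k) * (sc_coeff (p - k) * of_real (t - v) ^ (p - k))"
          by (simp add: sc_coeff_def)
      qed simp
    qed
    also have "?I
       = (\<Sum>k\<le>p. (\<i> ^ p * of_real (t ^ (p + 1) / fact (p + 1))) * of_real (sc_moment k * sc_moment (p - k)))"
      by (intro sum.cong) (auto simp: mult_ac)
    also have "\<dots> = q p"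
      unfolding sum_distrib_left[symmetric] of_real_sum[symmetric] sc_moment_convolution q_def
      by (simp add: mult_ac)
    finally show ?thesis .
  qed
  obtain I J where IJ: "\<And>n. ((\<lambda>v. \<Sum>p<n. e p v) has_integral I n) {0..t}"
      "((\<lambda>v. \<Sum>p. e p v) has_integral J) {0..t}" "I \<longlonglongrightarrow> J"
    by (rule uniform_limit_integral[OF ul]) (auto intro!: continuous_intros ce)
  have "I = (\<lambda>n. \<Sum>p<n. q p)"
    by (rule ext, rule has_integral_unique[OF IJ(1)]) (intro has_integral_sum ie, simp)
  then have "q sums J" using IJ(3) by (simp add: sums_def)
  moreover have "q sums - char_semicircle_deriv t"
  proof -
    have "(\<lambda>p. diffs sc_coeff p * of_real t ^ p) sums char_semicircle_deriv t"
      unfolding char_semicircle_deriv_def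
      by (intro summable_sums termdiff_converges_all summable_norm_cancel[OF summable_norm_sc_coeff])
    \<comment> \<open>The constant term is a multiple of the first moment, which is 0, so the
      derivative series may start at degree 1.\<close>
    moreover have "diffs sc_coeff 0 * of_real t ^ 0 = 0"
      by (simp add: diffs_def sc_coeff_def sc_moment_def)
    ultimately have "(\<lambda>p. diffs sc_coeff (Suc p) * of_real t ^ Suc p) sums char_semicircle_deriv t"
      using sums_Suc_iff[of "\<lambda>p. diffs sc_coeff p * of_real t ^ p" "char_semicircle_deriv t"] by simp
    moreover have "diffs sc_coeff (Suc p) * of_real t ^ Suc p = - q p" for p
    proof -
      have "diffs sc_coeff (Suc p) = \<i> ^ (p + 2) * of_real (sc_moment (p + 2)) / fact (p + 1)"
        by (simp add: diffs_def sc_coeff_def fact_Suc[of "Suc p"] del: fact_Suc of_nat_Suc power_Suc)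
      then show ?thesis by (simp add: q_def power_add)
    qed
    ultimately have "(\<lambda>p. - q p) sums char_semicircle_deriv t" by simp
    from sums_minus[OF this] show ?thesis by simp
  qed
  ultimately have "J = - char_semicircle_deriv t" by (rule sums_unique2)
  then show ?thesis using IJ(2) sums_e by (simp add: sums_iff)
qed

lemma isCont_cdf_semicircle: "isCont (cdf semicircle) x"
proof -
  have "emeasure semicircle {x} = 0"
    unfolding semicircle_def
    by (subst emeasure_density) (auto simp: nn_integral_0_iff_AE intro!: AE_I[of _ _ "{x}"] split: split_indicator)
  then show ?thesis
    by (simp add: finite_borel_measure.isCont_cdf[OF semicircle.finite_borel_measure_M] measure_def)
qed

section \<open>Almost sure convergence\<close>

lemma sets_spectral_measure [simp, measurable_cong]: "sets (spectral_measure n w x) = sets borel"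
  and space_spectral_measure [simp]: "space (spectral_measure n w x) = UNIV"
  using sets.sets_measure_of_eq[of "borel :: real measure"] sets.space_measure_of_eq[of "borel :: real measure"]
  by (simp_all add: spectral_measure_def)

text \<open>\<open>measure_of\<close> yields the zero measure for a set function that is not
  countably additive, so additivity has to be established before any value can be read off.\<close>

lemma emeasure_spectral_measure:
  assumes "S \<in> sets borel"
  shows "emeasure (spectral_measure n w x) S = (\<Sum>i<n. ennreal (w i) * indicator S (x i))"
  unfolding spectral_measure_def
proof (rule emeasure_measure_of_sigma)
  show "sigma_algebra UNIV (sets (borel :: real measure))"
    using sets.sigma_algebra_axioms[of "borel :: real measure"] by simp
  show "positive (sets borel) (\<lambda>A. \<Sum>i<n. ennreal (w i) * indicator A (x i))"
    by (simp add: positive_def)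
  show "countably_additive (sets borel) (\<lambda>A. \<Sum>i<n. ennreal (w i) * indicator A (x i))"
  proof (rule countably_additiveI)
    fix F :: "nat \<Rightarrow> real set" assume "disjoint_family F"
    then show "(\<Sum>k. \<Sum>i<n. ennreal (w i) * indicator (F k) (x i)) = (\<Sum>i<n. ennreal (w i) * indicator (\<Union>(range F)) (x i))"
      by (subst suminf_sum) (auto simp: ennreal_suminf_cmult suminf_indicator)
  qed
qed (rule assms)

lemma cdf_spectral_measure:
  assumes "\<And>i. i < n \<Longrightarrow> 0 \<le> w i"
  shows "cdf (spectral_measure n w x) q = (\<Sum>i<n. w i * indicator {..q} (x i))"
proof -
  have "emeasure (spectral_measure n w x) {..q} = (\<Sum>i<n. ennreal (w i * indicator {..q} (x i)))"
    by (subst emeasure_spectral_measure) (simp, intro sum.cong refl, simp split: split_indicator)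
  also have "\<dots> = ennreal (\<Sum>i<n. w i * indicator {..q} (x i))"
    by (rule sum_ennreal) (use assms in auto)
  finally have e: "emeasure (spectral_measure n w x) {..q} = ennreal (\<Sum>i<n. w i * indicator {..q} (x i))" .
  show ?thesis
    unfolding cdf_def measure_def e by (rule enn2real_ennreal) (use assms in \<open>auto intro!: sum_nonneg\<close>)
qed

text \<open>As a push-forward of the uniform measure on indices, the empirical measure is seen to be
  a probability measure, with an average over indices as its characteristic function.\<close>

lemma empirical_measure_eq_distr:
  assumes "n \<ge> 1"
  shows "empirical_measure n x = distr (uniform_count_measure {..<n}) borel x"
proof (rule measure_eqI)
  fix S assume "S \<in> sets (empirical_measure n x)"
  then have S: "S \<in> sets borel" by (simp add: empirical_measure_def)
  have "emeasure (empirical_measure n x) S = (\<Sum>i<n. ennreal (1 / real n) * indicator S (x i))"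
    unfolding empirical_measure_def by (rule emeasure_spectral_measure[OF S])
  also have "\<dots> = (\<Sum>i<n. if i \<in> x -` S then ennreal (1 / real n) else 0)"
    by (intro sum.cong) (auto simp: indicator_def)
  also have "\<dots> = (\<Sum>i\<in>x -` S \<inter> {..<n}. ennreal (1 / real n))"
    by (subst Int_commute) (simp only: sum.inter_restrict finite_lessThan)
  also have "\<dots> = ennreal (card (x -` S \<inter> {..<n}) / card {..<n})"
    by (simp add: ennreal_of_nat_eq_real_of_nat ennreal_mult'[symmetric])
  also have "\<dots> = emeasure (distr (uniform_count_measure {..<n}) borel x) S"
    using S by (subst emeasure_distr) (auto simp: emeasure_uniform_count_measure space_uniform_count_measure)
  finally show "emeasure (empirical_measure n x) S = emeasure (distr (uniform_count_measure {..<n}) borel x) S" .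
qed (simp add: empirical_measure_def)

lemma real_distribution_empirical:
  assumes "n \<ge> 1"
  shows "real_distribution (empirical_measure n x)"
proof -
  interpret prob_space "uniform_count_measure {..<n}"
    using assms by (intro prob_space_uniform_count_measure) (auto simp: lessThan_empty_iff)
  show ?thesis unfolding empirical_measure_eq_distr[OF assms] by (rule real_distribution_distr) simp
qed

lemma char_empirical:
  assumes "n \<ge> 1"
  shows "char (empirical_measure n x) t = ecf n x t"
proof -
  have "char (empirical_measure n x) t = (CLINT j|uniform_count_measure {..<n}. iexp (t * x j))"
    unfolding char_def empirical_measure_eq_distr[OF assms] by (rule integral_distr) auto
  also have "\<dots> = (\<Sum>j<n. (1 / real n) *\<^sub>R iexp (t * x j))"
    unfolding uniform_count_measure_def by (subst lebesgue_integral_point_measure_finite) auto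
  also have "\<dots> = ecf n x t"
    unfolding scaleR_sum_right[symmetric] ecf_def by (simp add: scaleR_conv_of_real)
  finally show ?thesis .
qed

lemma char_uminus_cnj: "char \<mu> (- t) = cnj (char \<mu> t)"
proof -
  have "iexp (- t * x) = cnj (iexp (t * x))" for x by (simp add: exp_cnj)
  then have "char \<mu> (- t) = (CLINT x|\<mu>. cnj (iexp (t * x)))" unfolding char_def by (simp only:)
  also have "\<dots> = cnj (char \<mu> t)" unfolding char_def by (rule Bochner_Integration.integral_cnj)
  finally show ?thesis .
qed

text \<open>Monotonicity squeezes the value at \<open>x\<close> between those at two rational
  neighbours where \<open>G\<close> is close to \<open>G x\<close>.\<close>

lemma tendsto_at_continuity_point_of_rational:
  fixes F :: "nat \<Rightarrow> real \<Rightarrow> real"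
  assumes mono: "\<And>n. n \<ge> 1 \<Longrightarrow> mono (F n)" and c: "isCont G x"
    and q: "\<And>q. q \<in> \<rat> \<Longrightarrow> (\<lambda>n. F n q) \<longlonglongrightarrow> G q"
  shows "(\<lambda>n. F n x) \<longlonglongrightarrow> G x"
proof (rule tendstoI)
  fix e :: real assume e: "e > 0"
  obtain d where d: "d > 0" "\<And>y. \<bar>y - x\<bar> < d \<Longrightarrow> \<bar>G y - G x\<bar> < e / 2"
    using c[unfolded continuous_at_eps_delta, rule_format, of "e / 2"] e by (auto simp: dist_real_def)
  obtain p where p: "p \<in> \<rat>" "x - d < p" "p < x" using Rats_dense_in_real[of "x - d" x] d by auto
  obtain r where r: "r \<in> \<rat>" "x < r" "r < x + d" using Rats_dense_in_real[of x "x + d"] d by auto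
  have Gp: "\<bar>G p - G x\<bar> < e / 2" "\<bar>G r - G x\<bar> < e / 2" using d p r by auto
  have e2: "e / 2 > 0" using e by simp
  show "\<forall>\<^sub>F n in sequentially. dist (F n x) (G x) < e"
    using tendstoD[OF q[OF p(1)] e2] tendstoD[OF q[OF r(1)] e2] eventually_ge_at_top[of 1]
  proof eventually_elim
    case (elim n)
    have "F n p \<le> F n x" "F n x \<le> F n r" using monoD[OF mono[OF elim(3)]] p r by auto
    then show ?case using elim(1,2) Gp unfolding dist_real_def by linarith
  qed
qed

section \<open>Asymptotics of the rescaling parameters\<close>

locale jacobi_scaling =
  fixes \<beta> \<sigma> :: real and a b :: "nat \<Rightarrow> real"
  assumes \<beta>: "\<beta> > 0" and \<sigma>: "\<sigma> > 0" and b_pos: "\<And>n. b n > 0" and a_pos: "\<And>n. a n > 0"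
    and a_n: "filterlim (\<lambda>n. a n / real n) at_top sequentially"
    and a_b: "(\<lambda>n. a n / b n) \<longlonglongrightarrow> \<sigma>"
    and center: "(\<lambda>n. sqrt (b n / real n) * (\<sigma> - a n / b n)) \<longlonglongrightarrow> 0"
begin

text \<open>The equilibrium of the limiting potential: \<open>A * (1 - c) = B * c\<close> when
  \<open>A / B = \<sigma>\<close>.\<close>

definition c where "c = \<sigma> / (\<sigma> + 1)"
definition e where "e n = \<beta> / 2 * (real n - 1) + 1"
definition A where "A n = a n - e n"
definition B where "B n = b n - e n"
definition s where "s n = (\<sigma> + 1) * sqrt (b n * (1 + \<sigma>) / (\<sigma> * real n * (\<beta> / 2)))"
text \<open>With \<open>x = s * (l - c)\<close> one has
  \<open>A * (1 - l) - B * l = s * n * (\<delta> - \<kappa> * x)\<close>: \<open>\<kappa>\<close> is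
  the strength of the quadratic confinement and \<open>\<delta>\<close> the residual drift.\<close>

definition \<kappa> where "\<kappa> n = (A n + B n) / ((s n)\<^sup>2 * real n)"
definition \<delta> where "\<delta> n = (A n * (1 - c) - B n * c) / (s n * real n)"
text \<open>The error coefficient of \<open>loop_defect_le\<close> at
  \<open>\<epsilon> = 1 / sqrt n\<close> and \<open>u = 2 * ln n\<close>.\<close>

definition \<eta> where "\<eta> L n = 2 * (1 / sqrt (real n)) * ((1 + \<beta>) * (L + 2)\<^sup>2 + 2 * \<kappa> n)
       + 2 * ln (real n) / (1 / sqrt (real n) * (real n)\<^sup>2) + (1 + \<beta>) * (L + 2) / real n
       + \<beta> * (L + 2) / s n + 2 * \<bar>\<delta> n\<bar> + 2 * \<bar>\<kappa> n - \<beta> / 2 * (c * (1 - c))\<bar>"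

lemma c_range: "0 < c" "c < 1" using \<sigma> by (auto simp: c_def)

lemma b_n: "filterlim (\<lambda>n. b n / real n) at_top sequentially"
proof -
  have "filterlim (\<lambda>n. inverse (a n / b n) * (a n / real n)) at_top sequentially"
    by (rule filterlim_tendsto_pos_mult_at_top[OF tendsto_inverse[OF a_b]]) (use \<sigma> a_n in auto)
  moreover have "(\<lambda>n. inverse (a n / b n) * (a n / real n)) = (\<lambda>n. b n / real n)"
    using a_pos by (auto simp: fun_eq_iff less_imp_neq[symmetric] dest: less_imp_neq)
  ultimately show ?thesis by (simp only:)
qed

lemma n_b: "(\<lambda>n. real n / b n) \<longlonglongrightarrow> 0"
  using tendsto_inverse_0_at_top[OF b_n] by simp

lemma inv_n: "(\<lambda>n. 1 / real n) \<longlonglongrightarrow> 0"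
  using tendsto_inverse_0_at_top[OF filterlim_real_sequentially] by (simp add: inverse_eq_divide)

lemma e_n: "(\<lambda>n. e n / real n) \<longlonglongrightarrow> \<beta> / 2"
proof (rule Lim_transform_eventually)
  have "(\<lambda>n. \<beta> / 2 + (1 - \<beta> / 2) * (1 / real n)) \<longlonglongrightarrow> \<beta> / 2 + (1 - \<beta> / 2) * 0"
    by (intro tendsto_intros inv_n)
  then show "(\<lambda>n. \<beta> / 2 + (1 - \<beta> / 2) * (1 / real n)) \<longlonglongrightarrow> \<beta> / 2" by simp
  show "\<forall>\<^sub>F n in sequentially. \<beta> / 2 + (1 - \<beta> / 2) * (1 / real n) = e n / real n"
    using eventually_gt_at_top[of 0] by eventually_elim (simp add: e_def field_simps)
qed

lemma e_b: "(\<lambda>n. e n / b n) \<longlonglongrightarrow> 0"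
proof (rule Lim_transform_eventually)
  show "(\<lambda>n. (e n / real n) * (real n / b n)) \<longlonglongrightarrow> 0"
    using tendsto_mult[OF e_n n_b] by simp
  show "\<forall>\<^sub>F n in sequentially. (e n / real n) * (real n / b n) = e n / b n"
    using eventually_gt_at_top[of 0] by eventually_elim simp
qed

definition K where "K = (\<sigma> + 1) * sqrt ((1 + \<sigma>) / (\<sigma> * (\<beta> / 2)))"

lemma K_pos: "K > 0" using \<sigma> \<beta> by (simp add: K_def)

lemma s_eq: "s n = K * sqrt (b n / real n)"
proof -
  have "b n * (1 + \<sigma>) / (\<sigma> * real n * (\<beta> / 2)) = ((1 + \<sigma>) / (\<sigma> * (\<beta> / 2))) * (b n / real n)"
    by (simp add: mult_ac)
  then show ?thesis unfolding s_def K_def by (simp only: real_sqrt_mult mult.assoc)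
qed

lemma s_at_top: "filterlim s at_top sequentially"
proof -
  have "filterlim (\<lambda>n. sqrt (b n / real n)) at_top sequentially"
    by (rule filterlim_compose[OF sqrt_at_top b_n])
  from filterlim_tendsto_pos_mult_at_top[OF tendsto_const K_pos this]
  show ?thesis unfolding s_eq[abs_def] .
qed

lemma inv_s: "(\<lambda>n. 1 / s n) \<longlonglongrightarrow> 0"
  using tendsto_inverse_0_at_top[OF s_at_top] by (simp add: inverse_eq_divide)

text \<open>The prefactor of the rescaling is made for this limit. It equals the coefficient of the
  interaction in the loop equation, which normalises the limiting semicircle to variance 1. The
  shift \<open>e n\<close> disappears because \<open>e n / b n\<close> tends to 0.\<close>

lemma \<kappa>_lim: "\<kappa> \<longlonglongrightarrow> \<beta> / 2 * (c * (1 - c))"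
proof (rule Lim_transform_eventually)
  have "(\<lambda>n. (a n / b n + 1 - 2 * (e n / b n)) / K\<^sup>2) \<longlonglongrightarrow> (\<sigma> + 1 - 2 * 0) / K\<^sup>2"
    using K_pos by (intro tendsto_intros a_b e_b) auto
  moreover have "(\<sigma> + 1 - 2 * 0) / K\<^sup>2 = \<beta> / 2 * (c * (1 - c))"
  proof -
    have "K\<^sup>2 = (\<sigma> + 1)\<^sup>2 * ((1 + \<sigma>) / (\<sigma> * (\<beta> / 2)))"
      using \<sigma> \<beta> by (simp add: K_def power_mult_distrib)
    moreover have "1 - c = 1 / (\<sigma> + 1)" using \<sigma> by (simp add: c_def field_simps)
    moreover have "p / (p\<^sup>2 * (p / (\<sigma> * (\<beta> / 2)))) = \<beta> / 2 * (\<sigma> / p * (1 / p))" if "p > 0" for p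
      using that \<sigma> \<beta> by (simp add: power2_eq_square mult_ac)
    from this[of "\<sigma> + 1"] have "(\<sigma> + 1) / ((\<sigma> + 1)\<^sup>2 * ((1 + \<sigma>) / (\<sigma> * (\<beta> / 2)))) = \<beta> / 2 * (\<sigma> / (\<sigma> + 1) * (1 / (\<sigma> + 1)))"
      using \<sigma> by (simp add: add.commute)
    ultimately show ?thesis by (simp add: c_def)
  qed
  ultimately show "(\<lambda>n. (a n / b n + 1 - 2 * (e n / b n)) / K\<^sup>2) \<longlonglongrightarrow> \<beta> / 2 * (c * (1 - c))" by (simp only:)
  show "\<forall>\<^sub>F n in sequentially. (a n / b n + 1 - 2 * (e n / b n)) / K\<^sup>2 = \<kappa> n"
    using eventually_gt_at_top[of 0]
  proof eventually_elim
    case (elim n)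
    have "(s n)\<^sup>2 * real n = K\<^sup>2 * b n"
      using elim b_pos[of n] by (simp add: s_eq power_mult_distrib)
    moreover have "A n + B n = b n * (a n / b n + 1 - 2 * (e n / b n))"
      using b_pos[of n] by (simp add: A_def B_def field_simps)
    ultimately show ?case using b_pos[of n] unfolding \<kappa>_def by simp
  qed
qed

text \<open>Centring at the limiting equilibrium costs a drift proportional to
  \<open>sqrt (b n / n) * (\<sigma> - a n / b n)\<close>, which is what \<open>center\<close>
  controls. The contribution of \<open>e n\<close> is negligible, since \<open>e n\<close> is of
  order \<open>n\<close> while it is divided by \<open>s n * n\<close> and \<open>s n\<close>
  diverges.\<close>

lemma \<delta>_lim: "\<delta> \<longlonglongrightarrow> 0"
proof (rule Lim_transform_eventually)
  let ?X = "\<lambda>n. sqrt (b n / real n) * (\<sigma> - a n / b n)"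
  have "(\<lambda>n. (- (?X n) / K - (1 - \<sigma>) * ((e n / real n) * (1 / s n))) / (1 + \<sigma>)) \<longlonglongrightarrow> (- 0 / K - (1 - \<sigma>) * (\<beta> / 2 * 0)) / (1 + \<sigma>)"
    using K_pos \<sigma> by (intro tendsto_intros center e_n inv_s) auto
  then show "(\<lambda>n. (- (?X n) / K - (1 - \<sigma>) * ((e n / real n) * (1 / s n))) / (1 + \<sigma>)) \<longlonglongrightarrow> 0" by simp
  show "\<forall>\<^sub>F n in sequentially. (- (?X n) / K - (1 - \<sigma>) * ((e n / real n) * (1 / s n))) / (1 + \<sigma>) = \<delta> n"
    using eventually_gt_at_top[of 0]
  proof eventually_elim
    case (elim n)
    define r where "r = sqrt (b n / real n)"
    have r: "r > 0" "b n = r * r * real n" using elim b_pos[of n] by (auto simp: r_def)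
    have sn: "s n = K * r" by (simp add: s_eq r_def)
    have "1 - c = 1 / (1 + \<sigma>)" using \<sigma> by (simp add: c_def field_simps)
    then have "A n * (1 - c) - B n * c = (A n - \<sigma> * B n) / (1 + \<sigma>)"
      by (simp add: c_def diff_divide_distrib add.commute)
    also have "A n - \<sigma> * B n = - (b n * (\<sigma> - a n / b n)) - (1 - \<sigma>) * e n"
      using b_pos[of n] by (simp add: A_def B_def algebra_simps)
    finally have "\<delta> n = (- (b n * (\<sigma> - a n / b n)) - (1 - \<sigma>) * e n) / (1 + \<sigma>) / (s n * real n)"
      by (simp add: \<delta>_def)
    also have "\<dots> = (- (b n * (\<sigma> - a n / b n)) / (s n * real n) - (1 - \<sigma>) * e n / (s n * real n)) / (1 + \<sigma>)"
      by (simp add: diff_divide_distrib mult.commute)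
    also have "- (b n * (\<sigma> - a n / b n)) / (s n * real n) = - (r * (\<sigma> - a n / b n)) / K"
    proof -
      have "- (b n * y) / (s n * real n) = - (r * y) / K" for y
        unfolding sn using r elim K_pos by simp
      then show ?thesis .
    qed
    finally show ?case by (simp add: r_def)
  qed
qed

lemma ln_sqrt: "(\<lambda>n. ln (real n) / sqrt (real n)) \<longlonglongrightarrow> 0"
  using lim_ln_over_power[of "1/2"] by (simp add: powr_half_sqrt)

lemma inv_sqrt: "(\<lambda>n. 1 / sqrt (real n)) \<longlonglongrightarrow> 0"
  using tendsto_inverse_0_at_top[OF filterlim_compose[OF sqrt_at_top filterlim_real_sequentially]]
  by (simp add: inverse_eq_divide)

lemma \<eta>_lim: "\<eta> L \<longlonglongrightarrow> 0"
proof -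
  have l: "(\<lambda>n. 2 * ln (real n) / (1 / sqrt (real n) * (real n)\<^sup>2)) \<longlonglongrightarrow> 0"
  proof (rule Lim_transform_eventually)
    have "(\<lambda>n. 2 * ((ln (real n) / sqrt (real n)) * (1 / real n))) \<longlonglongrightarrow> 2 * (0 * 0)"
      by (intro tendsto_intros ln_sqrt inv_n)
    then show "(\<lambda>n. 2 * ((ln (real n) / sqrt (real n)) * (1 / real n))) \<longlonglongrightarrow> 0" by simp
    show "\<forall>\<^sub>F n in sequentially. 2 * ((ln (real n) / sqrt (real n)) * (1 / real n)) = 2 * ln (real n) / (1 / sqrt (real n) * (real n)\<^sup>2)"
      using eventually_gt_at_top[of 0]
    proof eventually_elim
      case (elim n)
      define r where "r = sqrt (real n)"
      have "r > 0" "real n = r * r" using elim by (auto simp: r_def)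
      then show ?case unfolding r_def[symmetric] by (simp add: power2_eq_square)
    qed
  qed
  have "\<eta> L \<longlonglongrightarrow> 2 * 0 * ((1 + \<beta>) * (L + 2)\<^sup>2 + 2 * (\<beta> / 2 * (c * (1 - c)))) + 0
       + (1 + \<beta>) * (L + 2) * 0 + \<beta> * (L + 2) * 0 + 2 * \<bar>0\<bar> + 2 * \<bar>\<beta> / 2 * (c * (1 - c)) - \<beta> / 2 * (c * (1 - c))\<bar>"
    unfolding \<eta>_def[abs_def] divide_inverse[of "(1 + \<beta>) * (L + 2)"] divide_inverse[of "\<beta> * (L + 2)"]
    by (intro tendsto_intros inv_sqrt \<kappa>_lim \<delta>_lim l inv_n[unfolded inverse_eq_divide[symmetric]] inv_s[unfolded inverse_eq_divide[symmetric]])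
  then show ?thesis by simp
qed

text \<open>The exponents \<open>A n\<close> and \<open>B n\<close> can be negative for small
  \<open>n\<close>, whereas the perturbation bounds raise inequalities to these powers. Eventually
  \<open>e n <= (\<beta> / 2 + 1) * n\<close>, and \<open>a n / n\<close> and \<open>b n / n\<close>
  exceed that constant.\<close>

lemma eventually_params:
  "\<forall>\<^sub>F n in sequentially. n \<ge> 1 \<and> s n \<ge> 1 \<and> A n \<ge> 0 \<and> B n \<ge> 0 \<and> 1 / sqrt (real n) * (L + 2) \<le> 1/2"
proof -
  have "\<forall>\<^sub>F n in sequentially. 1 \<le> s n" using s_at_top by (simp add: filterlim_at_top)
  moreover have "\<forall>\<^sub>F n in sequentially. \<beta> / 2 + 1 \<le> a n / real n" using a_n by (simp add: filterlim_at_top)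
  moreover have "\<forall>\<^sub>F n in sequentially. \<beta> / 2 + 1 \<le> b n / real n" using b_n by (simp add: filterlim_at_top)
  moreover have "\<forall>\<^sub>F n in sequentially. 1 / sqrt (real n) * (L + 2) < 1/2"
    using tendsto_mult_right[OF inv_sqrt, of "L + 2"] by (intro order_tendstoD) auto
  ultimately show ?thesis using eventually_ge_at_top[of 1]
  proof eventually_elim
    case (elim n)
    have n: "real n \<ge> 1" using elim by simp
    have "e n = \<beta> / 2 * real n - \<beta> / 2 + 1" by (simp add: e_def right_diff_distrib)
    then have "e n \<le> (\<beta> / 2 + 1) * real n" using n \<beta> unfolding distrib_right by linarith
    moreover have "(\<beta> / 2 + 1) * real n \<le> a n" "(\<beta> / 2 + 1) * real n \<le> b n"
      using elim n by (simp_all add: pos_le_divide_eq)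
    ultimately show ?case using elim by (simp add: A_def B_def)
  qed
qed

end

section \<open>Almost sure limits along the whole sequence\<close>

locale jacobi_sequence = jacobi_scaling \<beta> \<sigma> a b + prob_space M
  for \<beta> \<sigma> :: real and a b :: "nat \<Rightarrow> real" and M :: "'w measure" +
  fixes lam w :: "nat \<Rightarrow> 'w \<Rightarrow> nat \<Rightarrow> real"
  assumes sample: "\<And>n. n \<ge> 1 \<Longrightarrow> jacobi_sample M n \<beta> (a n) (b n) (lam n) (w n)"
begin

definition x where "x n \<omega> i = s n * (lam n \<omega> i - c)"

lemma AE_sample:
  "AE \<omega> in M. \<forall>n\<ge>1. (\<forall>i<n. 0 < lam n \<omega> i \<and> lam n \<omega> i < 1) \<and> (\<forall>i<n. w n \<omega> i > 0) \<and> (\<Sum>i<n. w n \<omega> i) = 1"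
  unfolding AE_all_countable
proof (intro allI)
  fix n
  show "AE \<omega> in M. n \<ge> 1 \<longrightarrow> (\<forall>i<n. 0 < lam n \<omega> i \<and> lam n \<omega> i < 1) \<and> (\<forall>i<n. w n \<omega> i > 0) \<and> (\<Sum>i<n. w n \<omega> i) = 1"
  proof (cases "n \<ge> 1")
    case True
    interpret S: jacobi_sample M n \<beta> "a n" "b n" "lam n" "w n" by (rule sample[OF True])
    show ?thesis using S.AE_lam_range S.AE_w_simplex by eventually_elim auto
  qed simp
qed

lemma AE_loop_defect_le:
  assumes t: "loop_test L g g'"
  shows "AE \<omega> in M. \<forall>\<^sub>F n in sequentially.
     \<beta> / 2 * (c * (1 - c)) * \<bar>loop_defect n g g' (x n \<omega>)\<bar> \<le> \<eta> L n * (1 + mean_square n (x n \<omega>))"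
proof -
  let ?G = "\<lambda>n. scaled_test (s n) c g" and ?k' = "\<lambda>n. scaled_deriv (s n) c g g'"
  define \<epsilon> where "\<epsilon> n = 1 / sqrt (real n)" for n
  obtain n0 where n0: "\<And>n. n \<ge> n0 \<Longrightarrow> n \<ge> 1 \<and> s n \<ge> 1 \<and> A n \<ge> 0 \<and> B n \<ge> 0 \<and> \<epsilon> n * (L + 2) \<le> 1/2"
    using eventually_params[of L] unfolding eventually_sequentially \<epsilon>_def by blast
  let ?bad = "\<lambda>z n. {\<omega> \<in> space M. 2 * ln (real n) \<le>
      loop_exponent n \<beta> (A n) (B n) (L + 2) (z * \<epsilon> n) (?G n) (?k' n) (lam n \<omega>)}"
  have dev: "AE \<omega> in M. \<forall>\<^sub>F n in sequentially. \<omega> \<notin> ?bad z n"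
    if z: "z = 1 \<or> z = -1" for z
  proof (rule AE_eventually_not_in[where m=n0])
    fix n assume n: "n \<ge> n0"
    interpret S: jacobi_sample M n \<beta> "a n" "b n" "lam n" "w n" using n0[OF n] by (intro sample) simp
    have lp: "loop_perturbation \<beta> (A n) (B n) (L + 2) (z * \<epsilon> n) (?G n) (?k' n)"
      using n0[OF n] z by (intro loop_perturbation_scaled t c_range \<beta>) (auto simp: \<epsilon>_def)
    have AB: "A n = a n - (\<beta> / 2 * (real n - 1) + 1)" "B n = b n - (\<beta> / 2 * (real n - 1) + 1)"
      by (simp_all add: A_def B_def e_def)
    show "?bad z n \<in> events"
      by (rule S.prob_loop_ge(1)[OF lp AB])
    show "prob (?bad z n) \<le> exp (- (2 * ln (real n)))"
      by (rule S.prob_loop_ge(2)[OF lp AB])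
  qed
  have d1: "1 = (1::real) \<or> 1 = (-1::real)" and d2: "-1 = (1::real) \<or> -1 = (-1::real)" by simp_all
  show ?thesis using dev[OF d1] dev[OF d2] AE_sample AE_space
  proof eventually_elim
    case (elim \<omega>)
    from elim(1,2) eventually_ge_at_top[of n0] show ?case
    proof eventually_elim
      case (elim n)
      note n0 = n0[OF elim(3)]
      have n: "n \<ge> 1" and s1: "s n \<ge> 1" and AB: "A n \<ge> 0" "B n \<ge> 0" using n0 by auto
      have e: "\<epsilon> n > 0" using n by (simp add: \<epsilon>_def)
      let ?T = "loop_lin n \<beta> (A n) (B n) (?G n) (?k' n) (lam n \<omega>)"
      let ?Q = "loop_quad n \<beta> (A n) (B n) (L + 2) (?G n) (lam n \<omega>)"
      have "\<epsilon> n * ?T - 2 * (\<epsilon> n)\<^sup>2 * ?Q < 2 * ln (real n)" "- \<epsilon> n * ?T - 2 * (\<epsilon> n)\<^sup>2 * ?Q < 2 * ln (real n)"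
        using elim(1,2) \<open>\<omega> \<in> space M\<close> by auto
      then have "\<epsilon> n * \<bar>?T\<bar> \<le> 2 * (\<epsilon> n)\<^sup>2 * ?Q + 2 * ln (real n)"
        using e by (cases "?T \<ge> 0") auto
      then have "\<bar>?T\<bar> \<le> (2 * (\<epsilon> n)\<^sup>2 * ?Q + 2 * ln (real n)) / \<epsilon> n"
        using e by (simp add: pos_le_divide_eq mult.commute)
      also have "\<dots> = 2 * \<epsilon> n * ?Q + 2 * ln (real n) / \<epsilon> n"
        using e by (simp add: add_divide_distrib power2_eq_square)
      finally have T: "\<bar>?T\<bar> \<le> 2 * \<epsilon> n * ?Q + 2 * ln (real n) / \<epsilon> n" .
      have u: "2 * ln (real n) \<ge> 0" using n by simp
      show ?case
        unfolding \<eta>_def \<epsilon>_def[symmetric]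
      proof (rule loop_defect_le[OF t n s1 c_range \<beta> AB e u _ _ \<kappa>_def \<delta>_def T])
        show "0 < lam n \<omega> i \<and> lam n \<omega> i < 1" if "i < n" for i
          using \<open>\<forall>n\<ge>1. (\<forall>i<n. 0 < lam n \<omega> i \<and> lam n \<omega> i < 1) \<and> (\<forall>i<n. w n \<omega> i > 0) \<and> (\<Sum>i<n. w n \<omega> i) = 1\<close> n that by blast
      qed (simp add: x_def)
    qed
  qed
qed

lemma k0_pos: "\<beta> / 2 * (c * (1 - c)) > 0"
  using \<beta> c_range by simp

text \<open>For \<open>g = x\<close> every divided difference is 1, so the defect is
  \<open>1 - S\<close> with \<open>S\<close> the second moment. Once \<open>\<eta> 1 n\<close> is
  below half of the constant \<open>?k\<close>, the inequality reads
  \<open>S - 1 <= (1 + S) / 2\<close>, that is \<open>S <= 3\<close>.\<close>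

lemma AE_mean_square_le: "AE \<omega> in M. \<forall>\<^sub>F n in sequentially. mean_square n (x n \<omega>) \<le> 3"
proof -
  have "loop_test 1 (\<lambda>x. x) (\<lambda>_. 1)" by (simp add: loop_test_def)
  from AE_loop_defect_le[OF this] show ?thesis
  proof eventually_elim
    case (elim \<omega>)
    let ?k = "\<beta> / 2 * (c * (1 - c))"
    have "\<forall>\<^sub>F n in sequentially. \<eta> 1 n < ?k / 2"
      using \<eta>_lim[of 1] k0_pos by (intro order_tendstoD) auto
    with elim eventually_gt_at_top[of 0] show ?case
    proof eventually_elim
      case (elim n)
      let ?S = "mean_square n (x n \<omega>)"
      have S0: "?S \<ge> 0" by (simp add: mean_square_def sum_nonneg)
      have "divided_difference (\<lambda>x. x) (\<lambda>_. 1) y z = 1" for y z by (simp add: divided_difference_def)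
      then have "loop_defect n (\<lambda>x. x) (\<lambda>_. 1) (x n \<omega>) = 1 - ?S"
        using elim(2) by (simp add: loop_defect_def mean_square_def power2_eq_square)
      then have "?k * (?S - 1) \<le> ?k * \<bar>loop_defect n (\<lambda>x. x) (\<lambda>_. 1) (x n \<omega>)\<bar>"
        using k0_pos by (intro mult_left_mono) auto
      also have "\<dots> \<le> \<eta> 1 n * (1 + ?S)" by (rule elim(1))
      also have "\<dots> \<le> ?k / 2 * (1 + ?S)" using elim(3) S0 by (intro mult_right_mono) auto
      finally have "?k * (?S - 1) \<le> ?k * ((1 + ?S) / 2)" by simp
      then have "?S - 1 \<le> (1 + ?S) / 2" using k0_pos by (rule mult_left_le_imp_le)
      then show ?case by simp
    qed
  qed
qed

lemma AE_loop_defect_tendsto: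
  assumes t: "loop_test L g g'"
  shows "AE \<omega> in M. (\<lambda>n. loop_defect n g g' (x n \<omega>)) \<longlonglongrightarrow> 0"
  using AE_loop_defect_le[OF t] AE_mean_square_le
proof eventually_elim
  case (elim \<omega>)
  let ?k = "\<beta> / 2 * (c * (1 - c))"
  \<comment> \<open>The 4 is \<open>1 + 3\<close>, from the bound 3 on the second moment.\<close>
  have "(\<lambda>n. \<bar>\<eta> L n\<bar> * 4 / ?k) \<longlonglongrightarrow> \<bar>0\<bar> * 4 / ?k"
    using k0_pos by (intro tendsto_intros \<eta>_lim) auto
  then have lim: "(\<lambda>n. \<bar>\<eta> L n\<bar> * 4 / ?k) \<longlonglongrightarrow> 0" by (simp only: abs_zero mult_zero_left div_0)
  have "\<forall>\<^sub>F n in sequentially. norm (loop_defect n g g' (x n \<omega>)) \<le> \<bar>\<eta> L n\<bar> * 4 / ?k"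
    using elim
  proof eventually_elim
    case (elim n)
    let ?S = "mean_square n (x n \<omega>)"
    have S0: "?S \<ge> 0" by (simp add: mean_square_def sum_nonneg)
    have "?k * \<bar>loop_defect n g g' (x n \<omega>)\<bar> \<le> \<eta> L n * (1 + ?S)" by (rule elim(1))
    also have "\<dots> \<le> \<bar>\<eta> L n\<bar> * 4" using elim(2) S0 by (intro mult_mono) auto
    finally show ?case using k0_pos unfolding real_norm_def
      by (subst pos_le_divide_eq) (simp_all only: mult.commute)
  qed
  then show ?case using lim by (rule Lim_null_comparison)
qed

lemma loop_test_trig:
  assumes "t \<ge> 0"
  shows "loop_test t (\<lambda>x. cos (t * x)) (\<lambda>x. - t * sin (t * x))" "loop_test t (\<lambda>x. sin (t * x)) (\<lambda>x. t * cos (t * x))"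
proof -
  have "\<bar>t * sin (t * x)\<bar> \<le> t * 1" "\<bar>t * cos (t * x)\<bar> \<le> t * 1" for x
    unfolding abs_mult using assms by (intro mult_mono; simp)+
  moreover have "\<bar>cos (t * x)\<bar> \<le> 1 + \<bar>x\<bar>" "\<bar>sin (t * x)\<bar> \<le> 1 + \<bar>x\<bar>" for x
    using abs_cos_le_one[of "t * x"] abs_sin_le_one[of "t * x"] by linarith+
  ultimately show "loop_test t (\<lambda>x. cos (t * x)) (\<lambda>x. - t * sin (t * x))" "loop_test t (\<lambda>x. sin (t * x)) (\<lambda>x. t * cos (t * x))"
    using assms unfolding loop_test_def by (auto intro!: derivative_eq_intros continuous_intros)
qed

lemma AE_empirical:
  "AE \<omega> in M. weak_conv_m (\<lambda>n. empirical_measure n (x n \<omega>)) semicircle"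
proof -
  have cnt: "countable {t::real. t \<in> \<rat> \<and> 0 \<le> t}" by (rule countable_subset[OF _ countable_rat]) auto
  have "AE \<omega> in M. \<forall>t\<in>{t\<in>\<rat>. 0 \<le> t}. (\<lambda>n. cos_defect n t (x n \<omega>)) \<longlonglongrightarrow> 0"
    unfolding AE_ball_countable[OF cnt] using AE_loop_defect_tendsto[OF loop_test_trig(1)] by blast
  moreover have "AE \<omega> in M. \<forall>t\<in>{t\<in>\<rat>. 0 \<le> t}. (\<lambda>n. sin_defect n t (x n \<omega>)) \<longlonglongrightarrow> 0"
    unfolding AE_ball_countable[OF cnt] using AE_loop_defect_tendsto[OF loop_test_trig(2)] by blast
  ultimately show ?thesis using AE_mean_square_le
  proof eventually_elim
    case (elim \<omega>)
    have pos: "(\<lambda>n. ecf n (x n \<omega>) t) \<longlonglongrightarrow> char semicircle t" if "t \<ge> 0" for t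
    proof (rule ecf_tendsto[OF elim(3) _ _ has_vector_derivative_char_semicircle semicircle.cmod_char_le_1 semicircle.char_zero _ that])
      show "char_semicircle_deriv t + volterra_conv (char semicircle) t = 0" if "0 \<le> t" for t
        unfolding integral_unique[OF char_semicircle_volterra[OF that]] by simp
    qed (use elim in auto)
    \<comment> \<open>The sequence starts at \<open>Suc n\<close> because the empirical measure of
      no points is not a probability measure. Negative times follow by complex conjugation, the
      Volterra equation being solved on the positive half-line only.\<close>
    have lim: "(\<lambda>n. char (empirical_measure (Suc n) (x (Suc n) \<omega>)) t) \<longlonglongrightarrow> char semicircle t" for t
    proof (cases "t \<ge> 0")
      case True
      then show ?thesis using LIMSEQ_Suc[OF pos[of t]] by (simp add: char_empirical)
    next
      case False
      have "(\<lambda>n. char (empirical_measure (Suc n) (x (Suc n) \<omega>)) (- t)) \<longlonglongrightarrow> char semicircle (- t)"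
        using LIMSEQ_Suc[OF pos[of "- t"]] False by (simp add: char_empirical)
      from tendsto_cnj[OF this] show ?thesis by (simp add: char_uminus_cnj)
    qed
    have "weak_conv_m (\<lambda>n. empirical_measure (Suc n) (x (Suc n) \<omega>)) semicircle"
      by (rule levy_continuity[OF real_distribution_empirical real_distribution_semicircle lim]) simp
    then show ?case
      unfolding weak_conv_m_def weak_conv_def
      by (subst filterlim_sequentially_Suc[symmetric])
  qed
qed

text \<open>\<open>F\<close> may vary with \<open>n\<close> because a fixed function of the rescaled
  eigenvalue depends on \<open>n\<close> as a function of the original one. The choice
  \<open>\<theta> = 1 / sqrt n\<close> balances the two terms of the threshold up to a logarithm,
  and \<open>u = 2 * ln n\<close> gives summability.\<close>

lemma AE_weights_deviation:
  fixes F :: "nat \<Rightarrow> real \<Rightarrow> real"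
  assumes F [measurable]: "\<And>n. F n \<in> borel_measurable borel" and F01: "\<And>n y. 0 \<le> F n y \<and> F n y \<le> 1"
  shows "AE \<omega> in M. \<forall>\<^sub>F n in sequentially. (\<Sum>i<n. F n (lam n \<omega> i)) / real n - (\<Sum>i<n. w n \<omega> i * F n (lam n \<omega> i))
     < 1 / sqrt (real n) + 2 * ln (real n) / (real n * (\<beta> / 2) * (1 / sqrt (real n)))"
proof -
  let ?bad = "\<lambda>n. {\<omega> \<in> space M. (\<Sum>i<n. F n (lam n \<omega> i)) / real n - (\<Sum>i<n. w n \<omega> i * F n (lam n \<omega> i))
      \<ge> 1 / sqrt (real n) + 2 * ln (real n) / (real n * (\<beta> / 2) * (1 / sqrt (real n)))}"
  have "AE \<omega> in M. \<forall>\<^sub>F n in sequentially. \<omega> \<notin> ?bad n"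
  proof (rule AE_eventually_not_in[where m=1])
    fix n :: nat assume n: "n \<ge> 1"
    interpret S: jacobi_sample M n \<beta> "a n" "b n" "lam n" "w n" by (rule sample[OF n])
    have th: "0 < 1 / sqrt (real n)" "1 / sqrt (real n) \<le> 1" using n by auto
    show "?bad n \<in> events"
      by (rule S.prob_weights_deviation(1)[OF F F01 th])
    show "prob (?bad n) \<le> exp (- (2 * ln (real n)))"
      by (rule S.prob_weights_deviation(2)[OF F F01 th])
  qed
  then show ?thesis using AE_space
  proof eventually_elim
    case (elim \<omega>)
    from elim(1) show ?case by eventually_elim (use elim(2) in auto)
  qed
qed

text \<open>The deviation bound is one-sided; applied to \<open>1 - F\<close> it gives the other
  side, since both the Dirichlet weights and the uniform weights sum to 1.\<close>

lemma AE_weights_cdf: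
  "AE \<omega> in M. (\<lambda>n. (\<Sum>i<n. w n \<omega> i * indicator {..q} (x n \<omega> i)) - (\<Sum>i<n. indicator {..q} (x n \<omega> i)) / real n) \<longlonglongrightarrow> 0"
proof -
  define F where "F n l = indicat_real {..q} (s n * (l - c))" for n l
  have [measurable]: "F n \<in> borel_measurable borel" for n unfolding F_def by measurable
  define \<tau> where "\<tau> n = 1 / sqrt (real n) + 2 * ln (real n) / (real n * (\<beta> / 2) * (1 / sqrt (real n)))" for n
  have \<tau>: "\<tau> \<longlonglongrightarrow> 0"
  proof (rule Lim_transform_eventually)
    have "(\<lambda>n. 1 / sqrt (real n) + 4 / \<beta> * (ln (real n) / sqrt (real n))) \<longlonglongrightarrow> 0 + 4 / \<beta> * 0"
      by (intro tendsto_intros inv_sqrt ln_sqrt)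
    then show "(\<lambda>n. 1 / sqrt (real n) + 4 / \<beta> * (ln (real n) / sqrt (real n))) \<longlonglongrightarrow> 0" by simp
    show "\<forall>\<^sub>F n in sequentially. 1 / sqrt (real n) + 4 / \<beta> * (ln (real n) / sqrt (real n)) = \<tau> n"
      using eventually_gt_at_top[of 0]
    proof eventually_elim
      case (elim n)
      define r where "r = sqrt (real n)"
      have "r > 0" "real n = r * r" using elim by (auto simp: r_def)
      then show ?case unfolding \<tau>_def r_def[symmetric] using \<beta> by (simp add: field_simps)
    qed
  qed
  have "AE \<omega> in M. \<forall>\<^sub>F n in sequentially. (\<Sum>i<n. F n (lam n \<omega> i)) / real n - (\<Sum>i<n. w n \<omega> i * F n (lam n \<omega> i)) < \<tau> n"
    unfolding \<tau>_def by (rule AE_weights_deviation) (auto simp: F_def indicator_def)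
  moreover have "AE \<omega> in M. \<forall>\<^sub>F n in sequentially. (\<Sum>i<n. 1 - F n (lam n \<omega> i)) / real n - (\<Sum>i<n. w n \<omega> i * (1 - F n (lam n \<omega> i))) < \<tau> n"
    unfolding \<tau>_def by (rule AE_weights_deviation) (auto simp: F_def indicator_def)
  ultimately show ?thesis using AE_sample
  proof eventually_elim
    case (elim \<omega>)
    note simplex = elim(3)
    have "\<forall>\<^sub>F n in sequentially. norm ((\<Sum>i<n. w n \<omega> i * F n (lam n \<omega> i)) - (\<Sum>i<n. F n (lam n \<omega> i)) / real n) \<le> \<tau> n"
      using elim(1,2) eventually_ge_at_top[of 1]
    proof eventually_elim
      case (elim n)
      have "(\<Sum>i<n. 1 - F n (lam n \<omega> i)) / real n = 1 - (\<Sum>i<n. F n (lam n \<omega> i)) / real n"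
        using elim(3) by (simp add: sum_subtractf diff_divide_distrib)
      moreover have "(\<Sum>i<n. w n \<omega> i * (1 - F n (lam n \<omega> i))) = 1 - (\<Sum>i<n. w n \<omega> i * F n (lam n \<omega> i))"
        using simplex elim(3) by (simp add: right_diff_distrib sum_subtractf)
      ultimately show ?case using elim(1,2) by (simp add: abs_le_iff)
    qed
    from Lim_null_comparison[OF this \<tau>] show ?case by (simp add: F_def x_def)
  qed
qed

lemma AE_spectral:
  "AE \<omega> in M. weak_conv_m (\<lambda>n. spectral_measure n (w n \<omega>) (x n \<omega>)) semicircle"
proof -
  have "AE \<omega> in M. \<forall>q\<in>\<rat>. (\<lambda>n. (\<Sum>i<n. w n \<omega> i * indicator {..q} (x n \<omega> i)) - (\<Sum>i<n. indicator {..q} (x n \<omega> i)) / real n) \<longlonglongrightarrow> 0"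
    unfolding AE_ball_countable[OF countable_rat] by (intro ballI AE_weights_cdf)
  then show ?thesis using AE_empirical AE_sample
  proof eventually_elim
    case (elim \<omega>)
    define F where "F n q = (\<Sum>i<n. w n \<omega> i * indicator {..q} (x n \<omega> i))" for n q
    have cdf_w: "cdf (spectral_measure n (w n \<omega>) (x n \<omega>)) q = F n q" if "n \<ge> 1" for n q
      unfolding F_def by (rule cdf_spectral_measure) (use elim(3) that in \<open>auto simp: less_imp_le\<close>)
    have cdf_e: "cdf (empirical_measure n (x n \<omega>)) q = (\<Sum>i<n. indicator {..q} (x n \<omega> i)) / real n" for n q
      unfolding empirical_measure_def by (subst cdf_spectral_measure) (auto simp: sum_divide_distrib)
    have "(\<lambda>n. F n y) \<longlonglongrightarrow> cdf semicircle y" for y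
    proof (rule tendsto_at_continuity_point_of_rational[OF _ isCont_cdf_semicircle])
      show "mono (F n)" if "n \<ge> 1" for n
        unfolding F_def using elim(3) that
        by (intro monoI sum_mono mult_left_mono) (auto simp: indicator_def less_imp_le)
      fix q :: real assume q: "q \<in> \<rat>"
      \<comment> \<open>The semicircle law has no atoms, so weak convergence of the empirical
        measures applies at every \<open>q\<close>.\<close>
      have "(\<lambda>n. (\<Sum>i<n. indicator {..q} (x n \<omega> i)) / real n) \<longlonglongrightarrow> cdf semicircle q"
        using elim(2) isCont_cdf_semicircle unfolding weak_conv_m_def weak_conv_def cdf_e by blast
      from tendsto_add[OF bspec[OF elim(1) q] this]
      show "(\<lambda>n. F n q) \<longlonglongrightarrow> cdf semicircle q" by (simp add: F_def)
    qed
    then have "(\<lambda>n. cdf (spectral_measure n (w n \<omega>) (x n \<omega>)) y) \<longlonglongrightarrow> cdf semicircle y" for y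
      by (rule Lim_transform_eventually) (use eventually_ge_at_top[of 1] in eventually_elim, simp add: cdf_w)
    then show ?case by (simp add: weak_conv_m_def weak_conv_def)
  qed
qed

end

theorem theorem2p1:
  fixes M :: "'w measure"
    and \<beta> \<sigma> :: real
    and a b :: "nat \<Rightarrow> real"
    and lam w :: "nat \<Rightarrow> 'w \<Rightarrow> nat \<Rightarrow> real"
  assumes "prob_space M"
    and "\<beta> > 0"
    and "\<And>n. a n > 0" and "\<And>n. b n > 0"
    and "\<And>n. n \<ge> 1 \<Longrightarrow> a n > \<beta> / 2 * (real n - 1) \<and> b n > \<beta> / 2 * (real n - 1)"
    and "filterlim (\<lambda>n. a n / real n) at_top sequentially"
    and "\<sigma> > 0"
    and "(\<lambda>n. a n / b n) \<longlonglongrightarrow> \<sigma>"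
    and "(\<lambda>n. sqrt (b n / real n) * (\<sigma> - a n / b n)) \<longlonglongrightarrow> 0"
    and "\<And>n. n \<ge> 1 \<Longrightarrow>
           (\<lambda>\<omega>. (restrict (lam n \<omega>) {..<n}, restrict (w n \<omega>) {..<n}))
             \<in> M \<rightarrow>\<^sub>M (PiM {..<n} (\<lambda>_. lborel) \<Otimes>\<^sub>M PiM {..<n} (\<lambda>_. lborel))"
    and "\<And>n. n \<ge> 1 \<Longrightarrow>
           distr M (PiM {..<n} (\<lambda>_. lborel) \<Otimes>\<^sub>M PiM {..<n} (\<lambda>_. lborel))
             (\<lambda>\<omega>. (restrict (lam n \<omega>) {..<n}, restrict (w n \<omega>) {..<n}))
           = jacobi_ensemble n \<beta> (a n) (b n)"
  defines "resc \<equiv> \<lambda>n (x::real). (\<sigma> + 1) * sqrt (b n * (1 + \<sigma>) / (\<sigma> * real n * (\<beta> / 2)))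
                                 * (x - \<sigma> / (\<sigma> + 1))"
  shows "AE \<omega> in M.
           weak_conv_m (\<lambda>n. spectral_measure n (w n \<omega>) (\<lambda>i. resc n (lam n \<omega> i))) semicircle
         \<and> weak_conv_m (\<lambda>n. empirical_measure n (\<lambda>i. resc n (lam n \<omega> i))) semicircle"
proof -
  interpret S: jacobi_sequence \<beta> \<sigma> a b M lam w
    using assms(1-4,6-11)
    by (auto simp: jacobi_sequence_def jacobi_sequence_axioms_def jacobi_scaling_def
        jacobi_sample_def jacobi_sample_axioms_def)
  have "(\<lambda>i. resc n (lam n \<omega> i)) = S.x n \<omega>" for n \<omega>
    by (simp add: fun_eq_iff resc_def S.x_def S.s_def S.c_def)
  then show ?thesis using S.AE_spectral S.AE_empirical by simp
qed

end
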